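(* Let $G=\pi_1(\Gamma,Y,S)$ be the fundamental group of a finite graph of groups $(\Gamma,Y)$ all of whose edge groups $G_e$ ($e\in E(Y)$) are finite. Let $H,K\subseteq G$ be finitely generated subgroups which intersect trivially all the conjugates in $G$ of all the vertex groups $G_v$ ($v\in V(Y)$) (and are, therefore, free). Then $$\overline{r}(H\cap K)\leqslant 6m\cdot\overline{r}(H)\,\overline{r}(K),\qquad\text{where } m=\max_{e\in E(Y),\ g\in G}|g^{-1}G_eg\cap HK|.$$ In particular, $$\overline{r}(H\cap K)\leqslant 6m'\cdot\overline{r}(H)\,\overline{r}(K),$$ where $m'$ is the maximum of the orders of the edge groups of $(\Gamma,Y)$.
   Context: For a free group $F$, $r(F)$ denotes its rank and $\overline{r}(F)=\max(r(F)-1,0)$ its reduced rank. $HK=\{hk: h\in H,k\in K\}$ (a subset of $G$, not necessarily a subgroup). A graph $Y$ consists of a nonempty vertex set $V(Y)$, an edge set $E(Y)$, maps $\alpha,\omega:E(Y)\to V(Y)$ (beginning and end) and an inversion $e\mapsto e^{-1}$ on $E(Y)$ with $(e^{-1})^{-1}=e$, $e^{-1}\ne e$, $\alpha(e)=\omega(e^{-1})$. It is finite if $V(Y)$ and $E(Y)$ are finite. A graph of groups $(\Gamma,Y)$ consists of a connected graph $Y$, vertex groups $G_v$ ($v\in V(Y)$), edge groups $G_e$ ($e\in E(Y)$) with $G_e=G_{e^{-1}}$, and injective homomorphisms $\alpha_e:G_e\to G_{\alpha(e)}$. It is finite if the graph $Y$ is finite. For a maximal subtree $S$ of $Y$, the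 fundamental group $\pi_1(\Gamma,Y,S)$ is the quotient of the free product of all the $G_v$ ($v\in V(Y)$) and the free group with basis $\{t_e: e\in E(Y)\}$ by the normal closure of the elements $t_e^{-1}\alpha_e(g)t_e\,(\alpha_{e^{-1}}(g))^{-1}$ ($e\in E(Y)$, $g\in G_e$), $t_et_{e^{-1}}$ ($e\in E(Y)$), and $t_e$ ($e\in E(S)$). Up to isomorphism it does not depend on $S$. The vertex groups $G_v$ embed canonically in $\pi_1(\Gamma,Y,S)$ and are regarded as subgroups of it; each edge group $G_e$ is regarded as a subgroup of $G$ via $G_e\cong\alpha_e(G_e)\subseteq G_{\alpha(e)}\subseteq G$. *)

theory Defs
  imports
    "HOL-Algebra.Generated_Groups"
    "HOL-Library.Extended_Nat"
    "Graph_Theory.Bidirected_Digraph"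
    "Graph_Theory.Arc_Walk"
    "Graph_Theory.Digraph_Component"
begin

section \<open>Groups of words modulo relations\<close>

definition word_step :: "('a list \<times> 'a list) set \<Rightarrow> 'a list \<Rightarrow> 'a list \<Rightarrow> bool" where
  "word_step R u v \<longleftrightarrow> (\<exists>x y l r. (l, r) \<in> R \<and> u = x @ l @ y \<and> v = x @ r @ y)"

definition word_class :: "'a set \<Rightarrow> ('a list \<times> 'a list) set \<Rightarrow> 'a list \<Rightarrow> 'a list set" where
  "word_class A R u = {v \<in> lists A. equivclp (word_step R) u v}"

text \<open>The monoid presented by the alphabet \<open>A\<close> and the relations \<open>l = r\<close>, for \<open>(l, r) \<in> R\<close>.\<close>

definition word_group :: "'a set \<Rightarrow> ('a list \<times> 'a list) set \<Rightarrow> 'a list set monoid" where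
  "word_group A R =
    \<lparr>carrier = word_class A R ` lists A,
     monoid.mult = (\<lambda>X Y. \<Union>u\<in>X. \<Union>v\<in>Y. word_class A R (u @ v)),
     monoid.one = word_class A R []\<rparr>"

lemma word_cong_append:
  assumes "equivclp (word_step R) u u'"
  shows "equivclp (word_step R) (x @ u @ y) (x @ u' @ y)"
  using assms
proof (induction rule: equivclp_induct)
  case base
  then show ?case by simp
next
  case (step v w)
  have ext: "word_step R (x @ a @ y) (x @ b @ y)" if "word_step R a b" for a b
    using that unfolding word_step_def by (metis append.assoc)
  then have "equivclp (word_step R) (x @ v @ y) (x @ w @ y)"
    using step.hyps(2) by (meson equivclp_sym r_into_equivclp)
  with step.IH show ?case by (rule equivclp_trans)
qed

lemma word_cong_append2:
  assumes "equivclp (word_step R) u u'" "equivclp (word_step R) v v'"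
  shows "equivclp (word_step R) (u @ v) (u' @ v')"
  using word_cong_append[OF assms(1), of "[]" v] word_cong_append[OF assms(2), of u' "[]"]
  by (auto intro: equivclp_trans)

lemma word_class_eq_iff:
  assumes "u \<in> lists A" "v \<in> lists A"
  shows "word_class A R u = word_class A R v \<longleftrightarrow> equivclp (word_step R) u v"
  using assms unfolding word_class_def
  by (auto intro: equivclp_trans equivclp_sym)

lemma word_class_mult:
  assumes "u \<in> lists A" "v \<in> lists A"
  shows "word_class A R u \<otimes>\<^bsub>word_group A R\<^esub> word_class A R v = word_class A R (u @ v)"
proof -
  have eq: "word_class A R (u' @ v') = word_class A R (u @ v)"
    if "u' \<in> word_class A R u" "v' \<in> word_class A R v" for u' v'
    using that assms word_cong_append2[of R u u' v v']
    by (subst word_class_eq_iff) (auto simp: word_class_def intro: equivclp_sym)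
  have "u \<in> word_class A R u" "v \<in> word_class A R v"
    using assms by (auto simp: word_class_def)
  then have "(\<Union>u'\<in>word_class A R u. \<Union>v'\<in>word_class A R v. word_class A R (u' @ v'))
      = word_class A R (u @ v)"
    using eq by blast
  then show ?thesis
    by (simp add: word_group_def)
qed

lemma group_word_group:
  assumes inv: "\<And>a. a \<in> A \<Longrightarrow> \<exists>w\<in>lists A. equivclp (word_step R) (w @ [a]) []"
  shows "group (word_group A R)"
proof -
  have car: "carrier (word_group A R) = word_class A R ` lists A"
    and one: "\<one>\<^bsub>word_group A R\<^esub> = word_class A R []"
    by (simp_all add: word_group_def)
  have linv: "\<exists>w\<in>lists A. equivclp (word_step R) (w @ u) []" if "u \<in> lists A" for u
    using that
  proof (induction u)
    case Nil
    then show ?case by (intro bexI[of _ "[]"]) auto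
  next
    case (Cons a u)
    then obtain w where w: "w \<in> lists A" "equivclp (word_step R) (w @ u) []" by auto
    obtain b where b: "b \<in> lists A" "equivclp (word_step R) (b @ [a]) []"
      using inv[of a] Cons.hyps by auto
    have "equivclp (word_step R) (w @ (b @ [a]) @ u) (w @ [] @ u)"
      by (rule word_cong_append) (rule b)
    with w(2) have "equivclp (word_step R) ((w @ b) @ a # u) []"
      by (auto intro: equivclp_trans)
    with w b show ?case by (intro bexI[of _ "w @ b"]) auto
  qed
  show ?thesis
  proof (rule groupI)
    fix X assume "X \<in> carrier (word_group A R)"
    then obtain u where u: "u \<in> lists A" "X = word_class A R u" by (auto simp: car)
    obtain w where w: "w \<in> lists A" "equivclp (word_step R) (w @ u) []" using linv[OF u(1)] by auto
    have "word_class A R w \<otimes>\<^bsub>word_group A R\<^esub> X = \<one>\<^bsub>word_group A R\<^esub>"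
      using u w by (simp only: one word_class_mult word_class_eq_iff append_in_lists_conv lists.Nil simp_thms)
    with w(1) show "\<exists>Y\<in>carrier (word_group A R). Y \<otimes>\<^bsub>word_group A R\<^esub> X = \<one>\<^bsub>word_group A R\<^esub>"
      unfolding car by blast
  next
    fix X Y assume "X \<in> carrier (word_group A R)" "Y \<in> carrier (word_group A R)"
    then obtain u v where "u \<in> lists A" "v \<in> lists A" "X = word_class A R u" "Y = word_class A R v"
      by (auto simp only: car)
    then show "X \<otimes>\<^bsub>word_group A R\<^esub> Y \<in> carrier (word_group A R)"
      by (simp only: car word_class_mult append_in_lists_conv image_eqI simp_thms)
  next
    fix X Y Z assume "X \<in> carrier (word_group A R)" "Y \<in> carrier (word_group A R)"
      "Z \<in> carrier (word_group A R)"
    then obtain u v w where "u \<in> lists A" "v \<in> lists A" "w \<in> lists A"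
      "X = word_class A R u" "Y = word_class A R v" "Z = word_class A R w"
      by (auto simp only: car)
    then show "X \<otimes>\<^bsub>word_group A R\<^esub> Y \<otimes>\<^bsub>word_group A R\<^esub> Z
        = X \<otimes>\<^bsub>word_group A R\<^esub> (Y \<otimes>\<^bsub>word_group A R\<^esub> Z)"
      by (simp only: word_class_mult append_in_lists_conv append_assoc simp_thms)
  next
    fix X assume "X \<in> carrier (word_group A R)"
    then obtain u where "u \<in> lists A" "X = word_class A R u"
      by (auto simp only: car)
    then show "\<one>\<^bsub>word_group A R\<^esub> \<otimes>\<^bsub>word_group A R\<^esub> X = X"
      by (simp only: one word_class_mult lists.Nil append_Nil)
  qed (auto simp: car one)
qed


section \<open>Free groups and rank\<close>

text \<open>The letter \<open>(x, True)\<close> stands for the basis element \<open>x\<close>, and \<open>(x, False)\<close> for its inverse.\<close>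

definition free_group :: "'a set \<Rightarrow> ('a \<times> bool) list set monoid" where
  "free_group X = word_group (X \<times> UNIV) {([(x, b), (x, \<not> b)], []) |x b. x \<in> X}"

lemma group_free_group: "group (free_group X)"
  unfolding free_group_def
proof (rule group_word_group)
  fix a :: "'a \<times> bool" assume a: "a \<in> X \<times> UNIV"
  obtain x b where [simp]: "a = (x, b)" by (cases a)
  have "word_step {([(x, b), (x, \<not> b)], []) |x b. x \<in> X} ([(x, \<not> b)] @ [a]) []"
    using a unfolding word_step_def by fastforce
  then show "\<exists>w\<in>lists (X \<times> UNIV).
      equivclp (word_step {([(x, b), (x, \<not> b)], []) |x b. x \<in> X}) (w @ [a]) []"
    using a by (intro bexI[of _ "[(x, \<not> b)]"]) auto
qed

text \<open>A free group has a basis inside its own carrier, so index sets over the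
  element type of \<open>F\<close> suffice.\<close>

definition is_free_group :: "('a, 'b) monoid_scheme \<Rightarrow> bool" where
  "is_free_group F \<longleftrightarrow> (\<exists>X::'a set. F \<cong> free_group X)"

text \<open>The cardinality of a basis, with all infinite cardinalities identified.
  It is meaningful only if \<open>F\<close> is free.\<close>

definition free_rank :: "('a, 'b) monoid_scheme \<Rightarrow> enat" where
  "free_rank F = (THE n. \<exists>X::'a set. F \<cong> free_group X \<and> n = (if finite X then enat (card X) else \<infinity>))"

text \<open>Subtraction on \<^typ>\<open>enat\<close> is truncated: \<open>0 - 1 = 0\<close> and \<open>\<infinity> - 1 = \<infinity>\<close>.\<close>

definition reduced_rank :: "('a, 'b) monoid_scheme \<Rightarrow> enat" where
  "reduced_rank F = free_rank F - 1"

definition finitely_generated_subgroup :: "'a set \<Rightarrow> ('a, 'b) monoid_scheme \<Rightarrow> bool" where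
  "finitely_generated_subgroup H G \<longleftrightarrow>
    subgroup H G \<and> (\<exists>A. finite A \<and> A \<subseteq> carrier G \<and> H = generate G A)"

definition normal_closure :: "('a, 'b) monoid_scheme \<Rightarrow> 'a set \<Rightarrow> 'a set" where
  "normal_closure G A = \<Inter>{N. N \<lhd> G \<and> A \<subseteq> N}"

lemma normal_normal_closure:
  assumes "group G" "A \<subseteq> carrier G"
  shows "normal_closure G A \<lhd> G"
proof -
  interpret group G by fact
  have top: "carrier G \<in> {N. N \<lhd> G \<and> A \<subseteq> N}"
    using assms(2) by (auto simp: normal_inv_iff subgroup_self)
  have "subgroup (normal_closure G A) G"
    unfolding normal_closure_def using top
    by (intro subgroups_Inter) (auto dest: normal_imp_subgroup)
  then show ?thesis
    unfolding normal_inv_iff normal_closure_def by (auto simp: normal.inv_op_closed2)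
qed


section \<open>Trees\<close>

text \<open>
  A graph is a \<^locale>\<open>bidirected_digraph\<close>: \<open>\<alpha>\<close>, \<open>\<omega>\<close> are \<^const>\<open>tail\<close>, \<^const>\<open>head\<close>, and every
  geometric edge is a pair of arcs swapped by the inversion. The constant \<^const>\<open>tree\<close>
  does not apply, because it counts the closed walk \<open>e, e\<^sup>-\<^sup>1\<close> as a cycle.
\<close>

definition reduced_path :: "('e \<Rightarrow> 'e) \<Rightarrow> 'e list \<Rightarrow> bool" where
  "reduced_path inversion p \<longleftrightarrow> successively (\<lambda>a b. b \<noteq> inversion a) p"

definition bidirected_tree :: "('e \<Rightarrow> 'e) \<Rightarrow> ('v, 'e) pre_digraph \<Rightarrow> bool" where
  "bidirected_tree inversion T \<longleftrightarrow>
    inversion ` arcs T \<subseteq> arcs T \<and> connected T \<and>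
    \<not> (\<exists>p. pre_digraph.cycle T p \<and> reduced_path inversion p)"


section \<open>Graphs of groups\<close>

record ('v, 'e, 'g, 'h) graph_of_groups =
  base :: "('v, 'e) pre_digraph"
  inversion :: "'e \<Rightarrow> 'e"
  vgroup :: "'v \<Rightarrow> 'g monoid"
  egroup :: "'e \<Rightarrow> 'h monoid"
  emb :: "'e \<Rightarrow> 'h \<Rightarrow> 'g"

locale graph_of_groups =
  fixes \<Gamma> :: "('v, 'e, 'g, 'h) graph_of_groups"
  assumes bidirected: "bidirected_digraph (base \<Gamma>) (inversion \<Gamma>)"
    and connected: "connected (base \<Gamma>)"
    and group_vgroup: "v \<in> verts (base \<Gamma>) \<Longrightarrow> group (vgroup \<Gamma> v)"
    and group_egroup: "e \<in> arcs (base \<Gamma>) \<Longrightarrow> group (egroup \<Gamma> e)"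
    and egroup_inversion: "e \<in> arcs (base \<Gamma>) \<Longrightarrow> egroup \<Gamma> (inversion \<Gamma> e) = egroup \<Gamma> e"
    and emb_mon: "e \<in> arcs (base \<Gamma>) \<Longrightarrow> emb \<Gamma> e \<in> mon (egroup \<Gamma> e) (vgroup \<Gamma> (tail (base \<Gamma>) e))"

definition maximal_subtree ::
    "('v, 'e) pre_digraph \<Rightarrow> ('v, 'e, 'g, 'h) graph_of_groups \<Rightarrow> bool" where
  "maximal_subtree S \<Gamma> \<longleftrightarrow>
    pre_digraph.max_subgraph (base \<Gamma>) (bidirected_tree (inversion \<Gamma>)) S"


section \<open>The fundamental group\<close>

text \<open>\<open>Stable e True\<close> stands for \<open>t\<^sub>e\<close>, and \<open>Stable e False\<close> for its inverse.\<close>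

datatype ('v, 'e, 'g) letter = Vertex 'v 'g | Stable 'e bool

definition letters :: "('v, 'e, 'g, 'h) graph_of_groups \<Rightarrow> ('v, 'e, 'g) letter set" where
  "letters \<Gamma> =
    {Vertex v g |v g. v \<in> verts (base \<Gamma>) \<and> g \<in> carrier (vgroup \<Gamma> v)} \<union>
    {Stable e b |e b. e \<in> arcs (base \<Gamma>)}"

definition letter_rels ::
    "('v, 'e, 'g, 'h) graph_of_groups \<Rightarrow> (('v, 'e, 'g) letter list \<times> ('v, 'e, 'g) letter list) set" where
  "letter_rels \<Gamma> =
    {([Vertex v g, Vertex v h], [Vertex v (g \<otimes>\<^bsub>vgroup \<Gamma> v\<^esub> h)]) |v g h.
       v \<in> verts (base \<Gamma>) \<and> g \<in> carrier (vgroup \<Gamma> v) \<and> h \<in> carrier (vgroup \<Gamma> v)} \<union>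
    {([Vertex v \<one>\<^bsub>vgroup \<Gamma> v\<^esub>], []) |v. v \<in> verts (base \<Gamma>)} \<union>
    {([Stable e b, Stable e (\<not> b)], []) |e b. e \<in> arcs (base \<Gamma>)}"

text \<open>The free product of all vertex groups and the free group on the \<open>t\<^sub>e\<close>.\<close>

definition free_prod :: "('v, 'e, 'g, 'h) graph_of_groups \<Rightarrow> ('v, 'e, 'g) letter list set monoid" where
  "free_prod \<Gamma> = word_group (letters \<Gamma>) (letter_rels \<Gamma>)"

definition vertex_elt :: "('v, 'e, 'g, 'h) graph_of_groups \<Rightarrow> 'v \<Rightarrow> 'g \<Rightarrow> ('v, 'e, 'g) letter list set" where
  "vertex_elt \<Gamma> v g = word_class (letters \<Gamma>) (letter_rels \<Gamma>) [Vertex v g]"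

definition stable_elt :: "('v, 'e, 'g, 'h) graph_of_groups \<Rightarrow> 'e \<Rightarrow> ('v, 'e, 'g) letter list set" where
  "stable_elt \<Gamma> e = word_class (letters \<Gamma>) (letter_rels \<Gamma>) [Stable e True]"

definition relators ::
    "('v, 'e, 'g, 'h) graph_of_groups \<Rightarrow> ('v, 'e) pre_digraph \<Rightarrow> ('v, 'e, 'g) letter list set set" where
  "relators \<Gamma> S = (let P = free_prod \<Gamma>; Y = base \<Gamma>; rev = inversion \<Gamma> in
    {inv\<^bsub>P\<^esub> (stable_elt \<Gamma> e) \<otimes>\<^bsub>P\<^esub> vertex_elt \<Gamma> (tail Y e) (emb \<Gamma> e g) \<otimes>\<^bsub>P\<^esub> stable_elt \<Gamma> e
       \<otimes>\<^bsub>P\<^esub> inv\<^bsub>P\<^esub> (vertex_elt \<Gamma> (tail Y (rev e)) (emb \<Gamma> (rev e) g)) |e g.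
       e \<in> arcs Y \<and> g \<in> carrier (egroup \<Gamma> e)} \<union>
    {stable_elt \<Gamma> e \<otimes>\<^bsub>P\<^esub> stable_elt \<Gamma> (rev e) |e. e \<in> arcs Y} \<union>
    {stable_elt \<Gamma> e |e. e \<in> arcs S})"

definition fundamental_group ::
    "('v, 'e, 'g, 'h) graph_of_groups \<Rightarrow> ('v, 'e) pre_digraph \<Rightarrow> ('v, 'e, 'g) letter list set set monoid" where
  "fundamental_group \<Gamma> S = free_prod \<Gamma> Mod normal_closure (free_prod \<Gamma>) (relators \<Gamma> S)"

text \<open>The images of \<open>G\<^sub>v\<close> and of \<open>G\<^sub>e \<cong> \<alpha>\<^sub>e(G\<^sub>e) \<subseteq> G\<^bsub>\<alpha>(e)\<^esub>\<close> in the fundamental group.\<close>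

definition vertex_hom ::
    "('v, 'e, 'g, 'h) graph_of_groups \<Rightarrow> ('v, 'e) pre_digraph \<Rightarrow> 'v \<Rightarrow> 'g \<Rightarrow> ('v, 'e, 'g) letter list set set" where
  "vertex_hom \<Gamma> S v g =
    normal_closure (free_prod \<Gamma>) (relators \<Gamma> S) #>\<^bsub>free_prod \<Gamma>\<^esub> vertex_elt \<Gamma> v g"

definition vertex_subgroup ::
    "('v, 'e, 'g, 'h) graph_of_groups \<Rightarrow> ('v, 'e) pre_digraph \<Rightarrow> 'v \<Rightarrow> ('v, 'e, 'g) letter list set set set" where
  "vertex_subgroup \<Gamma> S v = vertex_hom \<Gamma> S v ` carrier (vgroup \<Gamma> v)"

definition edge_subgroup ::
    "('v, 'e, 'g, 'h) graph_of_groups \<Rightarrow> ('v, 'e) pre_digraph \<Rightarrow> 'e \<Rightarrow> ('v, 'e, 'g) letter list set set set" where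
  "edge_subgroup \<Gamma> S e = vertex_hom \<Gamma> S (tail (base \<Gamma>) e) ` emb \<Gamma> e ` carrier (egroup \<Gamma> e)"

context graph_of_groups
begin

lemma group_free_prod: "group (free_prod \<Gamma>)"
  unfolding free_prod_def
proof (rule group_word_group)
  fix a assume a: "a \<in> letters \<Gamma>"
  then consider v g where "a = Vertex v g" "v \<in> verts (base \<Gamma>)" "g \<in> carrier (vgroup \<Gamma> v)"
    | e b where "a = Stable e b" "e \<in> arcs (base \<Gamma>)"
    by (auto simp: letters_def)
  then show "\<exists>w\<in>lists (letters \<Gamma>). equivclp (word_step (letter_rels \<Gamma>)) (w @ [a]) []"
  proof cases
    case 1
    interpret V: group "vgroup \<Gamma> v" using 1 group_vgroup by blast
    have "([Vertex v (inv\<^bsub>vgroup \<Gamma> v\<^esub> g), a], [Vertex v \<one>\<^bsub>vgroup \<Gamma> v\<^esub>]) \<in> letter_rels \<Gamma>"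
      unfolding letter_rels_def using 1 V.l_inv[OF 1(3)] V.inv_closed[OF 1(3)] by fastforce
    then have "word_step (letter_rels \<Gamma>) [Vertex v (inv\<^bsub>vgroup \<Gamma> v\<^esub> g), a] [Vertex v \<one>\<^bsub>vgroup \<Gamma> v\<^esub>]"
      unfolding word_step_def by (metis append_Nil append_Nil2)
    moreover have "([Vertex v \<one>\<^bsub>vgroup \<Gamma> v\<^esub>], []) \<in> letter_rels \<Gamma>"
      unfolding letter_rels_def using 1 by blast
    then have "word_step (letter_rels \<Gamma>) [Vertex v \<one>\<^bsub>vgroup \<Gamma> v\<^esub>] []"
      unfolding word_step_def by (metis append_Nil append_Nil2)
    ultimately have "equivclp (word_step (letter_rels \<Gamma>)) [Vertex v (inv\<^bsub>vgroup \<Gamma> v\<^esub> g), a] []"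
      by (meson equivclp_trans r_into_equivclp)
    moreover have "[Vertex v (inv\<^bsub>vgroup \<Gamma> v\<^esub> g)] \<in> lists (letters \<Gamma>)"
      using 1 by (auto simp: letters_def)
    ultimately show ?thesis by (metis append_Cons append_Nil)
  next
    case 2
    have "([Stable e (\<not> b), a], []) \<in> letter_rels \<Gamma>"
      unfolding letter_rels_def using 2 by auto
    then have "word_step (letter_rels \<Gamma>) [Stable e (\<not> b), a] []"
      unfolding word_step_def by (metis append_Nil append_Nil2)
    moreover have "[Stable e (\<not> b)] \<in> lists (letters \<Gamma>)"
      using 2 by (auto simp: letters_def)
    ultimately show ?thesis by (metis append_Cons append_Nil r_into_equivclp)
  qed
qed

lemma vertex_elt_closed:
  "v \<in> verts (base \<Gamma>) \<Longrightarrow> g \<in> carrier (vgroup \<Gamma> v) \<Longrightarrow> vertex_elt \<Gamma> v g \<in> carrier (free_prod \<Gamma>)"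
  unfolding vertex_elt_def free_prod_def word_group_def
  by (simp only: partial_object.simps, rule imageI) (simp add: letters_def)

lemma stable_elt_closed: "e \<in> arcs (base \<Gamma>) \<Longrightarrow> stable_elt \<Gamma> e \<in> carrier (free_prod \<Gamma>)"
  unfolding stable_elt_def free_prod_def word_group_def
  by (simp only: partial_object.simps, rule imageI) (auto simp: letters_def)

lemma relators_closed:
  assumes "arcs S \<subseteq> arcs (base \<Gamma>)"
  shows "relators \<Gamma> S \<subseteq> carrier (free_prod \<Gamma>)"
proof -
  interpret P: group "free_prod \<Gamma>" by (rule group_free_prod)
  interpret Y: bidirected_digraph "base \<Gamma>" "inversion \<Gamma>" by (rule bidirected)
  have *: "vertex_elt \<Gamma> (tail (base \<Gamma>) e) (emb \<Gamma> e g) \<in> carrier (free_prod \<Gamma>)"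
    if "e \<in> arcs (base \<Gamma>)" "g \<in> carrier (egroup \<Gamma> e)" for e g
    using that emb_mon[of e] by (intro vertex_elt_closed) (auto simp: mon_def hom_def)
  have **: "vertex_elt \<Gamma> (tail (base \<Gamma>) (inversion \<Gamma> e)) (emb \<Gamma> (inversion \<Gamma> e) g) \<in> carrier (free_prod \<Gamma>)"
    if "e \<in> arcs (base \<Gamma>)" "g \<in> carrier (egroup \<Gamma> e)" for e g
    using that egroup_inversion[of e] by (intro *) auto
  show ?thesis
    unfolding relators_def Let_def using assms * **
    by (auto intro!: P.m_closed P.inv_closed stable_elt_closed simp del: Y.tail_arev)
qed

lemma group_fundamental_group:
  assumes "arcs S \<subseteq> arcs (base \<Gamma>)"
  shows "group (fundamental_group \<Gamma> S)"
  unfolding fundamental_group_def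
  by (intro normal.factorgroup_is_group normal_normal_closure group_free_prod relators_closed assms)

end

end

theory Submission
  imports Defs
begin

text \<open>\<open>G\<close> acts without inversions on its Bass-Serre tree, and the hypothesis says that \<open>H\<close> and \<open>K\<close>
  act freely on the vertices. By ping-pong with the half-spaces at the edges leaving a fundamental
  subtree, a group acting freely on a tree with finite quotient graph is free, and twice its rank
  minus two is the sum of \<open>deg - 2\<close> over the vertices of the quotient.

  Take leafless cofinite invariant subtrees for \<open>H\<close> and \<open>K\<close>. If \<open>H \<inter> K\<close> is nontrivial, it acts on their
  intersection, which is nonempty. An edge orbit of \<open>H \<inter> K\<close> determines a pair of edge orbits of \<open>H\<close> and \<open>K\<close>,
  and at most \<open>m\<close> orbits determine the same pair. Hence the vertex orbits of \<open>H \<inter> K\<close> over a pair of vertices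
  of degrees \<open>p\<close> and \<open>q\<close> have degrees at most \<open>min p q\<close> that add up to at most \<open>m p q\<close>, so their
  \<open>deg - 2\<close> add up to at most \<open>3 m (p - 2) (q - 2)\<close>. Summation over all pairs gives the factor \<open>6 m\<close>.

  Of the tree only the property is used that it is connected and that every edge is a bridge.
  This says that every parity cocycle on its edges is a coboundary, which is read off
  from the presentation of \<open>G\<close>.\<close>

section \<open>Free groups\<close>

text \<open>The set \<open>HK\<close> enters as follows. An edge lying over a given pair of edge
  orbits is reached from fixed representatives both by \<open>H\<close> and by \<open>K\<close>;
  comparing it with one reference edge over the same pair gives an element of \<open>HK\<close> that
  stabilises an edge of the tree, and edge stabilisers are conjugates of edge groups. The factor 3
  is the largest value of \<open>q / (q - 2)\<close> for \<open>q \<ge> 3\<close>. It becomes 6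
  because each sum of \<open>deg - 2\<close> is twice a reduced rank: the factor 2 appears twice on
  the right and once on the left. Subtrees must be leafless because a leaf contributes -1, and the
  sums are multiplied term by term. The obstacle is that circuits in the Bass-Serre graph are
  usually excluded by normal forms in \<open>G\<close>. Cohomology with coefficients in Z/2 takes
  their place: the indicator of a single edge and its inverse has a potential, which jumps across
  this edge and nowhere else. The same potential yields the bridge property, the edge stabilisers
  and the absence of inversions.\<close>

text \<open>\<open>equivclp\<close> itself allows arbitrary words, so membership in
  \<open>lists A\<close> is carried along in the induction; therefore \<open>F\<close> has to
  respect a relation only in contexts over \<open>A\<close>.\<close>

lemma word_cong_invariant:
  assumes R: "\<And>l r. (l, r) \<in> R \<Longrightarrow> l \<in> lists A \<and> r \<in> lists A"
    and F: "\<And>x y l r. \<lbrakk>x \<in> lists A; y \<in> lists A; (l, r) \<in> R\<rbrakk> \<Longrightarrow> F (x @ l @ y) = F (x @ r @ y)"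
    and uv: "equivclp (word_step R) u v" and u: "u \<in> lists A"
  shows "v \<in> lists A \<and> F v = F u"
  using uv
proof (induction rule: equivclp_induct)
  case base
  then show ?case using u by simp
next
  case (step v w)
  then consider "word_step R v w" | "word_step R w v" by blast
  then show ?case
  proof cases
    case 1
    then obtain x y l r where lr: "(l, r) \<in> R" and vw: "v = x @ l @ y" "w = x @ r @ y"
      unfolding word_step_def by blast
    show ?thesis using R[OF lr] F[OF _ _ lr, of x y] step.IH unfolding vw by auto
  next
    case 2
    then obtain x y l r where lr: "(l, r) \<in> R" and vw: "w = x @ l @ y" "v = x @ r @ y"
      unfolding word_step_def by blast
    show ?thesis using R[OF lr] F[OF _ _ lr, of x y] step.IH unfolding vw by auto
  qed
qed

definition free_rels :: "'x set \<Rightarrow> (('x \<times> bool) list \<times> ('x \<times> bool) list) set" where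
  "free_rels X = {([(x, b), (x, \<not> b)], []) |x b. x \<in> X}"

definition free_class :: "'x set \<Rightarrow> ('x \<times> bool) list \<Rightarrow> ('x \<times> bool) list set" where
  "free_class X = word_class (X \<times> UNIV) (free_rels X)"

lemma free_group_alt: "free_group X = word_group (X \<times> UNIV) (free_rels X)"
  by (simp add: free_group_def free_rels_def)

lemma carrier_free_group: "carrier (free_group X) = free_class X ` lists (X \<times> UNIV)"
  by (simp add: free_group_alt word_group_def free_class_def)

lemma one_free_group: "\<one>\<^bsub>free_group X\<^esub> = free_class X []"
  by (simp add: free_group_alt word_group_def free_class_def)

lemma free_class_mult:
  assumes "u \<in> lists (X \<times> UNIV)" "v \<in> lists (X \<times> UNIV)"
  shows "free_class X u \<otimes>\<^bsub>free_group X\<^esub> free_class X v = free_class X (u @ v)"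
  using assms by (simp only: free_group_alt free_class_def word_class_mult)

lemma free_class_eq_iff:
  assumes "u \<in> lists (X \<times> UNIV)" "v \<in> lists (X \<times> UNIV)"
  shows "free_class X u = free_class X v \<longleftrightarrow> equivclp (word_step (free_rels X)) u v"
  using assms by (simp only: free_class_def word_class_eq_iff)

text \<open>Functions on classes are defined by evaluating a chosen representative. The choice is
  equivalent to the word at hand, so an invariant of words descends to classes.\<close>

lemma free_class_SOME:
  assumes w: "w \<in> lists (X \<times> UNIV)"
  shows "equivclp (word_step (free_rels X)) w
    (SOME w'. w' \<in> lists (X \<times> UNIV) \<and> free_class X w' = free_class X w)"
proof -
  define w' where "w' = (SOME w'. w' \<in> lists (X \<times> UNIV) \<and> free_class X w' = free_class X w)"
  have "w' \<in> lists (X \<times> UNIV) \<and> free_class X w' = free_class X w"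
    unfolding w'_def by (rule someI[of _ w]) (use w in simp)
  then show ?thesis unfolding w'_def[symmetric] using free_class_eq_iff[OF w] by metis
qed

lemma free_rels_lists: "(l, r) \<in> free_rels X \<Longrightarrow> l \<in> lists (X \<times> UNIV) \<and> r \<in> lists (X \<times> UNIV)"
  by (auto simp: free_rels_def)

lemma free_class_cancel:
  assumes "x \<in> X"
  shows "free_class X [(x, b), (x, \<not> b)] = free_class X []"
proof -
  have "word_step (free_rels X) [(x, b), (x, \<not> b)] []"
    using assms unfolding word_step_def free_rels_def by fastforce
  then show ?thesis using assms by (subst free_class_eq_iff) auto
qed

definition reduced_word :: "('x \<times> bool) list \<Rightarrow> bool" where
  "reduced_word w \<longleftrightarrow> successively (\<lambda>p q. q \<noteq> (fst p, \<not> snd p)) w"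

lemma not_successivelyD:
  "\<not> successively P w \<Longrightarrow> \<exists>x a b y. w = x @ a # b # y \<and> \<not> P a b"
proof (induction w)
  case (Cons c w)
  show ?case
  proof (cases "successively P w")
    case False
    then obtain x a b y where "w = x @ a # b # y" "\<not> P a b" using Cons.IH by blast
    then show ?thesis by (metis append_Cons)
  next
    case True
    then obtain d w' where "w = d # w'" "\<not> P c d"
      using Cons.prems by (cases w) auto
    then show ?thesis by (metis append_Nil)
  qed
qed simp

text \<open>Cancelling an adjacent inverse pair keeps the class and shortens the word, so induction
  on the length applies.\<close>

lemma reduced_word_exists:
  assumes "w \<in> lists (X \<times> UNIV)"
  shows "\<exists>w'\<in>lists (X \<times> UNIV). reduced_word w' \<and> free_class X w' = free_class X w"
  using assms
proof (induction w rule: length_induct)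
  case (1 w)
  show ?case
  proof (cases "reduced_word w")
    case False
    then obtain x p q y where w: "w = x @ p # q # y" and q: "q = (fst p, \<not> snd p)"
      unfolding reduced_word_def by (blast dest: not_successivelyD)
    obtain z b where p: "p = (z, b)" by (cases p)
    have "word_step (free_rels X) w (x @ y)"
      unfolding word_step_def using 1(2) unfolding w q p free_rels_def
      by (intro exI[of _ x] exI[of _ y] exI[of _ "[(z, b), (z, \<not> b)]"] exI[of _ "[]"]) auto
    then have "free_class X (x @ y) = free_class X w"
      using 1(2) w by (subst free_class_eq_iff) (auto intro: equivclp_sym)
    moreover have "length (x @ y) < length w" "x @ y \<in> lists (X \<times> UNIV)"
      using 1(2) w by auto
    ultimately show ?thesis using 1(1) by metis
  qed (use 1 in blast)
qed

section \<open>Evaluation of words in a group and a criterion for freeness\<close>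

context group
begin

definition signed :: "'a \<times> bool \<Rightarrow> 'a" where
  "signed p = (if snd p then fst p else inv (fst p))"

definition list_prod :: "'a list \<Rightarrow> 'a" where
  "list_prod gs = foldr (\<otimes>) gs \<one>"

lemma list_prod_simps [simp]:
  "list_prod [] = \<one>" "list_prod (g # gs) = g \<otimes> list_prod gs"
  by (simp_all add: list_prod_def)

lemma list_prod_closed [simp]: "gs \<in> lists (carrier G) \<Longrightarrow> list_prod gs \<in> carrier G"
  by (induction gs) auto

lemma list_prod_append:
  "gs \<in> lists (carrier G) \<Longrightarrow> hs \<in> lists (carrier G) \<Longrightarrow>
    list_prod (gs @ hs) = list_prod gs \<otimes> list_prod hs"
  by (induction gs) (auto simp: m_assoc)

lemma signed_closed: "p \<in> X \<times> UNIV \<Longrightarrow> X \<subseteq> carrier G \<Longrightarrow> signed p \<in> carrier G"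
  by (auto simp: signed_def)

lemma map_signed_closed:
  "X \<subseteq> carrier G \<Longrightarrow> w \<in> lists (X \<times> UNIV) \<Longrightarrow> map signed w \<in> lists (carrier G)"
  using signed_closed by fastforce

text \<open>Evaluation of words is a homomorphism onto the generated subgroup. As every class
  contains a reduced word, the assumption makes its kernel trivial.\<close>

theorem free_group_iso_subgroup:
  assumes X: "X \<subseteq> carrier G"
    and reduced: "\<And>w. \<lbrakk>w \<in> lists (X \<times> UNIV); w \<noteq> []; reduced_word w\<rbrakk> \<Longrightarrow> list_prod (map signed w) \<noteq> \<one>"
  shows "free_group X \<cong> G\<lparr>carrier := generate G X\<rparr>"
proof -
  let ?L = "lists (X \<times> (UNIV :: bool set))"
  let ?ev = "\<lambda>w. list_prod (map signed w)"
  define \<phi> where "\<phi> U = ?ev (SOME w. w \<in> ?L \<and> free_class X w = U)" for U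
  have ev_append: "?ev (u @ v) = ?ev u \<otimes> ?ev v" if "u \<in> ?L" "v \<in> ?L" for u v
    using that map_signed_closed[OF X] by (simp add: list_prod_append)
  have ev_closed: "?ev u \<in> carrier G" if "u \<in> ?L" for u
    using that map_signed_closed[OF X] by simp
  have ev_cong: "?ev v = ?ev u" if "equivclp (word_step (free_rels X)) u v" "u \<in> ?L" for u v
  proof (rule word_cong_invariant[THEN conjunct2, OF free_rels_lists])
    fix x y l r assume xy: "x \<in> ?L" "y \<in> ?L" and lr: "(l, r) \<in> free_rels X"
    then have lr': "l \<in> ?L" "r \<in> ?L" using free_rels_lists by blast+
    obtain z b where z: "l = [(z, b), (z, \<not> b)]" "r = []" "z \<in> X"
      using lr unfolding free_rels_def by blast
    then have "z \<in> carrier G" using X by blast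
    then have "?ev l = ?ev r" unfolding z by (cases b) (simp_all add: signed_def)
    then have "?ev x \<otimes> (?ev l \<otimes> ?ev y) = ?ev x \<otimes> (?ev r \<otimes> ?ev y)" by simp
    then show "?ev (x @ l @ y) = ?ev (x @ r @ y)"
      using ev_append xy lr' append_in_lists_conv by metis
  qed (use that in auto)
  have \<phi>: "\<phi> (free_class X w) = ?ev w" if w: "w \<in> ?L" for w
  proof -
    show ?thesis
      using free_class_SOME[OF w] w unfolding \<phi>_def by (rule ev_cong)
  qed
  have "\<phi> \<in> hom (free_group X) G"
  proof (rule homI)
    fix U assume "U \<in> carrier (free_group X)"
    then obtain u where u: "u \<in> ?L" "U = free_class X u" unfolding carrier_free_group by blast
    then show "\<phi> U \<in> carrier G" using \<phi> ev_closed by simp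
    fix V assume "V \<in> carrier (free_group X)"
    then obtain v where v: "v \<in> ?L" "V = free_class X v" unfolding carrier_free_group by blast
    show "\<phi> (U \<otimes>\<^bsub>free_group X\<^esub> V) = \<phi> U \<otimes> \<phi> V"
      using u v \<phi> ev_append by (metis append_in_lists_conv free_class_mult)
  qed
  then interpret \<phi>: group_hom "free_group X" G \<phi>
    by (simp add: group_hom_def group_hom_axioms_def group_free_group)
  have "inj_on \<phi> (carrier (free_group X))"
      unfolding \<phi>.inj_on_one_iff
  proof (intro allI impI)
    fix U assume U: "U \<in> carrier (free_group X)" "\<phi> U = \<one>"
    then obtain u where "u \<in> ?L" "U = free_class X u" unfolding carrier_free_group by blast
    then obtain w where w: "w \<in> ?L" "reduced_word w" "U = free_class X w"
      using reduced_word_exists by metis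
    then have "w = []" using reduced[of w] U(2) \<phi> by auto
    then show "U = \<one>\<^bsub>free_group X\<^esub>" using w by (simp add: one_free_group)
  qed
  moreover have "\<phi> ` carrier (free_group X) = generate G X"
  proof
    have "?ev w \<in> generate G X" if "w \<in> ?L" for w
      using that
    proof (induction w)
      case (Cons p w)
      then have "signed p \<in> generate G X"
        unfolding signed_def by (auto intro: generate.incl generate.inv)
      then show ?case using Cons by (simp add: generate.eng)
    qed (simp add: generate.one)
    then have "\<phi> (free_class X w) \<in> generate G X" if "w \<in> ?L" for w
      using \<phi>[OF that] that by simp
    then show "\<phi> ` carrier (free_group X) \<subseteq> generate G X"
      unfolding carrier_free_group by blast
    have sub: "subgroup (\<phi> ` carrier (free_group X)) G"
      by (rule \<phi>.img_is_subgroup)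
    have "x \<in> \<phi> ` carrier (free_group X)" if "x \<in> X" for x
    proof -
      have "?ev [(x, True)] = x" using that X by (auto simp: signed_def)
      moreover have w: "[(x, True)] \<in> ?L" using that by simp
      ultimately have "x = \<phi> (free_class X [(x, True)])" using \<phi>[OF w] by simp
      then show ?thesis unfolding carrier_free_group using w by (rule image_eqI[OF _ imageI])
    qed
    then show "generate G X \<subseteq> \<phi> ` carrier (free_group X)"
      using generate_subgroup_incl[OF _ sub] by blast
  qed
  ultimately have "\<phi> \<in> iso (free_group X) (G\<lparr>carrier := generate G X\<rparr>)"
    using \<phi>.homh by (auto simp: iso_def bij_betw_def hom_def)
  then show ?thesis by (auto simp: is_iso_def)
qed

end

text \<open>A basis is recovered up to cardinality from the parity characters of the group.\<close>

definition parity_char :: "('a, 'b) monoid_scheme \<Rightarrow> ('a \<Rightarrow> bool) \<Rightarrow> bool" where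
  "parity_char G P \<longleftrightarrow> (\<forall>u\<in>carrier G. \<forall>v\<in>carrier G. P (u \<otimes>\<^bsub>G\<^esub> v) = (P u \<noteq> P v))"

lemma parity_char_one:
  assumes "monoid G" "parity_char G P"
  shows "\<not> P \<one>\<^bsub>G\<^esub>"
  using assms(2) monoid.one_closed[OF assms(1)] monoid.l_one[OF assms(1)]
  unfolding parity_char_def by metis

text \<open>A homomorphism to Z/2 takes the same value on a basis element and on its inverse, so its
  values on the basis determine it on every word.\<close>

lemma parity_char_free_eqI:
  assumes P: "parity_char (free_group X) P" and Q: "parity_char (free_group X) Q"
    and eq: "\<And>x. x \<in> X \<Longrightarrow> P (free_class X [(x, True)]) = Q (free_class X [(x, True)])"
    and U: "U \<in> carrier (free_group X)"
  shows "P U = Q U"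
proof -
  interpret F: group "free_group X" by (rule group_free_group)
  let ?L = "lists (X \<times> (UNIV :: bool set))"
  have mult: "R (free_class X (u @ v)) = (R (free_class X u) \<noteq> R (free_class X v))"
    if "parity_char (free_group X) R" "u \<in> ?L" "v \<in> ?L" for R u v
    using that(1)[unfolded parity_char_def carrier_free_group, rule_format, of "free_class X u" "free_class X v"]
      free_class_mult[OF that(2,3)] that(2,3) by (metis imageI)
  have one: "\<not> R (free_class X [])" if "parity_char (free_group X) R" for R
    using parity_char_one[OF F.monoid_axioms that] by (simp add: one_free_group)
  have letter: "R (free_class X [(x, b)]) = R (free_class X [(x, True)])"
    if "parity_char (free_group X) R" "x \<in> X" for R x b
    using mult[OF that(1), of "[(x, True)]" "[(x, False)]"] that(2) one[OF that(1)]
      free_class_cancel[OF that(2), of True] by (cases b) auto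
  have "P (free_class X u) = Q (free_class X u)" if "u \<in> ?L" for u
    using that
  proof (induction u)
    case Nil
    then show ?case using one[OF P] one[OF Q] by simp
  next
    case (Cons p u)
    obtain x b where p: "p = (x, b)" "x \<in> X" using Cons by auto
    show ?case
      using mult[OF P, of "[p]" u] mult[OF Q, of "[p]" u] letter[OF P p(2), of b]
        letter[OF Q p(2), of b] eq[OF p(2)] Cons p by auto
  qed
  then show ?thesis using U unfolding carrier_free_group by blast
qed

text \<open>The number of letters from \<open>A\<close>, taken modulo 2, survives cancellation,
  because a cancelling pair consists of two letters with the same basis element.\<close>

lemma parity_char_free_exists:
  obtains P where "parity_char (free_group X) P"
    "\<And>x. x \<in> X \<Longrightarrow> P (free_class X [(x, True)]) \<longleftrightarrow> x \<in> A"
proof -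
  let ?L = "lists (X \<times> (UNIV :: bool set))"
  define N where "N w = odd (length (filter (\<lambda>p. fst p \<in> A) w))" for w :: "('a \<times> bool) list"
  define P where "P U = N (SOME w. w \<in> ?L \<and> free_class X w = U)" for U
  have N_cong: "N v = N u" if "equivclp (word_step (free_rels X)) u v" "u \<in> ?L" for u v
  proof (rule word_cong_invariant[THEN conjunct2, OF free_rels_lists])
    fix x y l r assume "(l, r) \<in> free_rels X"
    then obtain z b where "l = [(z, b), (z, \<not> b)]" "r = []" unfolding free_rels_def by blast
    then show "N (x @ l @ y) = N (x @ r @ y)" by (simp add: N_def)
  qed (use that in auto)
  have PN: "P (free_class X w) = N w" if w: "w \<in> ?L" for w
  proof -
    show ?thesis
      using free_class_SOME[OF w] w unfolding P_def by (rule N_cong)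
  qed
  have "parity_char (free_group X) P"
    unfolding parity_char_def
  proof (intro ballI)
    fix U V assume "U \<in> carrier (free_group X)" "V \<in> carrier (free_group X)"
    then obtain u v where uv: "u \<in> ?L" "U = free_class X u" "v \<in> ?L" "V = free_class X v"
      unfolding carrier_free_group by blast
    then have "P (U \<otimes>\<^bsub>free_group X\<^esub> V) = N (u @ v)"
      using PN free_class_mult by (metis append_in_lists_conv)
    also have "\<dots> = (N u \<noteq> N v)" by (auto simp: N_def)
    finally show "P (U \<otimes>\<^bsub>free_group X\<^esub> V) = (P U \<noteq> P V)" using uv PN by simp
  qed
  moreover have "P (free_class X [(x, True)]) \<longleftrightarrow> x \<in> A" if "x \<in> X" for x
    using that PN[of "[(x, True)]"] by (auto simp: N_def)
  ultimately show ?thesis by (rule that)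
qed

text \<open>Homomorphisms to Z/2 correspond to subsets of a basis. Pulling them back along the
  isomorphism injects \<open>Pow Y\<close> into \<open>Pow X\<close>, and powers of two are
  compared.\<close>

lemma free_group_iso_card_le:
  fixes X :: "'a set" and Y :: "'b set"
  assumes iso: "free_group X \<cong> free_group Y" and fin: "finite X"
  shows "finite Y \<and> card Y \<le> card X"
proof -
  obtain \<phi> where \<phi>: "\<phi> \<in> iso (free_group X) (free_group Y)"
    using iso by (auto simp: is_iso_def)
  then have hom: "\<phi> \<in> hom (free_group X) (free_group Y)"
    and bij: "bij_betw \<phi> (carrier (free_group X)) (carrier (free_group Y))"
    by (auto simp: iso_def)
  have "\<forall>A. \<exists>P. parity_char (free_group Y) P \<and> (\<forall>y\<in>Y. P (free_class Y [(y, True)]) \<longleftrightarrow> y \<in> A)"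
    using parity_char_free_exists[of Y] by metis
  then obtain \<chi> where \<chi>: "\<And>A. parity_char (free_group Y) (\<chi> A)"
      "\<And>A y. y \<in> Y \<Longrightarrow> \<chi> A (free_class Y [(y, True)]) \<longleftrightarrow> y \<in> A"
    by metis
  \<comment> \<open>\<open>T A\<close> is the subset of \<open>X\<close> that describes the pullback
    of the character belonging to \<open>A\<close>.\<close>
  define T where "T A = {x \<in> X. \<chi> A (\<phi> (free_class X [(x, True)]))}" for A
  have pull: "parity_char (free_group X) (\<chi> A \<circ> \<phi>)" for A
    using \<chi>(1)[of A] hom unfolding parity_char_def hom_def by auto
  have "inj_on T (Pow Y)"
  proof (rule inj_onI)
    fix A B assume AB: "A \<in> Pow Y" "B \<in> Pow Y" "T A = T B"
    have pointwise: "(\<chi> A \<circ> \<phi>) U = (\<chi> B \<circ> \<phi>) U" if "U \<in> carrier (free_group X)" for U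
      by (rule parity_char_free_eqI[OF pull pull _ that]) (use AB(3) in \<open>auto simp: T_def\<close>)
    have "y \<in> A \<longleftrightarrow> y \<in> B" if y: "y \<in> Y" for y
    proof -
      have "free_class Y [(y, True)] \<in> carrier (free_group Y)"
        using y by (auto simp: carrier_free_group)
      then obtain U where "U \<in> carrier (free_group X)" "\<phi> U = free_class Y [(y, True)]"
        using bij by (metis bij_betw_def imageE)
      then show ?thesis using pointwise \<chi>(2)[OF y] by (metis comp_apply)
    qed
    then show "A = B" using AB by blast
  qed
  moreover have "T ` Pow Y \<subseteq> Pow X" by (auto simp: T_def)
  ultimately have fin_Pow: "finite (Pow Y)" and le: "card (Pow Y) \<le> card (Pow X)"
    using inj_on_finite card_inj_on_le fin finite_Pow_iff by metis+
  then have "finite Y" by simp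
  then show ?thesis using le fin power_le_imp_le_exp[of "2 :: nat" "card Y" "card X"]
    by (simp add: card_Pow)
qed

text \<open>\<open>free_rank\<close> is a definite description over all bases, including infinite
  ones; the cardinality comparison with the finite set \<open>X\<close> also gives the finiteness of
  the other basis.\<close>

theorem free_rank_eq:
  fixes F :: "('a, 'b) monoid_scheme" and X :: "'a set"
  assumes F: "free_group X \<cong> F" and fin: "finite X"
  shows "is_free_group F \<and> free_rank F = enat (card X)"
proof -
  have FX: "F \<cong> free_group X"
    using group.iso_sym[OF group_free_group] F by blast
  have "finite Y \<and> card Y = card X" if Y: "F \<cong> free_group Y" for Y :: "'a set"
  proof -
    have XY: "free_group X \<cong> free_group Y" using F Y by (rule iso_trans)
    then have YX: "free_group Y \<cong> free_group X"
      using group.iso_sym[OF group_free_group] by blast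
    show ?thesis
      using free_group_iso_card_le[OF XY fin] free_group_iso_card_le[OF YX] by auto
  qed
  then have "n = enat (card X)"
    if "\<exists>Y::'a set. F \<cong> free_group Y \<and> n = (if finite Y then enat (card Y) else \<infinity>)" for n
    using that by auto
  moreover have "\<exists>Y::'a set. F \<cong> free_group Y \<and> enat (card X) = (if finite Y then enat (card Y) else \<infinity>)"
    using FX fin by (intro exI[of _ X]) simp
  ultimately have "free_rank F = enat (card X)"
    unfolding free_rank_def by (rule the_equality[rotated])
  then show ?thesis using FX unfolding is_free_group_def by blast
qed

section \<open>Half-spaces in trees\<close>

text \<open>A tree is encoded as a connected symmetric relation in which every edge is a bridge, that is,
  the only edge entering some set of vertices.\<close>

locale tree_graph =
  fixes V :: "'x set" and E :: "('x \<times> 'x) set"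
  assumes E_sub: "E \<subseteq> V \<times> V"
    and E_sym: "(x, y) \<in> E \<Longrightarrow> (y, x) \<in> E"
    and V_conn: "\<lbrakk>x \<in> V; y \<in> V\<rbrakk> \<Longrightarrow> (x, y) \<in> E\<^sup>*"
    and bridge: "(x, y) \<in> E \<Longrightarrow> \<exists>U. x \<notin> U \<and> y \<in> U \<and> (\<forall>(a, b)\<in>E. a \<notin> U \<longrightarrow> b \<in> U \<longrightarrow> a = x \<and> b = y)"
begin

text \<open>The half-tree beyond the edge from \<open>x\<close> to \<open>y\<close>.\<close>

definition side :: "'x \<Rightarrow> 'x \<Rightarrow> 'x set" where
  "side x y = {z. (y, z) \<in> (E - {(x, y), (y, x)})\<^sup>*}"

definition conn :: "'x set \<Rightarrow> bool" where
  "conn C \<longleftrightarrow> (\<forall>x\<in>C. \<forall>y\<in>C. (x, y) \<in> (E \<inter> C \<times> C)\<^sup>*)"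

definition nbrs :: "'x set \<Rightarrow> 'x \<Rightarrow> 'x set" where
  "nbrs C x = {y \<in> C. (x, y) \<in> E}"

lemma head_in_side: "y \<in> side x y"
  by (simp add: side_def)

lemma side_step: "\<lbrakk>z \<in> side x y; (z, w) \<in> E; (z, w) \<noteq> (x, y); (z, w) \<noteq> (y, x)\<rbrakk> \<Longrightarrow> w \<in> side x y"
  unfolding side_def by (auto intro: rtrancl_into_rtrancl)

text \<open>The cut \<open>U\<close> given by \<open>bridge\<close> cannot be left by the remaining
  edges: leaving it is, by symmetry, entering it backwards, and the only entrance has been
  removed.\<close>

lemma tail_notin_side:
  assumes xy: "(x, y) \<in> E"
  shows "x \<notin> side x y"
proof -
  obtain U where U: "x \<notin> U" "y \<in> U" "\<And>a b. \<lbrakk>(a, b) \<in> E; a \<notin> U; b \<in> U\<rbrakk> \<Longrightarrow> a = x \<and> b = y"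
    using bridge[OF xy] by blast
  have "z \<in> U" if "(y, z) \<in> (E - {(x, y), (y, x)})\<^sup>*" for z
    using that
  proof (induction rule: rtrancl_induct)
    case (step b c)
    then have "(c, b) \<in> E" using E_sym by blast
    then show ?case using U(3)[of c b] step by blast
  qed (use U in simp)
  then show ?thesis using U(1) unfolding side_def by blast
qed

lemma edge_irrefl: "(x, x) \<notin> E"
  using tail_notin_side head_in_side by blast

lemma side_enter:
  assumes "(x, y) \<in> E" "(a, b) \<in> E" "a \<notin> side x y" "b \<in> side x y"
  shows "a = x \<and> b = y"
proof (rule ccontr)
  assume *: "\<not> (a = x \<and> b = y)"
  have "(b, a) \<noteq> (x, y)" using assms(1,4) tail_notin_side by blast
  then show False using side_step[OF assms(4), of a] assms(2,3) E_sym * by blast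
qed

lemma side_exit:
  assumes "(x, y) \<in> E" "(a, b) \<in> E" "a \<in> side x y" "b \<notin> side x y"
  shows "a = y \<and> b = x"
  using side_enter[OF assms(1) E_sym[OF assms(2)]] assms by blast

lemma opposite_sides_disjoint:
  assumes xy: "(x, y) \<in> E"
  shows "side x y \<inter> side y x = {}"
proof -
  have "z \<notin> side x y" if "(x, z) \<in> (E - {(y, x), (x, y)})\<^sup>*" for z
    using that
  proof (induction rule: rtrancl_induct)
    case (step b c)
    then show ?case using side_enter[OF xy, of b c] by blast
  qed (rule tail_notin_side[OF xy])
  then show ?thesis unfolding side_def[of y x] by blast
qed

text \<open>A path inside \<open>C\<close> could enter the half-tree only through the edge from
  \<open>x\<close> to \<open>y\<close>, but \<open>y\<close> is missing from
  \<open>C\<close>.\<close>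

lemma conn_side_disjoint:
  assumes C: "conn C" and xy: "(x, y) \<in> E" "x \<in> C" "y \<notin> C"
  shows "C \<inter> side x y = {}"
proof -
  have "z \<notin> side x y" if "z \<in> C" for z
  proof -
    have "(x, z) \<in> (E \<inter> C \<times> C)\<^sup>*" using C xy that by (auto simp: conn_def)
    then show ?thesis
    proof (induction rule: rtrancl_induct)
      case base
      show ?case using tail_notin_side[OF xy(1)] .
    next
      case (step b c)
      then show ?case using side_enter[OF xy(1), of b c] xy by blast
    qed
  qed
  then show ?thesis by blast
qed

lemma conn_subset_side:
  assumes C: "conn C" and xy: "(x, y) \<in> E" "x \<notin> C" and z: "z \<in> C" "z \<in> side x y"
  shows "C \<subseteq> side x y"
proof
  fix w assume "w \<in> C"
  then have "(z, w) \<in> (E \<inter> C \<times> C)\<^sup>*" using C z by (auto simp: conn_def)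
  then show "w \<in> side x y"
  proof (induction rule: rtrancl_induct)
    case (step b c)
    then show ?case using side_exit[OF xy(1), of b c] xy by blast
  qed (use z in simp)
qed

text \<open>A path from \<open>y\<close> within \<open>side x y\<close> could enter the other
  half-tree only from \<open>x'\<close>, which lies in \<open>C\<close> and hence outside
  \<open>side x y\<close>. This is the disjointness behind both ping-pong and the intersection of
  subtrees.\<close>

lemma sides_disjoint:
  assumes C: "conn C" and xy: "(x, y) \<in> E" "x \<in> C" "y \<notin> C"
    and xy': "(x', y') \<in> E" "x' \<in> C" "y' \<notin> C" and ne: "(x, y) \<noteq> (x', y')"
  shows "side x y \<inter> side x' y' = {}"
proof -
  note disj = conn_side_disjoint[OF C xy] conn_side_disjoint[OF C xy']
  have "z \<notin> side x' y' \<and> z \<in> side x y" if "(y, z) \<in> (E - {(x, y), (y, x)})\<^sup>*" for z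
    using that
  proof (induction rule: rtrancl_induct)
    case base
    have "x \<notin> side x' y'" using disj xy by blast
    then show ?case using side_enter[OF xy'(1) xy(1)] ne head_in_side by blast
  next
    case (step b c)
    then have c: "c \<in> side x y" using side_step[of b x y c] by blast
    have "c \<notin> side x' y'"
    proof
      assume "c \<in> side x' y'"
      then have "b = x'" using side_enter[OF xy'(1), of b c] step by blast
      then show False using disj xy' step by blast
    qed
    then show ?case using c by blast
  qed
  then show ?thesis unfolding side_def by blast
qed

text \<open>Along a path in \<open>C\<close>, a half-tree beyond an edge that leaves
  \<open>R\<close> can only be left through that same edge, that is, by returning to
  \<open>R\<close>.\<close>

lemma exit_edge:
  assumes C: "conn C" and R: "conn R" "R \<subseteq> C" "R \<noteq> {}" and y: "y \<in> C" "y \<notin> R"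
  obtains a b where "(a, b) \<in> E" "a \<in> R" "b \<in> C" "b \<notin> R" "y \<in> side a b"
proof -
  obtain x where x: "x \<in> R" using R by blast
  then have "(x, y) \<in> (E \<inter> C \<times> C)\<^sup>*" using C R y by (auto simp: conn_def)
  then have "y \<in> R \<or> (\<exists>a b. (a, b) \<in> E \<and> a \<in> R \<and> b \<in> C \<and> b \<notin> R \<and> y \<in> side a b)"
  proof (induction rule: rtrancl_induct)
    case (step b c)
    show ?case
    proof (cases "b \<in> R")
      case True
      then show ?thesis using step head_in_side[of c b] by blast
    next
      case False
      then obtain a d where ad: "(a, d) \<in> E" "a \<in> R" "d \<in> C" "d \<notin> R" "b \<in> side a d"
        using step.IH by blast
      then have "c \<in> R \<or> c \<in> side a d"
        using side_exit[OF ad(1), of b c] step by blast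
      then show ?thesis using ad by blast
    qed
  qed (use x in simp)
  then show ?thesis using y that by blast
qed

text \<open>The half-tree beyond an edge has no other entrance, so a path joining the ends of the
  edge must use it. Hence the edges of a connected subgraph are all the edges between its
  vertices.\<close>

lemma edge_in_connecting_subrelation:
  assumes "E' \<subseteq> E" "(a, b) \<in> E" "(a, b) \<in> E'\<^sup>*"
  shows "(a, b) \<in> E'"
proof -
  have "z \<notin> side a b \<or> (a, b) \<in> E'" if "(a, z) \<in> E'\<^sup>*" for z
    using that
  proof (induction rule: rtrancl_induct)
    case base
    then show ?case using tail_notin_side assms by blast
  next
    case (step y z)
    then show ?case using side_enter[OF assms(2), of y z] assms(1) by blast
  qed
  then show ?thesis using head_in_side assms(3) by blast
qed

lemma conn_V: "conn V"
proof -
  have "E \<inter> V \<times> V = E" using E_sub by blast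
  then show ?thesis by (auto simp: conn_def V_conn)
qed

lemma conn_singleton: "conn {x}"
  by (auto simp: conn_def)

lemma E_sym_rtrancl:
  assumes "(x, y) \<in> (E \<inter> C \<times> C)\<^sup>*"
  shows "(y, x) \<in> (E \<inter> C \<times> C)\<^sup>*"
proof -
  have "sym (E \<inter> C \<times> C)" using E_sym by (auto simp: sym_def)
  then show ?thesis using assms by (meson sym_rtrancl symD)
qed

lemma connI:
  assumes "\<And>z. z \<in> C \<Longrightarrow> (x, z) \<in> (E \<inter> C \<times> C)\<^sup>*"
  shows "conn C"
  unfolding conn_def
proof (intro ballI)
  fix y z assume "y \<in> C" "z \<in> C"
  then have "(y, x) \<in> (E \<inter> C \<times> C)\<^sup>*" "(x, z) \<in> (E \<inter> C \<times> C)\<^sup>*"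
    using assms E_sym_rtrancl by blast+
  then show "(y, z) \<in> (E \<inter> C \<times> C)\<^sup>*" by (rule rtrancl_trans)
qed

lemma conn_component:
  assumes "x \<in> C"
  defines "R \<equiv> {z. (x, z) \<in> (E \<inter> C \<times> C)\<^sup>*}"
  shows "conn R" "R \<subseteq> C" "x \<in> R"
proof -
  show sub: "R \<subseteq> C"
  proof
    fix z assume "z \<in> R"
    then have "(x, z) \<in> (E \<inter> C \<times> C)\<^sup>*" by (simp add: R_def)
    then show "z \<in> C" by (induction rule: rtrancl_induct) (use assms in auto)
  qed
  show "x \<in> R" by (simp add: R_def)
  have "(x, z) \<in> (E \<inter> R \<times> R)\<^sup>*" if "(x, z) \<in> (E \<inter> C \<times> C)\<^sup>*" for z
    using that
  proof (induction rule: rtrancl_induct)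
    case (step b c)
    then have "b \<in> R" "c \<in> R" unfolding R_def by (auto intro: rtrancl_into_rtrancl)
    then show ?case using step by (blast intro: rtrancl_into_rtrancl)
  qed simp
  then have "(x, z) \<in> (E \<inter> R \<times> R)\<^sup>*" if "z \<in> R" for z using that by (simp add: R_def)
  then show "conn R" by (rule connI)
qed

text \<open>If \<open>y\<close> were outside the component \<open>R\<close> of \<open>x\<close>,
  both \<open>C\<close> and \<open>D\<close> would leave \<open>R\<close> towards \<open>y\<close>,
  and by disjointness of half-trees through the same edge. The head of this edge lies in both sets,
  hence in \<open>R\<close>.\<close>

lemma conn_Int:
  assumes C: "conn C" and D: "conn D"
  shows "conn (C \<inter> D)"
  unfolding conn_def
proof (intro ballI)
  fix x y assume x: "x \<in> C \<inter> D" and y: "y \<in> C \<inter> D"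
  define R where "R = {z. (x, z) \<in> (E \<inter> (C \<inter> D) \<times> (C \<inter> D))\<^sup>*}"
  note R = conn_component[OF x, folded R_def]
  have "y \<in> R"
  proof (rule ccontr)
    assume "y \<notin> R"
    then obtain a b a' b' where ab: "(a, b) \<in> E" "a \<in> R" "b \<in> C" "b \<notin> R" "y \<in> side a b"
      and ab': "(a', b') \<in> E" "a' \<in> R" "b' \<in> D" "b' \<notin> R" "y \<in> side a' b'"
      using exit_edge[OF C R(1) _ _ _, of y] exit_edge[OF D R(1) _ _ _, of y] R(2,3) y
      by (metis Int_iff empty_iff le_inf_iff)
    have "(a, b) = (a', b')"
      using sides_disjoint[OF R(1) ab(1,2,4) ab'(1,2,4)] ab(5) ab'(5) by blast
    then have "b \<in> C \<inter> D" "a \<in> C \<inter> D" using ab ab' R(2) by auto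
    then have "b \<in> R" using ab(1,2) unfolding R_def by (auto intro: rtrancl_into_rtrancl)
    then show False using ab by blast
  qed
  then show "(x, y) \<in> (E \<inter> (C \<inter> D) \<times> (C \<inter> D))\<^sup>*" by (simp add: R_def)
qed

lemma unique_attachment:
  assumes "conn C" "b \<notin> C" "(a, b) \<in> E" "(a', b) \<in> E" "a \<in> C" "a' \<in> C"
  shows "a = a'"
  using sides_disjoint[of C a b a' b] assms head_in_side by blast

text \<open>Attaching one vertex at a time turns connectedness and the edge count into
  inductions.\<close>

inductive finite_subtree :: "'x set \<Rightarrow> bool" where
  single: "x \<in> V \<Longrightarrow> finite_subtree {x}"
| grow: "\<lbrakk>finite_subtree W; a \<in> W; (a, b) \<in> E; b \<notin> W\<rbrakk> \<Longrightarrow> finite_subtree (insert b W)"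

lemma finite_subtree_conn:
  assumes "finite_subtree W"
  shows "conn W \<and> finite W \<and> W \<subseteq> V \<and> W \<noteq> {}"
  using assms
proof induction
  case (grow W a b)
  let ?W = "insert b W"
  have mono: "(x, y) \<in> (E \<inter> ?W \<times> ?W)\<^sup>*" if "(x, y) \<in> (E \<inter> W \<times> W)\<^sup>*" for x y
    using that by (rule rtrancl_mono[THEN subsetD, rotated]) blast
  have "(a, x) \<in> (E \<inter> ?W \<times> ?W)\<^sup>*" if "x \<in> ?W" for x
  proof (cases "x = b")
    case True
    then show ?thesis using grow by (intro r_into_rtrancl) blast
  next
    case False
    then show ?thesis using grow that by (intro mono) (auto simp: conn_def)
  qed
  then have "conn ?W" by (rule connI)
  then show ?case using grow E_sub by auto
qed (auto simp: conn_def)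

text \<open>A new vertex has a unique neighbour in the set built so far and brings one edge in both
  directions. Edges are ordered pairs, whence \<open>2 (n - 1)\<close>; the form with
  \<open>+ 2\<close> avoids truncated subtraction.\<close>

lemma finite_subtree_edges:
  assumes "finite_subtree W"
  shows "card (E \<inter> W \<times> W) + 2 = 2 * card W"
  using assms
proof induction
  case (single x)
  have "E \<inter> {x} \<times> {x} = {}" using edge_irrefl by blast
  then show ?case by simp
next
  case (grow W a b)
  note W = finite_subtree_conn[OF grow.hyps(1)]
  have edges: "E \<inter> insert b W \<times> insert b W = E \<inter> W \<times> W \<union> {(a, b), (b, a)}"
  proof -
    have "x = a" if "x \<in> W" "(x, b) \<in> E \<or> (b, x) \<in> E" for x
      using unique_attachment[of W b x a] that grow.hyps W E_sym by blast
    then show ?thesis using grow.hyps(2,3) edge_irrefl[of b] E_sym[OF grow.hyps(3)] by blast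
  qed
  have "a \<noteq> b" using grow.hyps(2,4) by blast
  then have two: "card {(a, b), (b, a)} = 2" by simp
  have disj: "E \<inter> W \<times> W \<inter> {(a, b), (b, a)} = {}" using grow.hyps(4) by blast
  have fin: "finite (E \<inter> W \<times> W)" using W by blast
  have "card (E \<inter> insert b W \<times> insert b W) = card (E \<inter> W \<times> W) + 2"
    unfolding edges
    using card_Un_disjoint[OF fin _ disj] two by (metis finite.emptyI finite.insertI)
  then show ?case using grow W by simp
qed

end

section \<open>Groups acting freely on trees\<close>

locale tree_action = tree_graph V E + group G
  for V :: "'x set" and E and G (structure) +
  fixes act :: "'a \<Rightarrow> 'x \<Rightarrow> 'x"
  assumes act_closed: "\<lbrakk>g \<in> carrier G; x \<in> V\<rbrakk> \<Longrightarrow> act g x \<in> V"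
    and act_one: "x \<in> V \<Longrightarrow> act \<one> x = x"
    and act_mult: "\<lbrakk>g \<in> carrier G; h \<in> carrier G; x \<in> V\<rbrakk> \<Longrightarrow> act (g \<otimes> h) x = act g (act h x)"
    and act_edge: "\<lbrakk>g \<in> carrier G; (x, y) \<in> E\<rbrakk> \<Longrightarrow> (act g x, act g y) \<in> E"
    and no_inversion: "\<lbrakk>g \<in> carrier G; (x, y) \<in> E\<rbrakk> \<Longrightarrow> \<not> (act g x = y \<and> act g y = x)"
begin

lemma edge_verts: "(x, y) \<in> E \<Longrightarrow> x \<in> V \<and> y \<in> V"
  using E_sub by blast

lemma act_inv_cancel:
  "\<lbrakk>g \<in> carrier G; x \<in> V\<rbrakk> \<Longrightarrow> act (inv g) (act g x) = x"
  "\<lbrakk>g \<in> carrier G; x \<in> V\<rbrakk> \<Longrightarrow> act g (act (inv g) x) = x"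
  using act_mult[of "inv g" g x] act_mult[of g "inv g" x] act_one by simp_all

lemma act_inj: "\<lbrakk>act g x = act g y; g \<in> carrier G; x \<in> V; y \<in> V\<rbrakk> \<Longrightarrow> x = y"
  using act_inv_cancel(1) by metis

lemma act_edge_inv: "\<lbrakk>g \<in> carrier G; x \<in> V; (act g x, y) \<in> E\<rbrakk> \<Longrightarrow> (x, act (inv g) y) \<in> E"
  using act_edge[of "inv g" "act g x" y] act_inv_cancel by simp

lemma act_side:
  assumes g: "g \<in> carrier G" and xy: "(x, y) \<in> E" and z: "z \<in> side x y"
  shows "act g z \<in> side (act g x) (act g y)"
proof -
  have "(y, z) \<in> (E - {(x, y), (y, x)})\<^sup>*" using z by (simp add: side_def)
  then show ?thesis
  proof (induction rule: rtrancl_induct)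
    case base
    show ?case by (rule head_in_side)
  next
    case (step b c)
    have "(act g b, act g c) \<noteq> (act g x, act g y)" "(act g b, act g c) \<noteq> (act g y, act g x)"
      using step(2) act_inj[OF _ g] edge_verts xy by (metis Diff_iff insertCI prod.inject)+
    then show ?case using side_step[OF step.IH] step(2) act_edge[OF g] by blast
  qed
qed

lemma side_total:
  assumes xy: "(x, y) \<in> E" and z: "z \<in> V"
  shows "z \<in> side x y \<or> z \<in> side y x"
proof -
  have "(x, z) \<in> E\<^sup>*" using V_conn edge_verts[OF xy] z by blast
  then show ?thesis
  proof (induction rule: rtrancl_induct)
    case base
    then show ?case using head_in_side by blast
  next
    case (step b c)
    then show ?case
      using side_exit[OF xy step(2)] side_exit[OF E_sym[OF xy] step(2)] head_in_side by metis
  qed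
qed

lemma conn_act_image:
  assumes g: "g \<in> carrier G" and C: "conn C"
  shows "conn (act g ` C)"
proof -
  have "(act g x, act g y) \<in> (E \<inter> act g ` C \<times> act g ` C)\<^sup>*" if "(x, y) \<in> (E \<inter> C \<times> C)\<^sup>*" for x y
    using that
  proof (induction rule: rtrancl_induct)
    case (step b c)
    then show ?case using act_edge[OF g] by (blast intro: rtrancl_into_rtrancl)
  qed simp
  then show ?thesis using C unfolding conn_def by blast
qed

end

text \<open>\<open>SOME\<close> depends only on the set \<open>{x, inv x}\<close>, so both members
  of a pair get the same representative, and \<open>X\<close> collects the representatives.\<close>

lemma (in group) half_of_symmetric_set:
  assumes S: "S \<subseteq> carrier G" "\<And>s. s \<in> S \<Longrightarrow> inv s \<in> S" "\<And>s. s \<in> S \<Longrightarrow> inv s \<noteq> s"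
  obtains X where "X \<subseteq> S" "S = X \<union> m_inv G ` X" "X \<inter> m_inv G ` X = {}"
proof -
  define rep where "rep x = (SOME y. y \<in> {x, inv x})" for x
  define X where "X = {x \<in> S. rep x = x}"
  have rep: "rep x \<in> {x, inv x}" for x
    unfolding rep_def by (rule someI[of _ x]) simp
  have rep_inv: "rep (inv x) = rep x" if "x \<in> S" for x
    using S(1) that unfolding rep_def by (metis insert_commute inv_inv subsetD)
  have "S \<subseteq> X \<union> m_inv G ` X"
  proof
    fix x assume x: "x \<in> S"
    show "x \<in> X \<union> m_inv G ` X"
    proof (cases "rep x = x")
      case False
      then have "inv x \<in> X" using rep[of x] rep_inv[OF x] S(2)[OF x] by (auto simp: X_def)
      moreover have "x = inv (inv x)" using x S(1) by auto
      ultimately show ?thesis by blast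
    qed (use x in \<open>simp add: X_def\<close>)
  qed
  moreover have "X \<inter> m_inv G ` X = {}"
  proof (rule ccontr)
    assume "X \<inter> m_inv G ` X \<noteq> {}"
    then obtain y where y: "y \<in> X" "inv y \<in> X" by blast
    then have "y \<in> S" "rep y = y" "rep (inv y) = inv y" by (simp_all add: X_def)
    then show False using rep_inv[of y] S(3)[of y] by simp
  qed
  moreover have "X \<subseteq> S" by (auto simp: X_def)
  moreover have "m_inv G ` X \<subseteq> S" using S(2) \<open>X \<subseteq> S\<close> by blast
  ultimately show ?thesis using that[of X] by blast
qed

section \<open>Cofinite invariant subtrees and fundamental subtrees\<close>

text \<open>\<open>P\<close> and \<open>F\<close> express that the quotient of \<open>C\<close> by
  \<open>H\<close> is finite without forming the quotient. \<open>F\<close> may contain edges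
  outside \<open>C\<close>, so it can be kept when \<open>C\<close> is cut down.\<close>

locale free_subtree = tree_action V E G act
  for V :: "'x set" and E and G (structure) and act :: "'a \<Rightarrow> 'x \<Rightarrow> 'x" +
  fixes H :: "'a set" and C :: "'x set" and P :: "'x set" and F :: "('x \<times> 'x) set"
  assumes H: "subgroup H G"
    and free: "\<lbrakk>h \<in> H; x \<in> V; act h x = x\<rbrakk> \<Longrightarrow> h = \<one>"
    and C_sub: "C \<subseteq> V" and C_conn: "conn C" and C_ne: "C \<noteq> {}"
    and C_inv: "\<lbrakk>h \<in> H; x \<in> C\<rbrakk> \<Longrightarrow> act h x \<in> C"
    and P: "finite P" "P \<subseteq> C" "C \<subseteq> (\<Union>h\<in>H. act h ` P)"
    and F: "finite F" "F \<subseteq> E" "E \<inter> C \<times> C \<subseteq> (\<Union>h\<in>H. map_prod (act h) (act h) ` F)"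
begin

lemma H_closed [simp]: "h \<in> H \<Longrightarrow> h \<in> carrier G"
  using subgroup.subset[OF H] by blast

lemma H_mult [simp]: "g \<in> H \<Longrightarrow> h \<in> H \<Longrightarrow> g \<otimes> h \<in> H"
  using subgroup.m_closed[OF H] .

lemma H_inv [simp]: "h \<in> H \<Longrightarrow> inv h \<in> H"
  using subgroup.m_inv_closed[OF H] .

lemma H_one [simp]: "\<one> \<in> H"
  using subgroup.one_closed[OF H] .

lemma free_unique:
  assumes "g \<in> H" "h \<in> H" "x \<in> V" "act g x = act h x"
  shows "g = h"
proof -
  have "act (inv g \<otimes> h) x = x" using assms by (simp add: act_mult act_inv_cancel flip: assms(4))
  then have "inv g \<otimes> h = \<one>" using free assms by simp
  then show ?thesis using assms H_closed inv_equality inv_inv by (metis inv_closed)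
qed

text \<open>By freeness an edge in \<open>F\<close> has at most one translate that starts at
  \<open>x\<close>, so the degree of \<open>x\<close> is bounded by \<open>card F\<close>.\<close>

lemma finite_nbrs:
  assumes x: "x \<in> C"
  shows "finite (nbrs C x)"
proof -
  have "\<exists>e\<in>F. \<exists>h\<in>H. (x, y) = map_prod (act h) (act h) e" if "y \<in> nbrs C x" for y
  proof -
    have "(x, y) \<in> E \<inter> C \<times> C" using that x unfolding nbrs_def by simp
    then have "(x, y) \<in> (\<Union>h\<in>H. map_prod (act h) (act h) ` F)" using F(3) by (rule subsetD[rotated])
    then obtain h e where "h \<in> H" "e \<in> F" "(x, y) = map_prod (act h) (act h) e" by (elim UN_E imageE)
    then show ?thesis by blast
  qed
  then obtain f where f: "\<And>y. y \<in> nbrs C x \<Longrightarrow> f y \<in> F \<and> (\<exists>h\<in>H. (x, y) = map_prod (act h) (act h) (f y))"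
    by metis
  have "inj_on f (nbrs C x)"
  proof (rule inj_onI)
    fix y z assume yz: "y \<in> nbrs C x" "z \<in> nbrs C x" "f y = f z"
    obtain a b where ab: "f y = (a, b)" by fastforce
    obtain g h where gh: "g \<in> H" "h \<in> H" "x = act g a" "y = act g b" "x = act h a" "z = act h b"
      using f[OF yz(1)] f[OF yz(2)] ab yz(3) by auto
    have "(a, b) \<in> E" using f[OF yz(1)] ab F(2) by auto
    then have "g = h" using free_unique[of g h a] gh edge_verts by auto
    then show "y = z" using gh by simp
  qed
  moreover have "f ` nbrs C x \<subseteq> F" using f by blast
  ultimately show ?thesis using F(1) by (rule inj_on_finite)
qed

lemma nbrs_act:
  assumes h: "h \<in> H" and x: "x \<in> C"
  shows "nbrs C (act h x) = act h ` nbrs C x"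
proof
  show "act h ` nbrs C x \<subseteq> nbrs C (act h x)"
    unfolding nbrs_def using h act_edge C_inv by auto
  show "nbrs C (act h x) \<subseteq> act h ` nbrs C x"
  proof
    fix y assume y: "y \<in> nbrs C (act h x)"
    then have "act (inv h) y \<in> nbrs C x"
      unfolding nbrs_def using act_edge_inv[of h x y] h x C_inv C_sub by auto
    moreover have "y = act h (act (inv h) y)"
      using y h C_sub act_inv_cancel(2)[of h y] unfolding nbrs_def by auto
    ultimately show "y \<in> act h ` nbrs C x" by blast
  qed
qed

lemma card_nbrs_act:
  assumes h: "h \<in> H" and x: "x \<in> C"
  shows "card (nbrs C (act h x)) = card (nbrs C x)"
proof -
  have "inj_on (act h) (nbrs C x)"
    using act_inj[of h] h C_sub unfolding inj_on_def nbrs_def by (metis (mono_tags, lifting) H_closed mem_Collect_eq subsetD)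
  then show ?thesis unfolding nbrs_act[OF assms] by (rule card_image)
qed

text \<open>A lift of a finite subtree of the quotient graph.\<close>

definition transversal_subtree :: "'x set \<Rightarrow> bool" where
  "transversal_subtree W \<longleftrightarrow> finite_subtree W \<and> W \<subseteq> C \<and> (\<forall>w\<in>W. \<forall>w'\<in>W. \<forall>h\<in>H. act h w = w' \<longrightarrow> w = w')"

text \<open>Different vertices of \<open>W\<close> lie in different orbits, and each orbit in
  \<open>C\<close> meets \<open>P\<close>. The bound guarantees that a largest transversal subtree
  exists.\<close>

lemma card_transversal_subtree:
  assumes W: "transversal_subtree W"
  shows "card W \<le> card P"
proof -
  have "\<exists>p\<in>P. \<exists>h\<in>H. w = act h p" if "w \<in> W" for w
    using that P(3) W unfolding transversal_subtree_def by blast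
  then obtain f where f: "\<And>w. w \<in> W \<Longrightarrow> f w \<in> P \<and> (\<exists>h\<in>H. w = act h (f w))"
    by metis
  have "inj_on f W"
  proof (rule inj_onI)
    fix w w' assume ww: "w \<in> W" "w' \<in> W" "f w = f w'"
    define p where "p = f w"
    obtain g h where gh: "g \<in> H" "h \<in> H" "w = act g p" "w' = act h p"
      using f[OF ww(1)] f[OF ww(2)] ww(3) unfolding p_def by metis
    have "p \<in> V" using f[OF ww(1)] P(2) C_sub unfolding p_def by blast
    then have "act (h \<otimes> inv g) w = w'"
      using gh(1,2) act_mult[of h "inv g" w] act_inv_cancel(1)[of g p] act_closed[of g p]
      unfolding gh(3,4) by simp
    moreover have "h \<otimes> inv g \<in> H" using gh by simp
    ultimately show "w = w'" using W ww unfolding transversal_subtree_def by blast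
  qed
  moreover have "f ` W \<subseteq> P" using f by blast
  ultimately show ?thesis using P(1) by (rule card_inj_on_le)
qed

text \<open>A largest transversal subtree meets every orbit in \<open>C\<close>: otherwise some edge
  leads from a translate of it to a vertex of a new orbit, and a translate of that vertex could be
  attached.\<close>

lemma fundamental_subtree_exists:
  obtains W where "transversal_subtree W" "\<And>x. x \<in> C \<Longrightarrow> \<exists>w\<in>W. \<exists>h\<in>H. x = act h w"
proof -
  obtain x0 where x0: "x0 \<in> C" using C_ne by blast
  then have "transversal_subtree {x0}"
    using C_sub finite_subtree.single unfolding transversal_subtree_def by blast
  then obtain W where W: "transversal_subtree W" and max: "\<And>W'. transversal_subtree W' \<Longrightarrow> card W' \<le> card W"
    using ex_has_greatest_nat[of transversal_subtree "{x0}" card "Suc (card P)"] card_transversal_subtree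
    by (metis less_Suc_eq_le)
  have sub: "finite_subtree W" "W \<subseteq> C" and inj: "\<And>w w' h. \<lbrakk>w \<in> W; w' \<in> W; h \<in> H; act h w = w'\<rbrakk> \<Longrightarrow> w = w'"
    using W unfolding transversal_subtree_def by blast+
  note W' = finite_subtree_conn[OF sub(1)]
  then obtain w0 where w0: "w0 \<in> W" by blast
  have "\<exists>w\<in>W. \<exists>h\<in>H. x = act h w" if x: "x \<in> C" for x
  proof -
    have "(w0, x) \<in> (E \<inter> C \<times> C)\<^sup>*" using C_conn w0 sub x by (auto simp: conn_def)
    then show ?thesis
    proof (induction rule: rtrancl_induct)
      case base
      have "w0 = act \<one> w0" using act_one w0 W' by auto
      then show ?case using w0 H_one by blast
    next
      case (step a b)
      then obtain w h where wh: "w \<in> W" "h \<in> H" "a = act h w" by blast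
      have wV: "w \<in> V" and bV: "b \<in> V" using wh W' step C_sub by blast+
      \<comment> \<open>The edge is moved back so that it starts in \<open>W\<close>; its end
        \<open>c\<close> is the vertex that would enlarge \<open>W\<close>.\<close>
      define c where "c = act (inv h) b"
      have c: "(w, c) \<in> E" "c \<in> C" "b = act h c"
        using act_edge_inv[of h w b] act_inv_cancel(2)[of h b] wh step wV bV C_inv[of "inv h" b]
        by (auto simp: c_def)
      show ?case
      proof (rule ccontr)
        assume no: "\<not> (\<exists>w\<in>W. \<exists>h\<in>H. b = act h w)"
        have c_notin: "act g c \<notin> W" if g: "g \<in> H" for g
        proof
          assume gc: "act g c \<in> W"
          have "act (h \<otimes> inv g) (act g c) = b"
            using g wh c act_mult[of h "inv g" "act g c"] act_inv_cancel(1)[of g c] act_closed[of g c] C_sub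
            by auto
          moreover have "h \<otimes> inv g \<in> H" using g wh by simp
          ultimately show False using no gc by blast
        qed
        have c_notin': "act g w' \<noteq> c" if g: "g \<in> H" "w' \<in> W" for g w'
        proof
          assume "act g w' = c"
          then have "act (inv g) c = w'" using act_inv_cancel(1)[of g w'] g W' by auto
          then show False using c_notin[of "inv g"] g by simp
        qed
        have cW: "c \<notin> W" using c_notin[OF H_one] act_one[of c] c C_sub by auto
        have "transversal_subtree (insert c W)"
          unfolding transversal_subtree_def
          using finite_subtree.grow[OF sub(1) wh(1) c(1) cW] sub(2) c(2) inj c_notin c_notin' by auto
        then show False using max[of "insert c W"] cW W' by simp
      qed
    qed
  qed
  with W show ?thesis by (rule that)
qed

end

section \<open>A free basis by ping-pong and its cardinality\<close>

locale fundamental_subtree = free_subtree V E G act H C P F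
  for V :: "'x set" and E and G (structure) and act :: "'a \<Rightarrow> 'x \<Rightarrow> 'x" and H C P F +
  fixes W :: "'x set"
  assumes W: "transversal_subtree W"
    and cover: "x \<in> C \<Longrightarrow> \<exists>w\<in>W. \<exists>h\<in>H. x = act h w"
begin

lemma W_sub: "W \<subseteq> C"
  using W by (simp add: transversal_subtree_def)

lemma W_verts: "w \<in> W \<Longrightarrow> w \<in> V"
  using W_sub C_sub by blast

lemma W_finite_subtree: "finite_subtree W"
  using W by (simp add: transversal_subtree_def)

lemmas W_conn = finite_subtree_conn[OF W_finite_subtree]

lemma W_unique:
  assumes "w \<in> W" "w' \<in> W" "g \<in> H" "h \<in> H" "act g w = act h w'"
  shows "w = w' \<and> g = h"
proof -
  have "act (inv h \<otimes> g) w = w'"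
    using assms act_inv_cancel(1)[of h w'] W_verts by (simp add: act_mult)
  then have "w = w'" using assms W unfolding transversal_subtree_def by (metis H_inv H_mult)
  then show ?thesis using free_unique[of g h w] assms W_verts by blast
qed

text \<open>One element from each pair of mutually inverse \<open>steps\<close> makes up a basis of \<open>H\<close>.\<close>

definition steps :: "'a set" where
  "steps = {h \<in> H. h \<noteq> \<one> \<and> (\<exists>a\<in>W. \<exists>b\<in>W. (a, act h b) \<in> E)}"

lemma steps_H: "steps \<subseteq> H"
  by (auto simp: steps_def)

lemma edge_back:
  assumes "h \<in> H" "b \<in> W" "(a, act h b) \<in> E"
  shows "(b, act (inv h) a) \<in> E"
  using act_edge_inv[OF H_closed[OF assms(1)] W_verts[OF assms(2)] E_sym[OF assms(3)]] .

lemma translate_notin: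
  assumes "h \<in> H" "h \<noteq> \<one>" "b \<in> W"
  shows "act h b \<notin> W"
proof
  assume "act h b \<in> W"
  then show False
    using W_unique[of b "act h b" h \<one>] assms act_one[of "act h b"] W_verts by auto
qed

lemma steps_inv:
  assumes "h \<in> steps"
  shows "inv h \<in> steps"
proof -
  obtain a b where ab: "h \<in> H" "h \<noteq> \<one>" "a \<in> W" "b \<in> W" "(a, act h b) \<in> E"
    using assms unfolding steps_def by blast
  have "(b, act (inv h) a) \<in> E"
    using edge_back ab by blast
  moreover have "inv h \<noteq> \<one>" using ab inv_eq_1_iff by simp
  ultimately show ?thesis unfolding steps_def using ab H_inv by blast
qed

text \<open>\<open>W\<close> and its translate by \<open>h\<close> are disjoint and connected. Two
  edges between them would put the translate into two disjoint half-trees.\<close>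

lemma step_edge_unique:
  assumes h: "h \<in> H" "h \<noteq> \<one>" and ab: "a \<in> W" "b \<in> W" "(a, act h b) \<in> E"
    and ab': "a' \<in> W" "b' \<in> W" "(a', act h b') \<in> E"
  shows "a = a' \<and> b = b'"
proof -
  have conn: "conn (act h ` W)" using conn_act_image h W_conn by simp
  have disj: "act h ` W \<inter> W = {}" using translate_notin h by blast
  have "act h ` W \<subseteq> side a (act h b)"
    by (rule conn_subset_side[OF conn ab(3), of "act h b"]) (use ab disj head_in_side in blast)+
  then have "act h b' \<in> side a (act h b)" using ab' by blast
  moreover have "act h b' \<in> side a' (act h b')" by (rule head_in_side)
  ultimately have "(a, act h b) = (a', act h b')"
    using sides_disjoint[of W a "act h b" a' "act h b'"] ab ab' disj W_conn by blast
  then show ?thesis using W_unique[of b b' h h] h ab ab' by auto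
qed

text \<open>If \<open>h\<close> is an involution, the edge from \<open>W\<close> to its translate is
  mapped by \<open>h\<close> to such an edge read backwards. By uniqueness it is the same edge, so
  \<open>h\<close> would invert it.\<close>

lemma steps_not_self_inverse:
  assumes "h \<in> steps"
  shows "inv h \<noteq> h"
proof
  assume inv: "inv h = h"
  obtain a b where ab: "h \<in> H" "h \<noteq> \<one>" "a \<in> W" "b \<in> W" "(a, act h b) \<in> E"
    using assms unfolding steps_def by blast
  then have "(b, act h a) \<in> E"
    using edge_back[of h b a] inv by simp
  then have "a = b" using step_edge_unique ab by blast
  then have "act h a = act h b \<and> act h (act h b) = a"
    using act_inv_cancel(1)[of h b] inv ab W_verts by simp
  then show False using no_inversion[of h a "act h b"] ab by simp
qed

text \<open>For a step \<open>h\<close> only one edge runs from \<open>W\<close> to its translate by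
  \<open>h\<close>; the union avoids choosing it.\<close>

definition half :: "'a \<Rightarrow> 'x set" where
  "half h = (\<Union>a\<in>W. \<Union>b\<in>{b\<in>W. (a, act h b) \<in> E}. side a (act h b))"

lemma half_eq:
  assumes "h \<in> H" "h \<noteq> \<one>" "a \<in> W" "b \<in> W" "(a, act h b) \<in> E"
  shows "half h = side a (act h b)"
  unfolding half_def using assms step_edge_unique[OF assms] by blast

lemma half_disjoint_W:
  assumes "h \<in> steps"
  shows "W \<inter> half h = {}"
proof -
  obtain a b where ab: "h \<in> H" "h \<noteq> \<one>" "a \<in> W" "b \<in> W" "(a, act h b) \<in> E"
    using assms unfolding steps_def by blast
  show ?thesis unfolding half_eq[OF ab]
    using conn_side_disjoint[of W a "act h b"] W_conn translate_notin ab by blast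
qed

lemma halves_disjoint:
  assumes "h \<in> steps" "k \<in> steps" "h \<noteq> k"
  shows "half h \<inter> half k = {}"
proof -
  obtain a b where ab: "h \<in> H" "h \<noteq> \<one>" "a \<in> W" "b \<in> W" "(a, act h b) \<in> E"
    using assms unfolding steps_def by blast
  obtain a' b' where ab': "k \<in> H" "k \<noteq> \<one>" "a' \<in> W" "b' \<in> W" "(a', act k b') \<in> E"
    using assms unfolding steps_def by blast
  have "(a, act h b) \<noteq> (a', act k b')" using W_unique[of b b' h k] ab ab' assms(3) by blast
  then show ?thesis unfolding half_eq[OF ab] half_eq[OF ab']
    using sides_disjoint[of W a "act h b" a' "act k b'"] W_conn translate_notin ab ab' by blast
qed

text \<open>\<open>h\<close> carries the edge between \<open>W\<close> and its translate by
  \<open>inv h\<close> to the edge between the translate by \<open>h\<close> and \<open>W\<close>.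
  So it carries the half-tree opposite to \<open>half (inv h)\<close> into
  \<open>half h\<close>.\<close>

lemma half_ping_pong:
  assumes h: "h \<in> steps" and z: "z \<in> V" "z \<notin> half (inv h)"
  shows "act h z \<in> half h"
proof -
  obtain a b where ab: "h \<in> H" "h \<noteq> \<one>" "a \<in> W" "b \<in> W" "(a, act h b) \<in> E"
    using h unfolding steps_def by blast
  have e: "(b, act (inv h) a) \<in> E"
    using edge_back ab by blast
  have "half (inv h) = side b (act (inv h) a)"
    using half_eq[of "inv h" b a] steps_inv[OF h] e ab unfolding steps_def by blast
  then have "z \<in> side (act (inv h) a) b" using side_total[OF e z(1)] z(2) by blast
  then have "act h z \<in> side (act h (act (inv h) a)) (act h b)"
    using act_side[OF _ E_sym[OF e]] ab by simp
  then show ?thesis using act_inv_cancel(2)[of h a] ab W_verts half_eq[OF ab] by simp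
qed

text \<open>An edge of \<open>C\<close> passes from one translate of \<open>W\<close> to another,
  and the quotient of the two group elements is trivial or a step. Following paths from
  \<open>W\<close>, the generated subgroup reaches every translate.\<close>

lemma generate_steps:
  assumes X: "X \<subseteq> H" "steps \<subseteq> generate G X"
  shows "generate G X = H"
proof
  let ?H' = "generate G X"
  have sub: "subgroup ?H' G" by (rule generate_is_subgroup) (use X H_closed in blast)
  show "?H' \<subseteq> H" by (rule generate_subgroup_incl[OF X(1) H])
  obtain w0 where w0: "w0 \<in> W" using W_conn by blast
  have reach: "\<exists>g\<in>?H'. \<exists>w\<in>W. x = act g w" if "x \<in> C" for x
  proof -
    have "(w0, x) \<in> (E \<inter> C \<times> C)\<^sup>*" using C_conn w0 W_sub that by (auto simp: conn_def)
    then show ?thesis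
    proof (induction rule: rtrancl_induct)
      case base
      have "w0 = act \<one> w0" using act_one W_verts[OF w0] by simp
      then show ?case using w0 generate.one by blast
    next
      case (step x y)
      obtain g w where g: "g \<in> ?H'" "w \<in> W" "x = act g w" using step.IH by blast
      have gH: "g \<in> H" using g \<open>?H' \<subseteq> H\<close> by blast
      obtain h w' where h: "h \<in> H" "w' \<in> W" "y = act h w'" using cover step by blast
      have "(w, act (inv g) y) \<in> E"
        using act_edge_inv[OF H_closed[OF gH] W_verts[OF g(2)], of y] g(3) step(2) by blast
      then have e: "(w, act (inv g \<otimes> h) w') \<in> E"
        using act_mult[of "inv g" h w'] gH h W_verts by simp
      have "inv g \<otimes> h \<in> ?H'"
      proof (cases "inv g \<otimes> h = \<one>")
        case False
        then have "inv g \<otimes> h \<in> steps" unfolding steps_def using e g h gH by auto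
        then show ?thesis using X by blast
      qed (simp add: generate.one)
      then have "g \<otimes> (inv g \<otimes> h) \<in> ?H'" by (rule generate.eng[OF g(1)])
      then have "h \<in> ?H'" using gH h by (simp add: m_assoc[symmetric])
      then show ?case using h by blast
    qed
  qed
  show "H \<subseteq> ?H'"
  proof
    fix h assume h: "h \<in> H"
    then obtain g w where g: "g \<in> ?H'" "w \<in> W" "act h w0 = act g w"
      using reach[of "act h w0"] C_inv w0 W_sub by blast
    then have "h = g" using W_unique[of w0 w h g] w0 h \<open>?H' \<subseteq> H\<close> by blast
    then show "h \<in> ?H'" using g by simp
  qed
qed

text \<open>Ping-pong: a nonempty reduced word moves a vertex of \<open>W\<close> into the half-tree
  of its first letter, which is disjoint from \<open>W\<close>. So no such word evaluates to
  \<open>\<one>\<close>.\<close>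

lemma free_on_half_of_steps:
  assumes X: "X \<subseteq> steps" "steps = X \<union> m_inv G ` X" "X \<inter> m_inv G ` X = {}"
  shows "free_group X \<cong> G\<lparr>carrier := H\<rparr>"
proof -
  have XH: "X \<subseteq> H" using X(1) steps_H by blast
  then have XG: "X \<subseteq> carrier G" using H_closed by blast
  have signed_steps: "signed p \<in> steps" if "p \<in> X \<times> UNIV" for p
    using that X(1) steps_inv by (auto simp: signed_def)
  have signed_inv: "inv (signed p) = signed (fst p, \<not> snd p)" if "p \<in> X \<times> UNIV" for p
    using that XG by (auto simp: signed_def)
  have signed_inj: "p = q" if "p \<in> X \<times> UNIV" "q \<in> X \<times> UNIV" "signed p = signed q" for p q
  proof -
    obtain x b y c where p: "p = (x, b)" "q = (y, c)" by fastforce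
    have xy: "x \<in> X" "y \<in> X" "x \<in> carrier G" "y \<in> carrier G" using p that XG by auto
    show ?thesis
    proof (cases "b = c")
      case True
      have "x = y"
      proof (cases c)
        case False
        then have "inv x = inv y" using that(3) True by (simp add: p signed_def)
        then have "inv (inv x) = inv (inv y)" by (rule arg_cong)
        then show ?thesis by (simp only: inv_inv xy)
      qed (use that(3) True in \<open>simp add: p signed_def\<close>)
      then show ?thesis using True p by simp
    next
      case False
      then have "x = inv y \<or> inv x = y"
        using that(3) unfolding p signed_def by (cases b; cases c) simp_all
      then have "x \<in> m_inv G ` X \<or> y \<in> m_inv G ` X" using xy(1,2) by blast
      then show ?thesis using X(3) xy(1,2) by blast
    qed
  qed
  obtain w0 where w0: "w0 \<in> W" using W_conn by blast
  have move: "act (list_prod (map signed w)) w0 \<in> half (signed (hd w))"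
    if "w \<in> lists (X \<times> UNIV)" "w \<noteq> []" "reduced_word w" for w
    using that
  proof (induction w rule: list.induct)
    case (Cons p w)
    have p: "p \<in> X \<times> UNIV" and w: "w \<in> lists (X \<times> UNIV)" using Cons.prems(1) by simp_all
    have pG: "signed p \<in> carrier G" using signed_closed[OF p XG] .
    have wG: "list_prod (map signed w) \<in> carrier G"
      using map_signed_closed[OF XG w] by simp
    define z where "z = act (list_prod (map signed w)) w0"
    have zV: "z \<in> V" using act_closed wG W_verts[OF w0] z_def by simp
    have "z \<notin> half (inv (signed p))"
    proof (cases w)
      case Nil
      then have "z = w0" using act_one W_verts[OF w0] z_def by simp
      then show ?thesis using half_disjoint_W steps_inv signed_steps p w0 by blast
    next
      case (Cons q w')
      have q: "q \<in> X \<times> UNIV" and "q \<noteq> (fst p, \<not> snd p)" "reduced_word w"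
        using Cons.prems Cons p w by (auto simp: reduced_word_def)
      \<comment> \<open>Reducedness is used here: \<open>z\<close> lies in the half-tree of the next
        letter, which is then disjoint from the one that \<open>half_ping_pong\<close>
        forbids.\<close>
      then have "signed q \<noteq> inv (signed p)"
        using signed_inj[OF q, of "(fst p, \<not> snd p)"] signed_inv[OF p] p by auto
      moreover have "z \<in> half (signed q)"
        using Cons.IH[OF w] Cons \<open>reduced_word w\<close> z_def by simp
      ultimately show ?thesis
        using halves_disjoint[of "signed q" "inv (signed p)"] signed_steps p q steps_inv by blast
    qed
    then have "act (signed p) z \<in> half (signed p)" using half_ping_pong signed_steps[OF p] zV by blast
    then show ?case using act_mult[OF pG wG W_verts[OF w0]] z_def by simp
  qed simp
  have "list_prod (map signed w) \<noteq> \<one>"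
    if w: "w \<in> lists (X \<times> UNIV)" "w \<noteq> []" "reduced_word w" for w
  proof
    assume "list_prod (map signed w) = \<one>"
    then have "w0 \<in> half (signed (hd w))" using move[OF w] act_one W_verts[OF w0] by simp
    moreover have hd: "hd w \<in> X \<times> UNIV" using w(1,2) by (cases w) simp_all
    ultimately show False using half_disjoint_W[OF signed_steps[OF hd]] w0 by blast
  qed
  then have "free_group X \<cong> G\<lparr>carrier := generate G X\<rparr>"
    using free_group_iso_subgroup[OF XG] by blast
  moreover have "steps \<subseteq> generate G X"
    using X(2) by (auto intro: generate.incl generate.inv)
  ultimately show ?thesis using generate_steps[OF XH] by simp
qed

lemma finite_star_edges: "finite (SIGMA w:W. nbrs C w)"
  using W_conn finite_nbrs W_sub by (intro finite_SigmaI) blast+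

text \<open>A step corresponds to its edge from \<open>W\<close> to a translate. Every edge of
  \<open>C\<close> leaving \<open>W\<close> arises, because its end lies in a unique translate of
  \<open>W\<close>.\<close>

lemma steps_edges_bij:
  obtains f where "bij_betw f steps ((SIGMA w:W. nbrs C w) - W \<times> W)"
proof -
  have "\<exists>e. \<exists>a\<in>W. \<exists>b\<in>W. e = (a, act h b) \<and> e \<in> E" if "h \<in> steps" for h
    using that unfolding steps_def by blast
  then obtain f where f: "\<And>h. h \<in> steps \<Longrightarrow> \<exists>a\<in>W. \<exists>b\<in>W. f h = (a, act h b) \<and> f h \<in> E"
    by metis
  have inj: "inj_on f steps"
  proof (rule inj_onI)
    fix h k assume hk: "h \<in> steps" "k \<in> steps" "f h = f k"
    obtain b b' where "b \<in> W" "b' \<in> W" "act h b = act k b'"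
      using f[OF hk(1)] f[OF hk(2)] hk(3) by (metis prod.inject)
    then show "h = k" using W_unique[of b b' h k] hk steps_H by blast
  qed
  have "f ` steps = (SIGMA w:W. nbrs C w) - W \<times> W"
  proof
    show "f ` steps \<subseteq> (SIGMA w:W. nbrs C w) - W \<times> W"
    proof
      fix e assume "e \<in> f ` steps"
      then obtain h where h: "h \<in> steps" "e = f h" by blast
      then obtain a b where ab: "a \<in> W" "b \<in> W" "e = (a, act h b)" "e \<in> E" using f[OF h(1)] by metis
      have "h \<in> H" "h \<noteq> \<one>" using h unfolding steps_def by auto
      then show "e \<in> (SIGMA w:W. nbrs C w) - W \<times> W"
        using ab translate_notin C_inv W_sub unfolding nbrs_def by auto
    qed
    show "(SIGMA w:W. nbrs C w) - W \<times> W \<subseteq> f ` steps"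
    proof
      fix e assume e: "e \<in> (SIGMA w:W. nbrs C w) - W \<times> W"
      obtain a y where ay: "e = (a, y)" "a \<in> W" "y \<in> C" "(a, y) \<in> E" "y \<notin> W"
        using e unfolding nbrs_def by auto
      obtain h b where h: "h \<in> H" "b \<in> W" "y = act h b" using cover[OF ay(3)] by blast
      have "h \<noteq> \<one>" using h ay(5) act_one W_verts by auto
      then have hs: "h \<in> steps" unfolding steps_def using h ay by blast
      obtain a' b' where "a' \<in> W" "b' \<in> W" "f h = (a', act h b')" "(a', act h b') \<in> E"
        using f[OF hs] by metis
      then have "f h = e"
        using step_edge_unique[of h a b a' b'] h ay \<open>h \<noteq> \<one>\<close> by auto
      then show "e \<in> f ` steps" using hs by blast
    qed
  qed
  with inj show ?thesis using that unfolding bij_betw_def by blast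
qed

text \<open>The edges of \<open>C\<close> starting in \<open>W\<close> are
  \<open>2 (card W - 1)\<close> inner ones and \<open>2 card X\<close> leaving ones; subtracting 2
  for each vertex of \<open>W\<close> leaves the right side, which is minus twice the Euler
  characteristic of the quotient.\<close>

theorem free_basis_Euler:
  obtains X where "X \<subseteq> H" "finite X" "free_group X \<cong> G\<lparr>carrier := H\<rparr>"
    "(\<Sum>w\<in>W. int (card (nbrs C w)) - 2) = 2 * int (card X) - 2"
proof -
  have stepsG: "steps \<subseteq> carrier G" using steps_H H_closed by blast
  obtain X where X: "X \<subseteq> steps" "steps = X \<union> m_inv G ` X" "X \<inter> m_inv G ` X = {}"
    using half_of_symmetric_set[OF stepsG steps_inv steps_not_self_inverse] by blast
  obtain f where f: "bij_betw f steps ((SIGMA w:W. nbrs C w) - W \<times> W)"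
    by (rule steps_edges_bij)
  have fin: "finite steps"
    using bij_betw_finite[OF f] finite_star_edges by simp
  then have finX: "finite X" using X(1) finite_subset by blast
  have "inj_on (m_inv G) X"
    using X(1) stepsG inv_inv unfolding inj_on_def by (metis subsetD)
  then have card_steps: "card steps = 2 * card X"
    using finX X(3) card_image[of "m_inv G" X] by (subst X(2)) (simp add: card_Un_disjoint)
  have inside: "(SIGMA w:W. nbrs C w) \<inter> W \<times> W = E \<inter> W \<times> W"
    using W_sub unfolding nbrs_def by auto
  have "card (SIGMA w:W. nbrs C w) = card ((SIGMA w:W. nbrs C w) \<inter> W \<times> W) + card ((SIGMA w:W. nbrs C w) - W \<times> W)"
    using finite_star_edges card_Int_Diff by blast
  also have "\<dots> = card (E \<inter> W \<times> W) + 2 * card X"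
    using bij_betw_same_card[OF f] card_steps inside by simp
  finally have "(\<Sum>w\<in>W. card (nbrs C w)) + 2 = 2 * card W + 2 * card X"
    using finite_subtree_edges[OF W_finite_subtree] card_SigmaI[of W "nbrs C"] W_conn W_sub finite_nbrs
    by (auto simp: subset_iff)
  moreover have "(\<Sum>w\<in>W. int (card (nbrs C w)) - 2) = int (\<Sum>w\<in>W. card (nbrs C w)) - 2 * int (card W)"
    by (simp add: sum_subtractf)
  ultimately have "(\<Sum>w\<in>W. int (card (nbrs C w)) - 2) = 2 * int (card X) - 2"
    by linarith
  then show ?thesis using that[of X] X(1) steps_H finX free_on_half_of_steps[OF X] by blast
qed

end

section \<open>Existence of cofinite invariant subtrees\<close>

lemma rtrancl_finite_subrelation:
  assumes "(x, y) \<in> R\<^sup>*"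
  obtains B where "finite B" "B \<subseteq> R" "(x, y) \<in> B\<^sup>*"
proof -
  have "\<exists>B. finite B \<and> B \<subseteq> R \<and> (x, y) \<in> B\<^sup>*"
    using assms
  proof (induction rule: rtrancl_induct)
    case base
    show ?case by (rule exI[of _ "{}"]) simp
  next
    case (step y z)
    then obtain B where B: "finite B" "B \<subseteq> R" "(x, y) \<in> B\<^sup>*" by blast
    have "(x, y) \<in> (insert (y, z) B)\<^sup>*" using B(3) by (rule rtrancl_mono[THEN subsetD, rotated]) blast
    then have "(x, z) \<in> (insert (y, z) B)\<^sup>*" by (rule rtrancl_into_rtrancl) simp
    then show ?case using B step(2) by (intro exI[of _ "insert (y, z) B"]) simp
  qed
  then show ?thesis using that by blast
qed

context tree_action
begin

abbreviation act2 :: "'a \<Rightarrow> 'x \<times> 'x \<Rightarrow> 'x \<times> 'x" where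
  "act2 g \<equiv> map_prod (act g) (act g)"

lemma act2_edge: "\<lbrakk>g \<in> carrier G; e \<in> E\<rbrakk> \<Longrightarrow> act2 g e \<in> E"
  using act_edge by (cases e) auto

lemma act2_mult: "\<lbrakk>g \<in> carrier G; h \<in> carrier G; e \<in> E\<rbrakk> \<Longrightarrow> act2 (g \<otimes> h) e = act2 g (act2 h e)"
  using act_mult edge_verts by (cases e) auto

lemma act2_one: "e \<in> E \<Longrightarrow> act2 \<one> e = e"
  using act_one edge_verts by (cases e) auto

lemma act2_inv_cancel:
  "\<lbrakk>g \<in> carrier G; e \<in> E\<rbrakk> \<Longrightarrow> act2 (inv g) (act2 g e) = e"
  "\<lbrakk>g \<in> carrier G; e \<in> E\<rbrakk> \<Longrightarrow> act2 g (act2 (inv g) e) = e"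
  using act_inv_cancel edge_verts by (cases e; auto)+

text \<open>A base vertex \<open>x0\<close> is joined by a path to its image under each of the
  finitely many generators. The translates of these paths make up a connected invariant subgraph
  whose edges are finitely many up to translation.\<close>

lemma cofinite_subtree_exists:
  assumes H: "subgroup H G" "H = generate G A" and A: "finite A" "A \<subseteq> carrier G" and V: "V \<noteq> {}"
    and free: "\<And>h x. \<lbrakk>h \<in> H; x \<in> V; act h x = x\<rbrakk> \<Longrightarrow> h = \<one>"
  obtains C P F where "free_subtree V E G act H C P F"
proof -
  have HG: "h \<in> carrier G" if "h \<in> H" for h using subgroup.subset[OF H(1)] that by blast
  obtain x0 where x0: "x0 \<in> V" using V by blast
  have "\<exists>B. finite B \<and> B \<subseteq> E \<and> (x0, act a x0) \<in> B\<^sup>*" if "a \<in> A" for a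
  proof -
    have "(x0, act a x0) \<in> E\<^sup>*"
      using V_conn[OF x0 act_closed[OF subsetD[OF A(2) that] x0]] .
    then show ?thesis by (rule rtrancl_finite_subrelation) blast
  qed
  then obtain B where B: "\<And>a. a \<in> A \<Longrightarrow> finite (B a) \<and> B a \<subseteq> E \<and> (x0, act a x0) \<in> (B a)\<^sup>*"
    by metis
  \<comment> \<open>The reversed edges are added so that the translates form a symmetric
    relation.\<close>
  define F where "F = (\<Union>a\<in>A. B a \<union> (B a)\<inverse>)"
  have "B a \<subseteq> E \<and> (B a)\<inverse> \<subseteq> E" if "a \<in> A" for a using B[OF that] E_sym by blast
  then have F: "finite F" "F \<subseteq> E" using A(1) B unfolding F_def by simp_all blast+
  define E' where "E' = (\<Union>h\<in>H. act2 h ` F)"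
  have "act2 h e \<in> E" if "h \<in> H" "e \<in> F" for h e
    using act2_edge[OF HG[OF that(1)] subsetD[OF F(2) that(2)]] .
  then have E'_E: "E' \<subseteq> E" unfolding E'_def by (intro UN_least image_subsetI)
  have F_sym: "(y, x) \<in> F" if "(x, y) \<in> F" for x y using that unfolding F_def by blast
  have "sym E'"
  proof (rule symI)
    fix x y assume "(x, y) \<in> E'"
    then obtain h a b where "h \<in> H" "(a, b) \<in> F" "x = act h a" "y = act h b"
      unfolding E'_def by auto
    then show "(y, x) \<in> E'" unfolding E'_def using F_sym by force
  qed
  then have sym: "(y, x) \<in> E'\<^sup>*" if "(x, y) \<in> E'\<^sup>*" for x y
    using that by (meson sym_rtrancl symD)
  have E'_act: "(act g x, act g y) \<in> E'" if g: "g \<in> H" and xy: "(x, y) \<in> E'" for g x y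
  proof -
    obtain h a b where h: "h \<in> H" "(a, b) \<in> F" "x = act h a" "y = act h b"
      using xy unfolding E'_def by auto
    have eq: "act2 (g \<otimes> h) (a, b) = (act g x, act g y)"
      using act2_mult[OF HG[OF g] HG[OF h(1)] subsetD[OF F(2) h(2)]] h(3,4) by simp
    show ?thesis unfolding E'_def
      by (rule UN_I[OF subgroup.m_closed[OF H(1) g h(1)]]) (subst eq[symmetric], rule imageI[OF h(2)])
  qed
  have E'_act_star: "(act g x, act g y) \<in> E'\<^sup>*" if g: "g \<in> H" and xy: "(x, y) \<in> E'\<^sup>*" for g x y
    using xy
  proof (induction rule: rtrancl_induct)
    case (step b c)
    then show ?case using E'_act[OF g, of b c] by (meson rtrancl_into_rtrancl)
  qed simp
  have "F \<subseteq> E'"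
  proof
    fix e assume e: "e \<in> F"
    have "e = act2 \<one> e" by (rule act2_one[OF subsetD[OF F(2) e], symmetric])
    then have "e \<in> act2 \<one> ` F" using e by (rule image_eqI)
    then show "e \<in> E'" unfolding E'_def by (rule UN_I[OF subgroup.one_closed[OF H(1)]])
  qed
  then have gen: "(x0, act a x0) \<in> E'\<^sup>*" if "a \<in> A" for a
  proof -
    have "B a \<subseteq> E'" using \<open>F \<subseteq> E'\<close> that unfolding F_def by blast
    then show ?thesis using B[OF that] rtrancl_mono by blast
  qed
  have orbit: "(x0, act h x0) \<in> E'\<^sup>*" if "h \<in> generate G A" for h
    using that
  proof induction
    case one
    then show ?case using act_one[OF x0] by simp
  next
    case (incl a)
    then show ?case by (rule gen)
  next
    case (inv a)
    then have aG: "a \<in> carrier G" and "inv a \<in> H" using A H(2) generate.inv by auto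
    then have "(act (inv a) x0, x0) \<in> E'\<^sup>*"
      using E'_act_star[OF _ gen[OF inv], of "inv a"] act_inv_cancel(1)[OF aG x0] by simp
    then show ?case by (rule sym)
  next
    case (eng g h)
    have gh: "g \<in> H" "h \<in> H" using eng H(2) by auto
    have "(act g x0, act (g \<otimes> h) x0) \<in> E'\<^sup>*"
      using E'_act_star[OF gh(1) eng.IH(2)] act_mult[OF HG[OF gh(1)] HG[OF gh(2)] x0] by simp
    then show ?case using eng.IH(1) by (meson rtrancl_trans)
  qed
  define C where "C = {y. (x0, y) \<in> E'\<^sup>*}"
  have x0C: "x0 \<in> C" by (simp add: C_def)
  have C_sub: "C \<subseteq> V"
  proof
    fix y assume "y \<in> C"
    then have "(x0, y) \<in> E'\<^sup>*" by (simp add: C_def)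
    then show "y \<in> V" by (induction rule: rtrancl_induct) (use x0 E'_E E_sub in auto)
  qed
  have C_inv: "act h x \<in> C" if "h \<in> H" "x \<in> C" for h x
  proof -
    have "(x0, act h x0) \<in> E'\<^sup>*" using orbit that H(2) by blast
    moreover have "(act h x0, act h x) \<in> E'\<^sup>*" using E'_act_star that by (simp add: C_def)
    ultimately have "(x0, act h x) \<in> E'\<^sup>*" by (rule rtrancl_trans)
    then show ?thesis by (simp add: C_def)
  qed
  have "conn C"
  proof (rule connI)
    fix z assume "z \<in> C"
    then have "(x0, z) \<in> E'\<^sup>*" by (simp add: C_def)
    then show "(x0, z) \<in> (E \<inter> C \<times> C)\<^sup>*"
    proof (induction rule: rtrancl_induct)
      case (step b c)
      then have "b \<in> C" "c \<in> C" unfolding C_def by (auto intro: rtrancl_into_rtrancl)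
      then have "(b, c) \<in> E \<inter> C \<times> C" using step(2) E'_E by blast
      then show ?case using step.IH by (meson rtrancl_into_rtrancl)
    qed simp
  qed
  have edges: "E \<inter> C \<times> C \<subseteq> E'"
  proof
    fix e assume e: "e \<in> E \<inter> C \<times> C"
    obtain a b where ab: "e = (a, b)" by fastforce
    then have "(x0, a) \<in> E'\<^sup>*" "(x0, b) \<in> E'\<^sup>*" using e by (auto simp: C_def)
    then have "(a, b) \<in> E'\<^sup>*" using sym by (meson rtrancl_trans)
    then show "e \<in> E'" using edge_in_connecting_subrelation[OF E'_E] e ab by blast
  qed
  \<comment> \<open>A vertex of \<open>C\<close> other than \<open>x0\<close> is the end of an edge
    in \<open>E'\<close>, hence a translate of the end of an edge in \<open>F\<close>; the latter is
    in \<open>C\<close> by invariance.\<close>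
  define P where "P = insert x0 (snd ` F) \<inter> C"
  have "C \<subseteq> (\<Union>h\<in>H. act h ` P)"
  proof
    fix y assume y: "y \<in> C"
    then have "(x0, y) \<in> E'\<^sup>*" by (simp add: C_def)
    then show "y \<in> (\<Union>h\<in>H. act h ` P)"
    proof (cases rule: rtranclE)
      case base
      have "x0 = act \<one> x0" using act_one[OF x0] by simp
      then show ?thesis using base x0C subgroup.one_closed[OF H(1)] unfolding P_def by blast
    next
      case (step z)
      obtain h a b where h: "h \<in> H" "(a, b) \<in> F" "y = act h b"
        using step(2) unfolding E'_def by auto
      have "b \<in> V" using h F(2) E_sub by blast
      then have "act (inv h) y = b" using h(3) act_inv_cancel(1)[OF HG[OF h(1)]] by simp
      then have "b \<in> C" using C_inv[OF subgroup.m_inv_closed[OF H(1) h(1)] y] by simp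
      then have "b \<in> P" using h(2) unfolding P_def by force
      then show ?thesis using h by blast
    qed
  qed
  moreover have "finite P" "P \<subseteq> C" using F(1) by (auto simp: P_def)
  ultimately have "free_subtree V E G act H C P F"
    using edges x0C unfolding E'_def
    by (intro free_subtree.intro free_subtree_axioms.intro tree_action_axioms H(1))
      (use free C_sub C_inv \<open>conn C\<close> F in blast)+
  then show ?thesis by (rule that)
qed

end

section \<open>Removal of leaves\<close>

context free_subtree
begin

lemma C_verts: "x \<in> C \<Longrightarrow> x \<in> V"
  using C_sub by blast

text \<open>A nontrivial element moves \<open>w\<close> to another vertex of the connected set
  \<open>C\<close>. This excludes the subtree with a single vertex.\<close>

lemma nbrs_nonempty:
  assumes H_ne: "H \<noteq> {\<one>}" and w: "w \<in> C"
  shows "nbrs C w \<noteq> {}"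
proof -
  obtain h where h: "h \<in> H" "h \<noteq> \<one>" using H_ne H_one by blast
  then have "act h w \<noteq> w" "act h w \<in> C" using free[of h w] C_verts[OF w] C_inv w by blast+
  moreover have "(w, act h w) \<in> (E \<inter> C \<times> C)\<^sup>*"
    using C_conn w \<open>act h w \<in> C\<close> by (auto simp: conn_def)
  ultimately obtain y where "(w, y) \<in> E \<inter> C \<times> C" by (metis converse_rtranclE)
  then show ?thesis unfolding nbrs_def by blast
qed

text \<open>If the only neighbour were the translate of \<open>w\<close> by \<open>h\<close>, the
  translate by \<open>inv h\<close> would be a neighbour too. Then both are equal, and
  \<open>h\<close> inverts the edge.\<close>

lemma leaf_neighbour_other_orbit:
  assumes w: "w \<in> C" "nbrs C w = {u}" and h: "h \<in> H"
  shows "u \<noteq> act h w"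
proof
  assume u: "u = act h w"
  have "(w, act h w) \<in> E" using w(2) u unfolding nbrs_def by blast
  then have "(w, act (inv h) w) \<in> E"
    using act_edge_inv[OF H_closed[OF h] C_verts[OF w(1)] E_sym] by blast
  then have "act (inv h) w \<in> nbrs C w" unfolding nbrs_def using C_inv h w(1) by simp
  then have "act (inv h) w = act h w" using w(2) u by simp
  then have "act h (act h w) = w"
    using act_inv_cancel(2)[OF H_closed[OF h] C_verts[OF w(1)]] by simp
  then show False using no_inversion[OF H_closed[OF h] \<open>(w, act h w) \<in> E\<close>] by simp
qed

text \<open>The whole orbit of a leaf is removed to keep the set invariant. The neighbour of the
  leaf is in another orbit and remains, while \<open>P\<close> loses at least one representative of
  the removed orbit.\<close>

lemma prune_leaf:
  assumes w: "w \<in> C" "nbrs C w = {u}"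
  obtains P' where "free_subtree V E G act H (C - (\<lambda>h. act h w) ` H) P' F" "card P' < card P"
proof -
  define Orb where "Orb = (\<lambda>h. act h w) ` H"
  have Orb_inv: "act h x \<in> Orb" if hx: "h \<in> H" "x \<in> Orb" for h x
  proof -
    obtain g where g: "g \<in> H" "x = act g w" using hx(2) Orb_def by blast
    then have "act h x = act (h \<otimes> g) w" using hx act_mult C_verts[OF w(1)] by simp
    then show ?thesis unfolding Orb_def using H_mult[OF hx(1) g(1)] by blast
  qed
  have Orb_inv': "x \<in> Orb" if "h \<in> H" "x \<in> V" "act h x \<in> Orb" for h x
    using Orb_inv[of "inv h" "act h x"] act_inv_cancel(1)[of h x] that by simp
  have leaf: "card (nbrs C b) = 1" if b: "b \<in> Orb" for b
  proof -
    obtain g where "g \<in> H" "b = act g w" using b Orb_def by blast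
    then show ?thesis using card_nbrs_act[of g w] w by simp
  qed
  have u: "u \<in> C - Orb"
    using leaf_neighbour_other_orbit[OF w] w(2) unfolding Orb_def nbrs_def by auto
  have conn: "conn (C - Orb)"
  proof (rule connI)
    fix y assume y: "y \<in> C - Orb"
    define R where "R = {z. (u, z) \<in> (E \<inter> (C - Orb) \<times> (C - Orb))\<^sup>*}"
    note R = conn_component[OF u, folded R_def]
    have "y \<in> R"
    proof (rule ccontr)
      assume "y \<notin> R"
      then obtain a b where ab: "(a, b) \<in> E" "a \<in> R" "b \<in> C" "b \<notin> R" "y \<in> side a b"
        using exit_edge[OF C_conn R(1), of y] R(2,3) y by blast
      \<comment> \<open>\<open>R\<close> can be left within \<open>C\<close> only through a removed
        leaf, and a leaf has no second neighbour through which the way to \<open>y\<close> could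
        continue.\<close>
      have "b \<in> Orb"
      proof (rule ccontr)
        assume "b \<notin> Orb"
        then have "(a, b) \<in> E \<inter> (C - Orb) \<times> (C - Orb)" using ab R(2) by blast
        then have "b \<in> R" using ab(2) unfolding R_def by (auto intro: rtrancl_into_rtrancl)
        then show False using ab by blast
      qed
      then have "y \<noteq> b" using y by blast
      then obtain c where c: "(b, c) \<in> E" "c \<in> C" "y \<in> side b c"
        using exit_edge[OF C_conn conn_singleton[of b], of y] ab(3) y by blast
      have "a \<in> nbrs C b" "c \<in> nbrs C b"
        using ab c R(2) E_sym unfolding nbrs_def by blast+
      then have "a = c" using leaf[OF \<open>b \<in> Orb\<close>] by (metis card_1_singletonE singletonD)
      then show False using c(3) ab(5) opposite_sides_disjoint[OF ab(1)] by blast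
    qed
    then show "(u, y) \<in> (E \<inter> (C - Orb) \<times> (C - Orb))\<^sup>*" by (simp add: R_def)
  qed
  define P' where "P' = P - Orb"
  have cover: "C - Orb \<subseteq> (\<Union>h\<in>H. act h ` P')"
  proof
    fix y assume y: "y \<in> C - Orb"
    then obtain h p where h: "h \<in> H" "p \<in> P" "y = act h p" using P(3) by blast
    then have "p \<notin> Orb" using Orb_inv y by blast
    then show "y \<in> (\<Union>h\<in>H. act h ` P')" using h unfolding P'_def by blast
  qed
  obtain h p where hp: "h \<in> H" "p \<in> P" "w = act h p" using P(3) w(1) by blast
  have "w = act \<one> w" using act_one C_verts[OF w(1)] by simp
  then have "w \<in> Orb" unfolding Orb_def using H_one by blast
  then have "p \<in> Orb" using Orb_inv'[of h p] hp P(2) C_sub by blast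
  then have card: "card P' < card P"
    unfolding P'_def using hp P(1) by (intro psubset_card_mono) blast+
  have inv: "act h x \<in> C - Orb" if "h \<in> H" "x \<in> C - Orb" for h x
    using that C_inv[of h x] Orb_inv'[of h x] C_verts[of x] by blast
  have P': "finite P'" "P' \<subseteq> C - Orb" using P by (auto simp: P'_def)
  have edges: "E \<inter> (C - Orb) \<times> (C - Orb) \<subseteq> (\<Union>h\<in>H. map_prod (act h) (act h) ` F)"
    by (rule subset_trans[OF _ F(3)]) blast
  have ne: "C - Orb \<subseteq> V" "C - Orb \<noteq> {}" using C_sub u by blast+
  have "free_subtree V E G act H (C - Orb) P' F"
    by (intro free_subtree.intro free_subtree_axioms.intro tree_action_axioms H)
      (fact free conn inv P' cover edges ne F)+
  then show ?thesis using that card unfolding Orb_def by blast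
qed

end

context tree_action
begin

text \<open>Among all cofinite invariant subtrees one with the least \<open>card P\<close> is taken;
  pruning a leaf would lower this number.\<close>

lemma leafless_subtree_exists:
  assumes sub: "free_subtree V E G act H C0 P0 F0" and H_ne: "H \<noteq> {\<one>}"
  obtains C P F where "free_subtree V E G act H C P F" "\<And>x. x \<in> C \<Longrightarrow> 2 \<le> card (nbrs C x)"
proof -
  obtain C P F where T: "free_subtree V E G act H C P F"
    and least: "\<And>C' P' F'. free_subtree V E G act H C' P' F' \<Longrightarrow> card P \<le> card P'"
    using ex_has_least_nat[of "\<lambda>(C, P, F). free_subtree V E G act H C P F" "(C0, P0, F0)" "\<lambda>(C, P, F). card P"] sub
    by fastforce
  interpret T: free_subtree V E G act H C P F by (rule T)
  have "2 \<le> card (nbrs C x)" if x: "x \<in> C" for x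
  proof (rule ccontr)
    assume "\<not> 2 \<le> card (nbrs C x)"
    moreover have "card (nbrs C x) \<noteq> 0"
      using T.nbrs_nonempty[OF H_ne x] T.finite_nbrs[OF x] by simp
    ultimately have "card (nbrs C x) = 1" by linarith
    then obtain u where "nbrs C x = {u}" by (rule card_1_singletonE)
    then show False using T.prune_leaf[OF x] least by (metis not_le)
  qed
  then show ?thesis using that T by blast
qed

text \<open>If the subtrees were disjoint, \<open>D\<close> would lie beyond a single edge leaving
  \<open>C\<close>. A common element of \<open>H\<close> and \<open>K\<close> preserves both
  subtrees, hence fixes this edge, which freeness allows only for \<open>\<one>\<close>.\<close>

lemma free_subtrees_meet:
  assumes H: "free_subtree V E G act H C P F" and K: "free_subtree V E G act K D Q F'"
    and HK: "H \<inter> K \<noteq> {\<one>}"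
  shows "C \<inter> D \<noteq> {}"
proof
  interpret H: free_subtree V E G act H C P F by (rule H)
  interpret K: free_subtree V E G act K D Q F' by (rule K)
  assume disj: "C \<inter> D = {}"
  obtain l where l: "l \<in> H" "l \<in> K" "l \<noteq> \<one>" using HK H.H_one K.H_one by blast
  obtain y where y: "y \<in> D" using K.C_ne by blast
  obtain a b where ab: "(a, b) \<in> E" "a \<in> C" "b \<notin> C" "y \<in> side a b"
    by (rule exit_edge[OF conn_V H.C_conn H.C_sub H.C_ne K.C_verts[OF y]]) (use y disj in blast)+
  have D: "D \<subseteq> side a b"
    using conn_subset_side[OF K.C_conn ab(1) _ y ab(4)] disj ab(2) by blast
  have "act (inv l) y \<in> D" using K.C_inv y l by simp
  then have "act l (act (inv l) y) \<in> side (act l a) (act l b)"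
    using act_side[OF H.H_closed[OF l(1)] ab(1)] D by blast
  then have y': "y \<in> side (act l a) (act l b)"
    using act_inv_cancel(2)[OF H.H_closed[OF l(1)] K.C_verts[OF y]] by simp
  have "act l b \<notin> C"
  proof
    assume "act l b \<in> C"
    then have "act (inv l) (act l b) \<in> C" using H.C_inv l by simp
    then show False using act_inv_cancel(1)[OF H.H_closed[OF l(1)]] edge_verts[OF ab(1)] ab(3) by simp
  qed
  then have "(a, b) = (act l a, act l b)"
    using sides_disjoint[OF H.C_conn ab(1,2,3) act_edge[OF H.H_closed[OF l(1)] ab(1)] H.C_inv[OF l(1) ab(2)]]
      ab(4) y' by blast
  then show False using H.free[OF l(1), of a] edge_verts[OF ab(1)] l(3) by simp
qed

section \<open>Counting edge orbits of the intersection\<close>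

text \<open>Finiteness is demanded separately because \<open>card\<close> of an infinite set is 0.
  \<open>A\<close> is an arbitrary set, as the product of two subgroups need not be a
  subgroup.\<close>

definition edge_stabilizers_le :: "'a set \<Rightarrow> nat \<Rightarrow> bool" where
  "edge_stabilizers_le A m \<longleftrightarrow> (\<forall>(x, y)\<in>E. finite {g \<in> A. act g x = x \<and> act g y = y} \<and>
    card {g \<in> A. act g x = x \<and> act g y = y} \<le> m)"

text \<open>An edge \<open>e = h e1 = k e2\<close> of a fibre is recorded by the stabilising element \<open>h0 h\<inverse> k k0\<inverse>\<close> of a
  fixed edge \<open>e0 = h0 e1 = k0 e2\<close> of the same fibre.\<close>

lemma fibre_bound:
  assumes H: "subgroup H G" and K: "subgroup K G"
    and stab: "edge_stabilizers_le (H <#> K) m"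
    and A: "A \<subseteq> E" "\<And>e e' l. \<lbrakk>e \<in> A; e' \<in> A; l \<in> H \<inter> K; act2 l e = e'\<rbrakk> \<Longrightarrow> e = e'"
    and e12: "e1 \<in> E" "e2 \<in> E"
  defines "B \<equiv> {e \<in> A. (\<exists>h\<in>H. e = act2 h e1) \<and> (\<exists>k\<in>K. e = act2 k e2)}"
  shows "finite B \<and> card B \<le> m"
proof (cases "B = {}")
  case False
  note HG = subgroup.mem_carrier[OF H] and KG = subgroup.mem_carrier[OF K]
  obtain e0 where e0: "e0 \<in> B" using False by blast
  have "\<exists>h k. h \<in> H \<and> k \<in> K \<and> e = act2 h e1 \<and> e = act2 k e2" if "e \<in> B" for e
    using that unfolding B_def by blast
  then obtain p q where pq: "\<And>e. e \<in> B \<Longrightarrow> p e \<in> H \<and> q e \<in> K \<and> e = act2 (p e) e1 \<and> e = act2 (q e) e2"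
    by metis
  define s where "s e = (p e0 \<otimes> inv (p e)) \<otimes> (q e \<otimes> inv (q e0))" for e
  have BE: "e \<in> E" if "e \<in> B" for e using that A(1) unfolding B_def by blast
  define St where "St = {g \<in> H <#> K. act g (fst e0) = fst e0 \<and> act g (snd e0) = snd e0}"
  have s_St: "s e \<in> St" if e: "e \<in> B" for e
  proof -
    have mem: "p e \<in> H" "q e \<in> K" "p e0 \<in> H" "q e0 \<in> K" using pq e e0 by auto
    then have G: "p e \<in> carrier G" "q e \<in> carrier G" "p e0 \<in> carrier G" "q e0 \<in> carrier G"
      using HG KG by auto
    have pull: "act2 (inv (q e0)) e0 = e2" "act2 (inv (p e)) e = e1"
      using pq[OF e0] pq[OF e] act2_inv_cancel(1) G e12 by metis+
    have "act2 (q e \<otimes> inv (q e0)) e0 = e"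
      using act2_mult[of "q e" "inv (q e0)" e0] G BE[OF e0] pull pq[OF e] by simp
    moreover have "act2 (p e0 \<otimes> inv (p e)) e = e0"
      using act2_mult[of "p e0" "inv (p e)" e] G BE[OF e] pull pq[OF e0] by simp
    ultimately have "act2 (s e) e0 = e0"
      unfolding s_def using act2_mult[of "p e0 \<otimes> inv (p e)" "q e \<otimes> inv (q e0)" e0] G BE[OF e0] by simp
    then have "act (s e) (fst e0) = fst e0 \<and> act (s e) (snd e0) = snd e0"
      by (metis fst_map_prod snd_map_prod)
    moreover have "p e0 \<otimes> inv (p e) \<in> H" "q e \<otimes> inv (q e0) \<in> K"
      using mem H K by (simp_all add: subgroup.m_closed subgroup.m_inv_closed)
    then have "s e \<in> H <#> K"
      unfolding s_def set_mult_def by blast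
    ultimately show ?thesis by (simp add: St_def)
  qed
  have "inj_on s B"
  proof (rule inj_onI)
    fix e f assume e: "e \<in> B" and f: "f \<in> B" and eq: "s e = s f"
    have mem: "p e \<in> H" "q e \<in> K" "p e0 \<in> H" "q e0 \<in> K" "p f \<in> H" "q f \<in> K"
      using pq e e0 f by auto
    then have G: "p e \<in> carrier G" "q e \<in> carrier G" "p e0 \<in> carrier G" "q e0 \<in> carrier G"
      "p f \<in> carrier G" "q f \<in> carrier G"
      using HG KG by auto
    have "s e = p e0 \<otimes> ((inv (p e) \<otimes> q e) \<otimes> inv (q e0))"
      "s f = p e0 \<otimes> ((inv (p f) \<otimes> q f) \<otimes> inv (q e0))"
      unfolding s_def using G by (simp_all add: m_assoc)
    then have "inv (p e) \<otimes> q e = inv (p f) \<otimes> q f"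
      using eq G by simp
    then have "p f \<otimes> (inv (p e) \<otimes> q e) = p f \<otimes> (inv (p f) \<otimes> q f)" by (rule arg_cong)
    then have "p f \<otimes> inv (p e) \<otimes> q e = q f" using G by (simp add: m_assoc[symmetric])
    then have "p f \<otimes> inv (p e) \<otimes> q e \<otimes> inv (q e) = q f \<otimes> inv (q e)" by (rule arg_cong)
    \<comment> \<open>Equal labels yield an element of \<open>H \<inter> K\<close> that carries
      \<open>e\<close> to \<open>f\<close>; by the assumption on \<open>A\<close> the two edges then
      coincide.\<close>
    then have l: "p f \<otimes> inv (p e) = q f \<otimes> inv (q e)" using G by (simp add: m_assoc)
    have "p f \<otimes> inv (p e) \<in> H \<inter> K"
    proof
      show "p f \<otimes> inv (p e) \<in> H"
        using mem H by (simp add: subgroup.m_closed subgroup.m_inv_closed)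
      show "p f \<otimes> inv (p e) \<in> K"
        unfolding l using mem K by (simp add: subgroup.m_closed subgroup.m_inv_closed)
    qed
    moreover have "act2 (p f \<otimes> inv (p e)) e = f"
      using act2_mult[of "p f" "inv (p e)" e] G BE[OF e] act2_inv_cancel(1)[of "p e" e1] e12 pq[OF e] pq[OF f]
      by simp
    ultimately show "e = f" using A(2) e f unfolding B_def by blast
  qed
  moreover have "s ` B \<subseteq> St" using s_St by blast
  moreover have "finite St \<and> card St \<le> m"
    unfolding St_def using stab BE[OF e0] unfolding edge_stabilizers_le_def by (auto simp: case_prod_beta)
  ultimately show ?thesis by (meson card_inj_on_le inj_on_finite le_trans)
qed simp

end

text \<open>If \<open>p \<le> q\<close> and \<open>3 \<le> p\<close>, then \<open>p (n - 2) \<le> (p - 2) n\<close> for \<open>n \<le> p\<close>, and \<open>q \<le> 3 (q - 2)\<close>.\<close>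

lemma sum_excess_le_aux:
  fixes n :: "'i \<Rightarrow> int"
  assumes n: "\<And>i. i \<in> I \<Longrightarrow> n i \<le> p" and p: "2 \<le> p" "p \<le> q"
    and sum: "(\<Sum>i\<in>I. n i) \<le> m * (p * q)" and m: "0 \<le> m"
  shows "(\<Sum>i\<in>I. n i - 2) \<le> 3 * m * ((p - 2) * (q - 2))"
proof (cases "p = 2")
  case True
  then have "(\<Sum>i\<in>I. n i - 2) \<le> 0" using n by (intro sum_nonpos) simp
  then show ?thesis using True by simp
next
  case False
  have "p * (\<Sum>i\<in>I. n i - 2) \<le> (p - 2) * (\<Sum>i\<in>I. n i)"
    unfolding sum_distrib_left using n by (intro sum_mono) (simp add: algebra_simps)
  also have "\<dots> \<le> (p - 2) * (m * (p * q))" using sum p by (intro mult_left_mono) auto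
  also have "\<dots> = p * ((p - 2) * m * q)" by simp
  finally have "(\<Sum>i\<in>I. n i - 2) \<le> (p - 2) * m * q" using p by simp
  also have "\<dots> \<le> (p - 2) * m * (3 * (q - 2))"
    using p False m by (intro mult_left_mono) auto
  finally show ?thesis by (simp add: algebra_simps)
qed

lemma sum_excess_le:
  fixes n :: "'i \<Rightarrow> int"
  assumes "\<And>i. i \<in> I \<Longrightarrow> n i \<le> p" "\<And>i. i \<in> I \<Longrightarrow> n i \<le> q" "2 \<le> p" "2 \<le> q"
    "(\<Sum>i\<in>I. n i) \<le> m * (p * q)" "0 \<le> m"
  shows "(\<Sum>i\<in>I. n i - 2) \<le> 3 * m * ((p - 2) * (q - 2))"
proof (cases "p \<le> q")
  case True
  then show ?thesis using sum_excess_le_aux[of I n p q m] assms by simp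
next
  case False
  then show ?thesis using sum_excess_le_aux[of I n q p m] assms by (simp add: mult.commute)
qed

section \<open>The intersection of two subtrees and the rank inequality\<close>

context tree_action
begin

text \<open>The point is cofiniteness. One edge is chosen from each orbit of
  \<open>H \<inter> K\<close>; the chosen edges are distributed over the finitely many pairs from
  \<open>F\<close> and \<open>F'\<close>, and over each pair \<open>fibre_bound\<close> allows only
  finitely many.\<close>

lemma Int_free_subtree:
  assumes H: "free_subtree V E G act H C P F" and K: "free_subtree V E G act K D Q F'"
    and HK: "H \<inter> K \<noteq> {\<one>}"
    and stab: "edge_stabilizers_le (H <#> K) m"
  obtains P'' F'' where "free_subtree V E G act (H \<inter> K) (C \<inter> D) P'' F''"
proof -
  interpret H: free_subtree V E G act H C P F by (rule H)
  interpret K: free_subtree V E G act K D Q F' by (rule K)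
  let ?L = "H \<inter> K" and ?C = "C \<inter> D"
  have L: "subgroup ?L G" by (rule subgroups_Inter_pair[OF H.H K.H])
  note meet = free_subtrees_meet[OF H K HK]
  define EL where "EL = E \<inter> ?C \<times> ?C"
  \<comment> \<open>The choice depends only on the set of translates and is therefore constant on
    orbits.\<close>
  define rep where "rep e = (SOME e'. e' \<in> {e' \<in> EL. \<exists>l\<in>?L. e' = act2 l e})" for e
  have C_inv: "act l x \<in> ?C" if "l \<in> ?L" "x \<in> ?C" for l x
    using H.C_inv K.C_inv that by blast
  have rep: "rep e \<in> EL \<and> (\<exists>l\<in>?L. rep e = act2 l e)" if e: "e \<in> EL" for e
  proof -
    have "e = act2 \<one> e" using act2_one e by (simp add: EL_def)
    then have "e \<in> {e' \<in> EL. \<exists>l\<in>?L. e' = act2 l e}" using e H.H_one K.H_one by blast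
    then show ?thesis unfolding rep_def using someI[of "\<lambda>e'. e' \<in> {e' \<in> EL. \<exists>l\<in>?L. e' = act2 l e}" e] by blast
  qed
  have rep_act: "rep (act2 l e) = rep e" if l: "l \<in> ?L" and e: "e \<in> EL" for l e
  proof -
    have lG: "l \<in> carrier G" and eE: "e \<in> E" using l e H.H_closed by (auto simp: EL_def)
    have "{e' \<in> EL. \<exists>k\<in>?L. e' = act2 k (act2 l e)} = {e' \<in> EL. \<exists>k\<in>?L. e' = act2 k e}"
    proof (intro Collect_cong conj_cong refl iffI)
      fix e' assume "\<exists>k\<in>?L. e' = act2 k (act2 l e)"
      then obtain k where k: "k \<in> ?L" "e' = act2 k (act2 l e)" by blast
      then have "e' = act2 (k \<otimes> l) e" using act2_mult[OF H.H_closed lG eE] by auto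
      moreover have "k \<otimes> l \<in> ?L" using k l by simp
      ultimately show "\<exists>k\<in>?L. e' = act2 k e" by blast
    next
      fix e' assume "\<exists>k\<in>?L. e' = act2 k e"
      then obtain k where k: "k \<in> ?L" "e' = act2 k e" by blast
      then have kG: "k \<in> carrier G" using H.H_closed by blast
      have "e' = act2 (k \<otimes> inv l) (act2 l e)"
        using act2_mult[OF kG inv_closed[OF lG] act2_edge[OF lG eE]] act2_inv_cancel(1)[OF lG eE] k by simp
      moreover have "k \<otimes> inv l \<in> ?L" using k l by simp
      ultimately show "\<exists>k\<in>?L. e' = act2 k (act2 l e)" by blast
    qed
    then show ?thesis unfolding rep_def by simp
  qed
  define A where "A = rep ` EL"
  have A_E: "A \<subseteq> EL" using rep unfolding A_def by blast
  have A_sub: "A \<subseteq> E" using A_E unfolding EL_def by blast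
  have rep_rep: "rep e = e" if e: "e \<in> A" for e
  proof -
    obtain f where f: "f \<in> EL" "e = rep f" using e unfolding A_def by blast
    obtain l where "l \<in> ?L" "rep f = act2 l f" using rep[OF f(1)] by blast
    then show ?thesis using rep_act[OF _ f(1)] f by metis
  qed
  have A_ineq: "e = e'" if "e \<in> A" "e' \<in> A" "l \<in> ?L" "act2 l e = e'" for e e' l
    using rep_act[OF that(3), of e] rep_rep that A_E by (metis subsetD)
  define B where "B e1 e2 = {e \<in> A. (\<exists>h\<in>H. e = act2 h e1) \<and> (\<exists>k\<in>K. e = act2 k e2)}" for e1 e2
  have "A \<subseteq> (\<Union>e1\<in>F. \<Union>e2\<in>F'. B e1 e2)"
  proof
    fix e assume e: "e \<in> A"
    have "EL \<subseteq> E \<inter> C \<times> C" "EL \<subseteq> E \<inter> D \<times> D" unfolding EL_def by blast+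
    then have cover: "e \<in> (\<Union>h\<in>H. act2 h ` F)" "e \<in> (\<Union>h\<in>K. act2 h ` F')"
      using subsetD[OF A_E e] H.F(3) K.F(3) by (meson subsetD)+
    obtain h e1 where h: "h \<in> H" "e1 \<in> F" "e = act2 h e1" using cover(1) by (elim UN_E imageE)
    obtain k e2 where k: "k \<in> K" "e2 \<in> F'" "e = act2 k e2" using cover(2) by (elim UN_E imageE)
    have "e \<in> B e1 e2" unfolding B_def using e h(1,3) k(1,3) by blast
    then show "e \<in> (\<Union>e1\<in>F. \<Union>e2\<in>F'. B e1 e2)" using h(2) k(2) by blast
  qed
  moreover have "finite (B e1 e2)" if "e1 \<in> F" "e2 \<in> F'" for e1 e2
    unfolding B_def
    by (rule fibre_bound[OF H.H K.H _ A_sub _ subsetD[OF H.F(2) that(1)] subsetD[OF K.F(2) that(2)], THEN conjunct1])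
      (fact stab A_ineq)+
  ultimately have fin: "finite A" using H.F(1) K.F(1) by (meson finite_UN_I finite_subset)
  have A_cover: "EL \<subseteq> (\<Union>l\<in>?L. act2 l ` A)"
  proof
    fix e assume e: "e \<in> EL"
    then have eE: "e \<in> E" by (simp add: EL_def)
    obtain l where l: "l \<in> ?L" "rep e = act2 l e" using rep[OF e] by blast
    then have "e = act2 (inv l) (rep e)" using act2_inv_cancel(1)[OF H.H_closed eE] by simp
    moreover have "inv l \<in> ?L" using l by simp
    moreover have "rep e \<in> A" using e by (simp add: A_def)
    ultimately show "e \<in> (\<Union>l\<in>?L. act2 l ` A)" by blast
  qed
  obtain x0 where x0: "x0 \<in> ?C" using meet by blast
  have conn: "conn ?C" by (rule conn_Int[OF H.C_conn K.C_conn])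
  have P_cover: "?C \<subseteq> (\<Union>l\<in>?L. act l ` insert x0 (fst ` A))"
  proof
    fix y assume y: "y \<in> ?C"
    show "y \<in> (\<Union>l\<in>?L. act l ` insert x0 (fst ` A))"
    proof (cases "y = x0")
      case True
      then have "y = act \<one> x0" using act_one H.C_verts x0 by simp
      then show ?thesis using H.H_one K.H_one by blast
    next
      case False
      have "(y, x0) \<in> (E \<inter> ?C \<times> ?C)\<^sup>*" using conn y x0 by (auto simp: conn_def)
      then obtain z where "(y, z) \<in> EL" unfolding EL_def using False by (metis converse_rtranclE)
      then have "(y, z) \<in> (\<Union>l\<in>?L. act2 l ` A)" using A_cover by (rule subsetD[rotated])
      then obtain l e where le: "l \<in> ?L" "e \<in> A" "(y, z) = act2 l e" by (elim UN_E imageE)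
      then have "y = act l (fst e)" by (metis fst_conv fst_map_prod)
      then show ?thesis using le by blast
    qed
  qed
  have P: "finite (insert x0 (fst ` A))" "insert x0 (fst ` A) \<subseteq> ?C"
    using fin x0 A_E unfolding EL_def by auto
  have free: "h = \<one>" if "h \<in> ?L" "x \<in> V" "act h x = x" for h x
    using H.free that by blast
  have sub: "?C \<subseteq> V" using H.C_sub by blast
  have "free_subtree V E G act ?L ?C (insert x0 (fst ` A)) A"
    by (intro free_subtree.intro free_subtree_axioms.intro tree_action_axioms L)
      (fact free sub conn meet C_inv P P_cover fin A_sub A_cover[unfolded EL_def])+
  then show ?thesis by (rule that)
qed

text \<open>The vertices of \<open>WL\<close> are grouped by the pair of their orbits under
  \<open>H\<close> and \<open>K\<close>. Each group obeys \<open>sum_excess_le\<close>, and summing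
  the bounds over all pairs gives the product of the two sums.\<close>

lemma Int_rank_bound:
  assumes H: "fundamental_subtree V E G act H C P F WH" and K: "fundamental_subtree V E G act K D Q F' WK"
    and L: "fundamental_subtree V E G act (H \<inter> K) (C \<inter> D) P'' F'' WL"
    and degH: "\<And>x. x \<in> C \<Longrightarrow> 2 \<le> card (nbrs C x)" and degK: "\<And>x. x \<in> D \<Longrightarrow> 2 \<le> card (nbrs D x)"
    and stab: "edge_stabilizers_le (H <#> K) m"
  shows "(\<Sum>w\<in>WL. int (card (nbrs (C \<inter> D) w)) - 2) \<le>
    3 * int m * ((\<Sum>w\<in>WH. int (card (nbrs C w)) - 2) * (\<Sum>w\<in>WK. int (card (nbrs D w)) - 2))"
proof -
  interpret H: fundamental_subtree V E G act H C P F WH by (rule H)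
  interpret K: fundamental_subtree V E G act K D Q F' WK by (rule K)
  interpret L: fundamental_subtree V E G act "H \<inter> K" "C \<inter> D" P'' F'' WL by (rule L)
  let ?N = "\<lambda>w. card (nbrs (C \<inter> D) w)"
  have "\<exists>a\<in>WH. \<exists>h\<in>H. w = act h a" "\<exists>b\<in>WK. \<exists>k\<in>K. w = act k b" if "w \<in> WL" for w
    using H.cover K.cover L.W_sub that by blast+
  then obtain rH rK where r: "\<And>w. w \<in> WL \<Longrightarrow> rH w \<in> WH \<and> (\<exists>h\<in>H. w = act h (rH w))"
      "\<And>w. w \<in> WL \<Longrightarrow> rK w \<in> WK \<and> (\<exists>k\<in>K. w = act k (rK w))"
    by metis
  have nbrs_sub: "nbrs (C \<inter> D) w \<subseteq> nbrs C w" "nbrs (C \<inter> D) w \<subseteq> nbrs D w" for w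
    unfolding nbrs_def by blast+
  have NH: "?N w \<le> card (nbrs C (rH w))" if w: "w \<in> WL" for w
  proof -
    obtain h where h: "h \<in> H" "w = act h (rH w)" using r(1)[OF w] by blast
    have "card (nbrs C w) = card (nbrs C (rH w))"
      using H.card_nbrs_act[OF h(1), of "rH w"] h(2) r(1)[OF w] H.W_sub by auto
    moreover have "?N w \<le> card (nbrs C w)"
      using w L.W_sub by (intro card_mono nbrs_sub H.finite_nbrs) blast
    ultimately show ?thesis by simp
  qed
  have NK: "?N w \<le> card (nbrs D (rK w))" if w: "w \<in> WL" for w
  proof -
    obtain k where k: "k \<in> K" "w = act k (rK w)" using r(2)[OF w] by blast
    have "card (nbrs D w) = card (nbrs D (rK w))"
      using K.card_nbrs_act[OF k(1), of "rK w"] k(2) r(2)[OF w] K.W_sub by auto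
    moreover have "?N w \<le> card (nbrs D w)"
      using w L.W_sub by (intro card_mono nbrs_sub K.finite_nbrs) blast
    ultimately show ?thesis by simp
  qed
  define fib where "fib ab = {w \<in> WL. rH w = fst ab \<and> rK w = snd ab}" for ab
  have finL: "finite WL" and finH: "finite WH" and finK: "finite WK"
    using L.W_conn H.W_conn K.W_conn by blast+
  \<comment> \<open>Edges starting in \<open>WL\<close> lie in different orbits of
    \<open>H \<inter> K\<close>, as \<open>fibre_bound\<close> requires.\<close>
  define A where "A = (SIGMA w:WL. nbrs (C \<inter> D) w)"
  have A_sub: "A \<subseteq> E" unfolding A_def nbrs_def by blast
  have A_ineq: "e = e'" if e: "e \<in> A" "e' \<in> A" "l \<in> H \<inter> K" "act2 l e = e'" for e e' l
  proof -
    have "fst e \<in> WL" "fst e' \<in> WL" "act l (fst e) = fst e'" using e unfolding A_def by auto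
    then have "l = \<one>" using L.W_unique[of "fst e" "fst e'" l \<one>] e(3) L.H_one act_one[of "fst e'"] L.W_verts by simp
    then show ?thesis using act2_one[OF subsetD[OF A_sub e(1)]] e(4) by simp
  qed
  define B where "B e1 e2 = {e \<in> A. (\<exists>h\<in>H. e = act2 h e1) \<and> (\<exists>k\<in>K. e = act2 k e2)}" for e1 e2
  \<comment> \<open>An edge starting over \<open>(a, b)\<close> is a translate by \<open>H\<close>
    of an edge at \<open>a\<close> and a translate by \<open>K\<close> of an edge at
    \<open>b\<close>; at most \<open>m\<close> such edges belong to each pair.\<close>
  have fib_sum: "(\<Sum>w\<in>fib (a, b). ?N w) \<le> m * (card (nbrs C a) * card (nbrs D b))"
    if a: "a \<in> WH" and b: "b \<in> WK" for a b
  proof -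
    let ?I = "({a} \<times> nbrs C a) \<times> ({b} \<times> nbrs D b)"
    have fin_fib: "finite (fib (a, b))" using finL unfolding fib_def by simp
    have aC: "a \<in> C" and bD: "b \<in> D" using a b H.W_sub K.W_sub by blast+
    have finI: "finite ?I" using H.finite_nbrs[OF aC] K.finite_nbrs[OF bD] by simp
    have B: "finite (B (fst i) (snd i)) \<and> card (B (fst i) (snd i)) \<le> m" if "i \<in> ?I" for i
    proof -
      have i: "fst i \<in> E" "snd i \<in> E" using that unfolding nbrs_def by auto
      show ?thesis
        unfolding B_def by (rule fibre_bound[OF H.H K.H _ A_sub _ i]) (fact stab A_ineq)+
    qed
    have sub: "(SIGMA w:fib (a, b). nbrs (C \<inter> D) w) \<subseteq> (\<Union>i\<in>?I. B (fst i) (snd i))"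
    proof (rule subsetI, elim SigmaE)
      fix e w y assume w: "w \<in> fib (a, b)" and y: "y \<in> nbrs (C \<inter> D) w" and e: "e = (w, y)"
      have wL: "w \<in> WL" "rH w = a" "rK w = b" using w unfolding fib_def by auto
      obtain h k where hk: "h \<in> H" "w = act h a" "k \<in> K" "w = act k b"
        using r(1)[OF wL(1), unfolded wL(2)] r(2)[OF wL(1), unfolded wL(3)] by blast
      have "y \<in> act h ` nbrs C a"
        using y nbrs_sub(1)[of w] H.nbrs_act[OF hk(1) aC] unfolding hk(2)[symmetric] by blast
      then obtain y1 where y1: "y1 \<in> nbrs C a" "y = act h y1" by blast
      have "y \<in> act k ` nbrs D b"
        using y nbrs_sub(2)[of w] K.nbrs_act[OF hk(3) bD] unfolding hk(4)[symmetric] by blast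
      then obtain y2 where y2: "y2 \<in> nbrs D b" "y = act k y2" by blast
      have "e = act2 h (a, y1)" "e = act2 k (b, y2)"
        unfolding e map_prod_simp using hk(2,4) y1(2) y2(2) by simp_all
      moreover have "e \<in> A" using wL(1) y e unfolding A_def by simp
      ultimately have "e \<in> B (a, y1) (b, y2)"
        unfolding B_def by (intro CollectI conjI bexI[OF _ hk(1)] bexI[OF _ hk(3)])
      then show "e \<in> (\<Union>i\<in>?I. B (fst i) (snd i))"
        using y1(1) y2(1) by (intro UN_I[of "((a, y1), (b, y2))"]) simp_all
    qed
    have "(\<Sum>w\<in>fib (a, b). ?N w) = card (SIGMA w:fib (a, b). nbrs (C \<inter> D) w)"
      using fin_fib L.finite_nbrs L.W_sub by (subst card_SigmaI) (auto simp: fib_def)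
    also have "\<dots> \<le> card (\<Union>i\<in>?I. B (fst i) (snd i))"
      using finI B by (intro card_mono sub finite_UN_I) blast+
    also have "\<dots> \<le> (\<Sum>i\<in>?I. card (B (fst i) (snd i)))"
      by (rule card_UN_le[OF finI])
    also have "\<dots> \<le> (\<Sum>i\<in>?I. m)"
      by (rule sum_mono) (use B in blast)
    also have "\<dots> = m * (card (nbrs C a) * card (nbrs D b))"
      by (simp add: card_cartesian_product)
    finally show ?thesis .
  qed
  have excess: "(\<Sum>w\<in>fib (a, b). int (?N w) - 2) \<le>
      3 * int m * ((int (card (nbrs C a)) - 2) * (int (card (nbrs D b)) - 2))"
    if a: "a \<in> WH" and b: "b \<in> WK" for a b
  proof (rule sum_excess_le)
    show "int (?N w) \<le> int (card (nbrs C a))" if "w \<in> fib (a, b)" for w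
      using NH[of w] that by (simp add: fib_def)
    show "int (?N w) \<le> int (card (nbrs D b))" if "w \<in> fib (a, b)" for w
      using NK[of w] that by (simp add: fib_def)
    show "2 \<le> int (card (nbrs C a))" "2 \<le> int (card (nbrs D b))"
      using degH[of a] degK[of b] H.W_sub K.W_sub a b by auto
    show "(\<Sum>w\<in>fib (a, b). int (?N w)) \<le> int m * (int (card (nbrs C a)) * int (card (nbrs D b)))"
      using fib_sum[OF a b] by (metis of_nat_le_iff of_nat_mult of_nat_sum)
  qed simp
  have "(\<Sum>w\<in>WL. int (?N w) - 2) = (\<Sum>ab\<in>WH \<times> WK. \<Sum>w\<in>fib ab. int (?N w) - 2)"
  proof -
    have img: "(\<lambda>w. (rH w, rK w)) ` WL \<subseteq> WH \<times> WK" using r by auto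
    have "fib ab = {w \<in> WL. (rH w, rK w) = ab}" for ab unfolding fib_def by auto
    then show ?thesis
      using sum.group[OF finL finite_cartesian_product[OF finH finK] img, of "\<lambda>w. int (?N w) - 2"] by simp
  qed
  also have "\<dots> \<le> (\<Sum>ab\<in>WH \<times> WK. 3 * int m * ((int (card (nbrs C (fst ab))) - 2) * (int (card (nbrs D (snd ab))) - 2)))"
    by (rule sum_mono) (use excess in auto)
  also have "\<dots> = 3 * int m * ((\<Sum>w\<in>WH. int (card (nbrs C w)) - 2) * (\<Sum>w\<in>WK. int (card (nbrs D w)) - 2))"
    unfolding sum_product sum.cartesian_product by (simp add: sum_distrib_left case_prod_beta)
  finally show ?thesis .
qed

lemma free_subtree_basis:
  assumes "free_subtree V E G act H C P F"
  obtains W and X :: "'a set" where "fundamental_subtree V E G act H C P F W" "finite X" "free_group X \<cong> G\<lparr>carrier := H\<rparr>"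
    "(\<Sum>w\<in>W. int (card (nbrs C w)) - 2) = 2 * int (card X) - 2"
proof -
  interpret free_subtree V E G act H C P F by (rule assms)
  obtain W where W: "transversal_subtree W" "\<And>x. x \<in> C \<Longrightarrow> \<exists>w\<in>W. \<exists>h\<in>H. x = act h w"
    by (rule fundamental_subtree_exists) blast
  then interpret fundamental_subtree V E G act H C P F W by unfold_locales auto
  obtain X where X: "X \<subseteq> H" "finite X" "free_group X \<cong> G\<lparr>carrier := H\<rparr>"
      "(\<Sum>w\<in>W. int (card (nbrs C w)) - 2) = 2 * int (card X) - 2"
    by (rule free_basis_Euler)
  show ?thesis by (rule that[OF fundamental_subtree_axioms X(2-4)])
qed

lemma free_group_trivial: "free_group ({} :: 'a set) \<cong> G\<lparr>carrier := {\<one>}\<rparr>"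
  using free_group_iso_subgroup[of "{}"] by (simp add: generate_empty)

theorem Int_rank_inequality:
  assumes H: "subgroup H G" "H = generate G A" "finite A" "A \<subseteq> carrier G"
    and K: "subgroup K G" "K = generate G B" "finite B" "B \<subseteq> carrier G"
    and V: "V \<noteq> {}"
    and freeH: "\<And>h x. \<lbrakk>h \<in> H; x \<in> V; act h x = x\<rbrakk> \<Longrightarrow> h = \<one>"
    and freeK: "\<And>h x. \<lbrakk>h \<in> K; x \<in> V; act h x = x\<rbrakk> \<Longrightarrow> h = \<one>"
    and stab: "edge_stabilizers_le (H <#> K) m"
  obtains XH XK XL :: "'a set" where "finite XH" "free_group XH \<cong> G\<lparr>carrier := H\<rparr>"
    "finite XK" "free_group XK \<cong> G\<lparr>carrier := K\<rparr>"
    "finite XL" "free_group XL \<cong> G\<lparr>carrier := H \<inter> K\<rparr>"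
    "card XL - 1 \<le> 6 * m * (card XH - 1) * (card XK - 1)"
proof -
  obtain CH PH FH where TH: "free_subtree V E G act H CH PH FH"
    by (rule cofinite_subtree_exists[OF H V freeH])
  obtain CK PK FK where TK: "free_subtree V E G act K CK PK FK"
    by (rule cofinite_subtree_exists[OF K V freeK])
  show ?thesis
  proof (cases "H \<inter> K = {\<one>}")
    case True
    obtain XH :: "'a set" where XH: "finite XH" "free_group XH \<cong> G\<lparr>carrier := H\<rparr>"
      by (rule free_subtree_basis[OF TH]) blast
    obtain XK :: "'a set" where XK: "finite XK" "free_group XK \<cong> G\<lparr>carrier := K\<rparr>"
      by (rule free_subtree_basis[OF TK]) blast
    \<comment> \<open>The trivial intersection has the empty basis, and \<open>0 - 1\<close> is 0
      for natural numbers.\<close>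
    show ?thesis
      by (rule that[OF XH XK finite.emptyI]) (use free_group_trivial True in simp_all)
  next
    case False
    then have ne: "H \<noteq> {\<one>}" "K \<noteq> {\<one>}"
      using subgroup.one_closed[OF H(1)] subgroup.one_closed[OF K(1)] by blast+
    obtain C P F where C: "free_subtree V E G act H C P F" and degC: "\<And>x. x \<in> C \<Longrightarrow> 2 \<le> card (nbrs C x)"
      by (rule leafless_subtree_exists[OF TH ne(1)]) blast
    obtain D Q F' where D: "free_subtree V E G act K D Q F'" and degD: "\<And>x. x \<in> D \<Longrightarrow> 2 \<le> card (nbrs D x)"
      by (rule leafless_subtree_exists[OF TK ne(2)]) blast
    obtain P'' F'' where L: "free_subtree V E G act (H \<inter> K) (C \<inter> D) P'' F''"
      by (rule Int_free_subtree[OF C D False]) (rule stab, blast)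
    obtain WH and XH :: "'a set" where XH: "fundamental_subtree V E G act H C P F WH" "finite XH"
        "free_group XH \<cong> G\<lparr>carrier := H\<rparr>" "(\<Sum>w\<in>WH. int (card (nbrs C w)) - 2) = 2 * int (card XH) - 2"
      by (rule free_subtree_basis[OF C])
    obtain WK and XK :: "'a set" where XK: "fundamental_subtree V E G act K D Q F' WK" "finite XK"
        "free_group XK \<cong> G\<lparr>carrier := K\<rparr>" "(\<Sum>w\<in>WK. int (card (nbrs D w)) - 2) = 2 * int (card XK) - 2"
      by (rule free_subtree_basis[OF D])
    obtain WL and XL :: "'a set" where XL: "fundamental_subtree V E G act (H \<inter> K) (C \<inter> D) P'' F'' WL" "finite XL"
        "free_group XL \<cong> G\<lparr>carrier := H \<inter> K\<rparr>"
        "(\<Sum>w\<in>WL. int (card (nbrs (C \<inter> D) w)) - 2) = 2 * int (card XL) - 2"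
      by (rule free_subtree_basis[OF L])
    \<comment> \<open>Leaflessness makes both sums nonnegative, so the ranks are at least 1 and
      truncated subtraction agrees with subtraction of integers.\<close>
    have sumH: "0 \<le> (\<Sum>w\<in>WH. int (card (nbrs C w)) - 2)"
      using degC fundamental_subtree.W_sub[OF XH(1)] by (intro sum_nonneg) force
    have sumK: "0 \<le> (\<Sum>w\<in>WK. int (card (nbrs D w)) - 2)"
      using degD fundamental_subtree.W_sub[OF XK(1)] by (intro sum_nonneg) force
    have "2 * int (card XL) - 2 \<le> 3 * int m * ((2 * int (card XH) - 2) * (2 * int (card XK) - 2))"
      unfolding XH(4)[symmetric] XK(4)[symmetric] XL(4)[symmetric]
      by (rule Int_rank_bound[OF XH(1) XK(1) XL(1)]) (fact degC degD stab)+
    \<comment> \<open>Halving both sides turns \<open>3 * 2 * 2\<close> into 6.\<close>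
    then have "int (card XL) - 1 \<le> 6 * int m * (int (card XH) - 1) * (int (card XK) - 1)"
      by (simp add: algebra_simps)
    also have "\<dots> = int (6 * m * (card XH - 1) * (card XK - 1))"
      using sumH sumK unfolding XH(4) XK(4) by (simp add: of_nat_diff)
    finally have "card XL - 1 \<le> 6 * m * (card XH - 1) * (card XK - 1)" by linarith
    then show ?thesis using that XH(2,3) XK(2,3) XL(2,3) by blast
  qed
qed

end

section \<open>Parity cocycles on the underlying graph\<close>

text \<open>The involution is constrained on the arcs of \<open>T\<close> only, so a subgraph of the
  base can be taken with the inversion of the base.\<close>

locale involutive_digraph = wf_digraph T for T :: "('v, 'e) pre_digraph" +
  fixes rv :: "'e \<Rightarrow> 'e"
  assumes rv_arc: "e \<in> arcs T \<Longrightarrow> rv e \<in> arcs T"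
    and rv_rv: "e \<in> arcs T \<Longrightarrow> rv (rv e) = e"
    and rv_tail: "e \<in> arcs T \<Longrightarrow> tail T (rv e) = head T e"
    and rv_ne: "e \<in> arcs T \<Longrightarrow> rv e \<noteq> e"
begin

lemma rv_head: "e \<in> arcs T \<Longrightarrow> head T (rv e) = tail T e"
  using rv_tail[of "rv e"] rv_rv rv_arc by simp

text \<open>Vanishing of the first cohomology with coefficients in Z/2, where the cochains are
  symmetric under the inversion.\<close>

definition even_coboundary :: bool where
  "even_coboundary \<longleftrightarrow> (\<forall>f. (\<forall>e\<in>arcs T. f (rv e) = f e) \<longrightarrow>
    (\<exists>\<phi>. \<forall>e\<in>arcs T. \<phi> (head T e) = (\<phi> (tail T e) \<noteq> f e)))"

lemma symcl_arcs_ends: "(arcs_ends T)\<^sup>s = arcs_ends T"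
proof -
  have "(b, a) \<in> arcs_ends T" if ab: "(a, b) \<in> arcs_ends T" for a b
  proof -
    obtain e where "e \<in> arcs T" "tail T e = a" "head T e = b"
      using ab by (rule reachableE)
    then show ?thesis using rv_arc rv_tail rv_head unfolding arcs_ends_conv by force
  qed
  then show ?thesis unfolding symcl_def by auto
qed

lemma connected_iff:
  "connected T \<longleftrightarrow> verts T \<noteq> {} \<and> (\<forall>u\<in>verts T. \<forall>v\<in>verts T. (u, v) \<in> (arcs_ends T)\<^sup>*)"
proof -
  have "(u, v) \<in> rtrancl_on (verts T) (arcs_ends T)" if "(u, v) \<in> (arcs_ends T)\<^sup>*" "u \<in> verts T" for u v
    using that
  proof (induction rule: rtrancl_induct)
    case (step v w)
    then have "w \<in> verts T" unfolding arcs_ends_conv by auto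
    then show ?case using step by (meson rtrancl_on_into_rtrancl_on)
  qed simp
  then show ?thesis unfolding connected_conv symcl_arcs_ends
    using rtrancl_on_rtranclI[of _ _ "verts T" "arcs_ends T"] by blast
qed

definition parity :: "('e \<Rightarrow> bool) \<Rightarrow> 'e list \<Rightarrow> bool" where
  "parity f p \<longleftrightarrow> odd (length (filter f p))"

lemma parity_simps [simp]:
  "\<not> parity f []" "parity f (e # p) = (f e \<noteq> parity f p)" "parity f (p @ q) = (parity f p \<noteq> parity f q)"
  by (auto simp: parity_def)

text \<open>A closed walk with a repeated vertex splits into two shorter closed walks. Otherwise it
  is a cycle, hence it backtracks somewhere, and deleting the two mutually inverse arcs does not
  change the parity.\<close>

lemma closed_walk_even:
  assumes no_cycle: "\<And>p. cycle p \<Longrightarrow> \<not> reduced_path rv p"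
    and f: "\<And>e. e \<in> arcs T \<Longrightarrow> f (rv e) = f e"
    and p: "awalk u p u"
  shows "\<not> parity f p"
  using p
proof (induction p arbitrary: u rule: length_induct)
  case (1 p)
  show ?case
  proof (cases p)
    case (Cons e q)
    have eq: "e \<in> arcs T" "tail T e = u" "awalk (head T e) q u"
      using 1(2) Cons by (auto simp: awalk_Cons_iff)
    show ?thesis
    proof (cases "distinct (awalk_verts (head T e) q)")
      case False
      obtain q1 r s w where q: "q = q1 @ r @ s" "0 < length r"
          "awalk (head T e) q1 w" "awalk w r w" "awalk w s u"
        using awalk_not_distinct_decomp[OF eq(3) False] by blast
      have "awalk u (e # q1 @ s) u" using eq q by (auto simp: awalk_Cons_iff)
      moreover have "length (e # q1 @ s) < length p" "length r < length p" using Cons q by auto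
      ultimately have "\<not> parity f (e # q1 @ s)" "\<not> parity f r" using 1(1) q(4) by blast+
      then show ?thesis unfolding Cons q(1) by auto
    next
      case True
      then have "cycle p" using 1(2) Cons eq(2) unfolding cycle_def by auto
      then obtain x a b y where ab: "p = x @ a # b # y" "b = rv a"
        using no_cycle[of p] unfolding reduced_path_def by (blast dest: not_successivelyD)
      have a: "a \<in> arcs T" using 1(2) ab by (auto simp: awalk_def)
      have "awalk u (x @ y) u"
        using 1(2) rv_head[OF a] unfolding ab by (auto simp: awalk_Cons_iff)
      moreover have "length (x @ y) < length p" using ab by simp
      ultimately have "\<not> parity f (x @ y)" using 1(1) by blast
      then show ?thesis using f[OF a] unfolding ab by auto
    qed
  qed simp
qed

lemma awalk_reverse:
  "awalk u p v \<Longrightarrow> awalk v (rev (map rv p)) u"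
proof (induction p arbitrary: u)
  case (Cons e p)
  then have e: "e \<in> arcs T" "tail T e = u" "awalk (head T e) p v" by (auto simp: awalk_Cons_iff)
  then have "awalk (head T e) [rv e] u"
    using rv_arc rv_tail rv_head by (auto simp: awalk_Cons_iff awalk_Nil_iff)
  then show ?case using Cons.IH[OF e(3)] by simp
qed (auto simp: awalk_Nil_iff)

text \<open>The potential at \<open>v\<close> is the parity of a walk from a base vertex to
  \<open>v\<close>; two such walks combine to a closed walk, which is even.\<close>

lemma tree_even_coboundary:
  assumes tree: "bidirected_tree rv T"
  shows even_coboundary
  unfolding even_coboundary_def
proof (intro allI impI)
  fix f :: "'e \<Rightarrow> bool" assume f: "\<forall>e\<in>arcs T. f (rv e) = f e"
  have even: "\<not> parity f p" if "awalk u p u" for u p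
    using closed_walk_even[of f u p] tree f that unfolding bidirected_tree_def by blast
  have "connected T" using tree by (simp add: bidirected_tree_def)
  then obtain v0 where v0: "v0 \<in> verts T" and conn: "\<And>v. v \<in> verts T \<Longrightarrow> (v0, v) \<in> (arcs_ends T)\<^sup>*"
    unfolding connected_iff by blast
  have walk: "\<exists>p. awalk v0 p v" if "v \<in> verts T" for v
    using conn[OF that]
  proof (induction rule: rtrancl_induct)
    case base
    then show ?case using v0 by (auto simp: awalk_Nil_iff intro: exI[of _ "[]"])
  next
    case (step v w)
    then obtain p e where "awalk v0 p v" "e \<in> arcs T" "tail T e = v" "head T e = w"
      unfolding arcs_ends_conv by auto
    then have "awalk v0 (p @ [e]) w" by (auto simp: awalk_Cons_iff awalk_Nil_iff)
    then show ?case by blast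
  qed
  have unique: "parity f p = parity f q" if "awalk v0 p v" "awalk v0 q v" for p q v
  proof -
    have "parity f (rev (map rv q)) = parity f q" if "set q \<subseteq> arcs T" for q
      using that f by (induction q) auto
    moreover have "set q \<subseteq> arcs T" using that(2) by (auto simp: awalk_def)
    moreover have "awalk v0 (p @ rev (map rv q)) v0"
      using awalk_reverse[OF that(2)] that(1) by auto
    ultimately show ?thesis using even[of v0 "p @ rev (map rv q)"] by auto
  qed
  define \<phi> where "\<phi> v = (\<exists>p. awalk v0 p v \<and> parity f p)" for v
  have \<phi>: "\<phi> v = parity f p" if "awalk v0 p v" for v p
    using unique that unfolding \<phi>_def by blast
  have "\<phi> (head T e) = (\<phi> (tail T e) \<noteq> f e)" if e: "e \<in> arcs T" for e
  proof -
    obtain p where p: "awalk v0 p (tail T e)" using walk e by (meson tail_in_verts)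
    then have "awalk v0 (p @ [e]) (head T e)" using e by (auto simp: awalk_Cons_iff awalk_Nil_iff)
    then show ?thesis using \<phi>[OF p] \<phi>[of "p @ [e]" "head T e"] by auto
  qed
  then show "\<exists>\<phi>. \<forall>e\<in>arcs T. \<phi> (head T e) = (\<phi> (tail T e) \<noteq> f e)" by blast
qed

text \<open>Testing against the indicator of the first edge of a reduced cycle shows that the
  cycle runs through this edge a second time.\<close>

lemma even_coboundary_no_reduced_cycle:
  assumes cob: even_coboundary and p: "cycle p"
  shows "\<not> reduced_path rv p"
proof
  assume red: "reduced_path rv p"
  obtain u where u: "awalk u p u" "distinct (tl (awalk_verts u p))" "distinct p" "p \<noteq> []"
    using p unfolding cycle_conv by blast
  obtain e q where p_eq: "p = e # q" using u(4) by (cases p) auto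
  have e: "e \<in> arcs T" "tail T e = u" "awalk (head T e) q u"
    using u(1) p_eq by (auto simp: awalk_Cons_iff)
  define f where "f a = (a = e \<or> a = rv e)" for a
  have "f (rv a) = f a" if "a \<in> arcs T" for a
    using rv_rv e(1) that unfolding f_def by metis
  then obtain \<phi> where \<phi>: "\<And>a. a \<in> arcs T \<Longrightarrow> \<phi> (head T a) = (\<phi> (tail T a) \<noteq> f a)"
    using cob unfolding even_coboundary_def by metis
  have "\<phi> w = (\<phi> v \<noteq> parity f r)" if "awalk v r w" for v r w
    using that
  proof (induction r arbitrary: v)
    case (Cons a r)
    then show ?case using \<phi>[of a] by (auto simp: awalk_Cons_iff)
  qed (auto simp: awalk_Nil_iff)
  then have "\<not> parity f p" using u(1) by blast
  then have "parity f q" unfolding p_eq by (simp add: f_def)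
  have "filter f q \<noteq> []" using \<open>parity f q\<close> unfolding parity_def by auto
  \<comment> \<open>\<open>e\<close> itself cannot recur, because the arcs of a cycle are
    distinct.\<close>
  then have "rv e \<in> set q" using u(3) unfolding p_eq f_def by (auto simp: filter_empty_conv)
  then obtain q1 q2 where q: "q = q1 @ rv e # q2" by (meson split_list)
  \<comment> \<open>Either \<open>rv e\<close> follows \<open>e\<close> at once, which is a
    backtracking, or the part in between returns to \<open>head T e\<close> and repeats a
    vertex.\<close>
  show False
  proof (cases q1)
    case Nil
    then show False using red unfolding p_eq q reduced_path_def by simp
  next
    case (Cons a q1')
    have w: "awalk (head T e) q1 (head T e)" "awalk (head T e) (rv e # q2) u"
      using e(3) rv_tail[OF e(1)] unfolding q by (auto simp: awalk_Cons_iff)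
    have "awalk_verts (head T e) (q1 @ rv e # q2) =
        awalk_verts (head T e) q1 @ tl (awalk_verts (head T e) (rv e # q2))"
      using awalk_verts_append[of "head T e" q1 "rv e # q2" u] e(3) w unfolding q by simp
    then have "distinct (awalk_verts (head T e) q1)"
      using u(2) unfolding p_eq q by simp
    moreover have "q1 \<noteq> []" using Cons by simp
    ultimately show False using w(1) by (metis apath_def apath_nonempty_ends)
  qed
qed

end

locale spanning_subtree = bidirected_digraph Y rv for Y :: "('v, 'e) pre_digraph" and rv +
  fixes S :: "('v, 'e) pre_digraph"
  assumes Y_connected: "connected Y"
    and maximal: "pre_digraph.max_subgraph Y (bidirected_tree rv) S"
begin

lemma S_subgraph: "subgraph S Y" and S_tree: "bidirected_tree rv S"
  and S_maximal: "\<lbrakk>subgraph S S'; subgraph S' Y; bidirected_tree rv S'\<rbrakk> \<Longrightarrow> S' = S"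
  using maximal unfolding pre_digraph.max_subgraph_def by blast+

lemma S_verts: "verts S \<subseteq> verts Y" and S_arcs: "arcs S \<subseteq> arcs Y"
  and S_tail: "tail S = tail Y" and S_head: "head S = head Y" and S_wf: "wf_digraph S"
  using S_subgraph unfolding subgraph_def compatible_def by auto

lemma involutive_subgraph:
  assumes "subgraph T Y" "rv ` arcs T \<subseteq> arcs T"
  shows "involutive_digraph T rv"
proof -
  have T: "arcs T \<subseteq> arcs Y" "tail T = tail Y" "head T = head Y" "wf_digraph T"
    using assms(1) unfolding subgraph_def compatible_def by auto
  show ?thesis
  proof (intro involutive_digraph.intro involutive_digraph_axioms.intro T(4))
    fix e assume e: "e \<in> arcs T"
    then have eY: "e \<in> arcs Y" using T(1) by blast
    show "rv e \<in> arcs T" "rv (rv e) = e" "tail T (rv e) = head T e" "rv e \<noteq> e"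
      using assms(2) e eY arev_neq[OF eY] unfolding T by auto
  qed
qed

sublocale S: involutive_digraph S rv
  using involutive_subgraph[OF S_subgraph] S_tree unfolding bidirected_tree_def by blast

text \<open>Otherwise an edge leaving \<open>S\<close> could be attached together with its new end.
  The enlarged graph is recognised as a tree by its potentials: a potential on \<open>S\<close>
  extends to the new vertex by the value that the new edge prescribes.\<close>

lemma S_spanning: "verts S = verts Y"
proof (rule ccontr)
  assume "verts S \<noteq> verts Y"
  then obtain v where v: "v \<in> verts Y" "v \<notin> verts S" using S_verts by blast
  have "connected S" using S_tree by (simp add: bidirected_tree_def)
  then obtain u where u: "u \<in> verts S" and S_conn: "\<And>u v. \<lbrakk>u \<in> verts S; v \<in> verts S\<rbrakk> \<Longrightarrow> (u, v) \<in> (arcs_ends S)\<^sup>*"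
    unfolding S.connected_iff by blast
  interpret Y: involutive_digraph Y rv
    by (rule involutive_subgraph) (auto simp: subgraph_refl)
  have "(u, v) \<in> (arcs_ends Y)\<^sup>*"
    using Y_connected u v S_verts unfolding Y.connected_iff by blast
  then have "\<exists>e\<in>arcs Y. tail Y e \<in> verts S \<and> head Y e \<notin> verts S"
    using v(2)
  proof (induction rule: rtrancl_induct)
    case (step a b)
    then show ?case unfolding arcs_ends_conv by auto
  qed (use u in simp)
  then obtain e where e: "e \<in> arcs Y" "tail Y e \<in> verts S" "head Y e \<notin> verts S" by blast
  define S' where "S' = \<lparr>verts = insert (head Y e) (verts S), arcs = insert e (insert (rv e) (arcs S)),
    tail = tail Y, head = head Y\<rparr>"
  have S'_simps: "verts S' = insert (head Y e) (verts S)" "arcs S' = insert e (insert (rv e) (arcs S))"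
    "tail S' = tail Y" "head S' = head Y"
    by (simp_all add: S'_def)
  have S_ends: "tail Y a \<in> verts S" "head Y a \<in> verts S" if "a \<in> arcs S" for a
    using S.wellformed[OF that] by (simp_all add: S_tail S_head)
  have "wf_digraph S'"
    by unfold_locales (use e S_ends in \<open>auto simp: S'_simps\<close>)
  then have sub: "subgraph S S'" "subgraph S' Y"
    using e S_verts S_arcs S_wf wf_digraph
    by (auto simp: subgraph_def compatible_def S'_simps S_tail S_head)
  have inv: "rv ` arcs S' \<subseteq> arcs S'" using S.rv_arc by (auto simp: S'_simps)
  interpret S': involutive_digraph S' rv by (rule involutive_subgraph[OF sub(2) inv])
  have "connected S'"
    unfolding S'.connected_iff
  proof (intro conjI ballI)
    have "arcs_ends S \<subseteq> arcs_ends S'" unfolding arcs_ends_conv S'_simps S_tail S_head by blast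
    then have mono: "(a, b) \<in> (arcs_ends S')\<^sup>*" if "a \<in> verts S" "b \<in> verts S" for a b
      using S_conn[OF that] rtrancl_mono by blast
    have "(tail Y a, head Y a) \<in> arcs_ends S'" if "a \<in> {e, rv e}" for a
      unfolding arcs_ends_conv S'_simps using that by blast
    from this[of e] this[of "rv e"]
    have new: "(tail Y e, head Y e) \<in> arcs_ends S'" "(head Y e, tail Y e) \<in> arcs_ends S'"
      using e(1) by simp_all
    have to_tail: "(a, tail Y e) \<in> (arcs_ends S')\<^sup>*" and from_tail: "(tail Y e, a) \<in> (arcs_ends S')\<^sup>*"
      if "a \<in> verts S'" for a
      using that mono e(2) new by (auto simp: S'_simps)
    show "(a, b) \<in> (arcs_ends S')\<^sup>*" if "a \<in> verts S'" "b \<in> verts S'" for a b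
      using to_tail[OF that(1)] from_tail[OF that(2)] by (rule rtrancl_trans)
  qed (simp add: S'_simps)
  moreover have "S'.even_coboundary"
    unfolding S'.even_coboundary_def
  proof (intro allI impI)
    fix f :: "'e \<Rightarrow> bool" assume f: "\<forall>a\<in>arcs S'. f (rv a) = f a"
    then obtain \<phi> where \<phi>: "\<And>a. a \<in> arcs S \<Longrightarrow> \<phi> (head Y a) = (\<phi> (tail Y a) \<noteq> f a)"
      using S.tree_even_coboundary[OF S_tree] unfolding S.even_coboundary_def S'_simps S_tail S_head
      by (metis insertCI)
    define \<phi>' where "\<phi>' = \<phi>(head Y e := (\<phi> (tail Y e) \<noteq> f e))"
    have \<phi>': "\<phi>' a = \<phi> a" if "a \<in> verts S" for a
      unfolding \<phi>'_def by (rule fun_upd_other) (use that e(3) in blast)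
    have "f (rv e) = f e" by (rule bspec[OF f]) (simp add: S'_simps)
    have e_cocycle: "\<phi>' (head Y e) = (\<phi>' (tail Y e) \<noteq> f e)"
      unfolding \<phi>'[OF e(2)] unfolding \<phi>'_def by (simp only: fun_upd_same)
    have "\<phi>' (head Y a) = (\<phi>' (tail Y a) \<noteq> f a)" if "a \<in> arcs S'" for a
    proof -
      consider "a \<in> arcs S" | "a = e" | "a = rv e" using \<open>a \<in> arcs S'\<close> unfolding S'_simps by blast
      then show ?thesis
      proof cases
        case 1
        then show ?thesis using \<phi>[OF 1] \<phi>'[OF S_ends(1)[OF 1]] \<phi>'[OF S_ends(2)[OF 1]] by simp
      next
        case 2
        then show ?thesis using e_cocycle by simp
      next
        case 3
        then show ?thesis
          unfolding 3 head_arev[OF e(1)] tail_arev[OF e(1)] using e_cocycle \<open>f (rv e) = f e\<close> by blast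
      qed
    qed
    then show "\<exists>\<phi>. \<forall>a\<in>arcs S'. \<phi> (head S' a) = (\<phi> (tail S' a) \<noteq> f a)"
      unfolding S'_simps by blast
  qed
  ultimately have "bidirected_tree rv S'"
    using S'.even_coboundary_no_reduced_cycle inv unfolding bidirected_tree_def by blast
  then have "S' = S" using S_maximal sub by blast
  then show False using e(3) S'_simps(1) by auto
qed

lemma even_coboundary_S:
  assumes "\<And>e. e \<in> arcs S \<Longrightarrow> f (rv e) = f e"
  obtains \<phi> where "\<And>e. e \<in> arcs S \<Longrightarrow> \<phi> (head Y e) = (\<phi> (tail Y e) \<noteq> f e)"
  using S.tree_even_coboundary[OF S_tree] assms
  unfolding S.even_coboundary_def S_tail S_head by metis

end

section \<open>Parity cocycles on the fundamental group\<close>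

locale bass_serre = graph_of_groups \<Gamma> for \<Gamma> :: "('v, 'e, 'g, 'h) graph_of_groups" +
  fixes S :: "('v, 'e) pre_digraph" and G :: "('v, 'e, 'g) letter list set set monoid" (structure)
  assumes maximal: "maximal_subtree S \<Gamma>"
    and G: "G = fundamental_group \<Gamma> S"
begin

abbreviation "Y \<equiv> base \<Gamma>"
abbreviation "rv \<equiv> inversion \<Gamma>"
abbreviation "L \<equiv> lists (letters \<Gamma>)"
abbreviation "Pr \<equiv> free_prod \<Gamma>"
abbreviation "Ker \<equiv> normal_closure Pr (relators \<Gamma> S)"

end

sublocale bass_serre \<subseteq> B: spanning_subtree "base \<Gamma>" "inversion \<Gamma>" S
  using bidirected connected maximal unfolding maximal_subtree_def
  by (simp add: spanning_subtree_def spanning_subtree_axioms_def)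

sublocale bass_serre \<subseteq> P: group "free_prod \<Gamma>"
  by (rule group_free_prod)

sublocale bass_serre \<subseteq> G: group G
  unfolding G by (rule group_fundamental_group[OF B.S_arcs])

section \<open>Words, relators and the basic relations in the fundamental group\<close>

context bass_serre
begin

definition cls :: "('v, 'e, 'g) letter list \<Rightarrow> ('v, 'e, 'g) letter list set" where
  "cls w = word_class (letters \<Gamma>) (letter_rels \<Gamma>) w"

definition proj :: "('v, 'e, 'g) letter list \<Rightarrow> ('v, 'e, 'g) letter list set set" where
  "proj w = Ker #>\<^bsub>Pr\<^esub> cls w"

abbreviation vh :: "'v \<Rightarrow> 'g \<Rightarrow> ('v, 'e, 'g) letter list set set" where
  "vh \<equiv> vertex_hom \<Gamma> S"

abbreviation st :: "'e \<Rightarrow> ('v, 'e, 'g) letter list set set" where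
  "st e \<equiv> proj [Stable e True]"

lemma letters_simps [simp]:
  "Vertex v x \<in> letters \<Gamma> \<longleftrightarrow> v \<in> verts Y \<and> x \<in> carrier (vgroup \<Gamma> v)"
  "Stable e b \<in> letters \<Gamma> \<longleftrightarrow> e \<in> arcs Y"
  by (auto simp: letters_def)

lemma letter_rels_lists: "(l, r) \<in> letter_rels \<Gamma> \<Longrightarrow> l \<in> L \<and> r \<in> L"
  using monoid.m_closed[OF group.is_monoid[OF group_vgroup]] monoid.one_closed[OF group.is_monoid[OF group_vgroup]]
  unfolding letter_rels_def by auto

lemma carrier_free_prod: "carrier Pr = cls ` L"
  by (simp add: free_prod_def word_group_def cls_def[abs_def])

lemma cls_one: "\<one>\<^bsub>Pr\<^esub> = cls []"
  by (simp add: free_prod_def word_group_def cls_def)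

lemma cls_closed: "w \<in> L \<Longrightarrow> cls w \<in> carrier Pr"
  unfolding carrier_free_prod by (rule imageI)

lemma cls_mult: "\<lbrakk>u \<in> L; v \<in> L\<rbrakk> \<Longrightarrow> cls u \<otimes>\<^bsub>Pr\<^esub> cls v = cls (u @ v)"
  by (simp only: free_prod_def cls_def word_class_mult)

lemma cls_eq_iff: "\<lbrakk>u \<in> L; v \<in> L\<rbrakk> \<Longrightarrow> cls u = cls v \<longleftrightarrow> equivclp (word_step (letter_rels \<Gamma>)) u v"
  by (simp only: cls_def word_class_eq_iff)

lemma cls_rel:
  assumes "(l, r) \<in> letter_rels \<Gamma>"
  shows "cls l = cls r"
proof -
  have "word_step (letter_rels \<Gamma>) l r"
    unfolding word_step_def using assms by (metis append_Nil append_Nil2)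
  then show ?thesis using letter_rels_lists[OF assms] by (simp add: cls_eq_iff r_into_equivclp)
qed

lemma Ker_normal: "Ker \<lhd> Pr"
  by (rule normal_normal_closure[OF group_free_prod relators_closed[OF B.S_arcs]])

lemma proj_one: "proj [] = \<one>"
  using Ker_normal by (simp add: proj_def cls_one[symmetric] G fundamental_group_def
      P.coset_mult_one normal_imp_subgroup subgroup.subset)

lemma carrier_G: "carrier G = proj ` L"
  by (auto simp: G fundamental_group_def FactGroup_def RCOSETS_def carrier_free_prod proj_def[abs_def])

lemma proj_closed [simp]: "w \<in> L \<Longrightarrow> proj w \<in> carrier G"
  unfolding carrier_G by (rule imageI)

lemma proj_mult: "\<lbrakk>u \<in> L; v \<in> L\<rbrakk> \<Longrightarrow> proj u \<otimes> proj v = proj (u @ v)"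
  using normal.rcos_sum[OF Ker_normal cls_closed cls_closed]
  by (simp add: proj_def G fundamental_group_def FactGroup_def cls_mult)

lemma proj_Cons: "\<lbrakk>a \<in> letters \<Gamma>; w \<in> L\<rbrakk> \<Longrightarrow> proj (a # w) = proj [a] \<otimes> proj w"
  using proj_mult[of "[a]" w] by simp

lemma proj_cong: "cls u = cls v \<Longrightarrow> proj u = proj v"
  by (simp add: proj_def)

lemma proj_Ker:
  assumes "cls w \<in> Ker"
  shows "proj w = \<one>"
proof -
  interpret N: normal Ker "free_prod \<Gamma>" by (rule Ker_normal)
  have "proj w = Ker"
    unfolding proj_def by (rule P.coset_join2[OF N.mem_carrier[OF assms] N.is_subgroup assms])
  then show ?thesis by (simp add: G fundamental_group_def FactGroup_def)
qed

lemma vh_eq: "vh v x = proj [Vertex v x]"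
  by (simp add: vertex_hom_def vertex_elt_def proj_def cls_def)

lemma vh_closed [simp]: "\<lbrakk>v \<in> verts Y; x \<in> carrier (vgroup \<Gamma> v)\<rbrakk> \<Longrightarrow> vh v x \<in> carrier G"
  by (simp add: vh_eq)

lemma st_closed [simp]: "e \<in> arcs Y \<Longrightarrow> st e \<in> carrier G"
  by simp

lemma vertex_rel:
  assumes "v \<in> verts Y" "x \<in> carrier (vgroup \<Gamma> v)" "y \<in> carrier (vgroup \<Gamma> v)"
  shows "([Vertex v x, Vertex v y], [Vertex v (x \<otimes>\<^bsub>vgroup \<Gamma> v\<^esub> y)]) \<in> letter_rels \<Gamma>"
  unfolding letter_rels_def using assms by blast

lemma vertex_one_rel: "v \<in> verts Y \<Longrightarrow> ([Vertex v \<one>\<^bsub>vgroup \<Gamma> v\<^esub>], []) \<in> letter_rels \<Gamma>"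
  unfolding letter_rels_def by blast

lemma stable_rel: "e \<in> arcs Y \<Longrightarrow> ([Stable e b, Stable e (\<not> b)], []) \<in> letter_rels \<Gamma>"
  unfolding letter_rels_def by blast

lemma vh_mult:
  assumes "v \<in> verts Y" "x \<in> carrier (vgroup \<Gamma> v)" "y \<in> carrier (vgroup \<Gamma> v)"
  shows "vh v x \<otimes> vh v y = vh v (x \<otimes>\<^bsub>vgroup \<Gamma> v\<^esub> y)"
  using proj_mult[of "[Vertex v x]" "[Vertex v y]"] proj_cong[OF cls_rel[OF vertex_rel[OF assms]]] assms
  by (simp add: vh_eq)

lemma vh_one: "v \<in> verts Y \<Longrightarrow> vh v \<one>\<^bsub>vgroup \<Gamma> v\<^esub> = \<one>"
  using proj_cong[OF cls_rel[OF vertex_one_rel]] by (simp add: vh_eq proj_one)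

lemma inv_cls_stable: "e \<in> arcs Y \<Longrightarrow> inv\<^bsub>Pr\<^esub> cls [Stable e True] = cls [Stable e False]"
  using cls_rel[OF stable_rel[of e False]]
  by (intro P.inv_equality) (simp_all add: cls_mult cls_one cls_closed)

lemma inv_cls_vertex:
  assumes v: "v \<in> verts Y" "x \<in> carrier (vgroup \<Gamma> v)"
  shows "inv\<^bsub>Pr\<^esub> cls [Vertex v x] = cls [Vertex v (inv\<^bsub>vgroup \<Gamma> v\<^esub> x)]"
proof -
  interpret V: group "vgroup \<Gamma> v" by (rule group_vgroup[OF v(1)])
  show ?thesis
    using cls_rel[OF vertex_rel[OF v(1) V.inv_closed[OF v(2)] v(2)]] cls_rel[OF vertex_one_rel[OF v(1)]] v
    by (intro P.inv_equality) (simp_all add: cls_mult cls_one cls_closed)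
qed

lemma proj_stable_False:
  assumes "e \<in> arcs Y"
  shows "proj [Stable e False] = inv st e"
  using proj_mult[of "[Stable e False]" "[Stable e True]"] proj_cong[OF cls_rel[OF stable_rel[OF assms, of False]]] assms
  by (intro G.inv_equality[symmetric]) (simp_all add: proj_one)

lemma emb_closed: "\<lbrakk>e \<in> arcs Y; x \<in> carrier (egroup \<Gamma> e)\<rbrakk> \<Longrightarrow> emb \<Gamma> e x \<in> carrier (vgroup \<Gamma> (tail Y e))"
  using emb_mon[of e] by (auto simp: mon_def hom_def)

lemma emb_rv_closed:
  "\<lbrakk>e \<in> arcs Y; x \<in> carrier (egroup \<Gamma> e)\<rbrakk> \<Longrightarrow> emb \<Gamma> (rv e) x \<in> carrier (vgroup \<Gamma> (head Y e))"
  using emb_closed[of "rv e" x] egroup_inversion[of e] by simp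

text \<open>Inverses of group elements are replaced by letters, because the holonomy used later is
  defined letter by letter.\<close>

definition edge_word where
  "edge_word e x = [Stable e False, Vertex (tail Y e) (emb \<Gamma> e x), Stable e True,
    Vertex (head Y e) (inv\<^bsub>vgroup \<Gamma> (head Y e)\<^esub> emb \<Gamma> (rv e) x)]"

definition relator_words where
  "relator_words = {edge_word e x |e x. e \<in> arcs Y \<and> x \<in> carrier (egroup \<Gamma> e)} \<union>
    {[Stable e True, Stable (rv e) True] |e. e \<in> arcs Y} \<union> {[Stable e True] |e. e \<in> arcs S}"

lemma edge_word_lists: "\<lbrakk>e \<in> arcs Y; x \<in> carrier (egroup \<Gamma> e)\<rbrakk> \<Longrightarrow> edge_word e x \<in> L"
  using emb_closed emb_rv_closed group.inv_closed[OF group_vgroup]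
  unfolding edge_word_def by simp

lemma relator_words_lists: "relator_words \<subseteq> L"
  using edge_word_lists B.S_arcs unfolding relator_words_def by auto

lemma relators_words: "relators \<Gamma> S = cls ` relator_words"
proof -
  have elts: "stable_elt \<Gamma> e = cls [Stable e True]" "vertex_elt \<Gamma> v x = cls [Vertex v x]" for e v x
    by (simp_all add: stable_elt_def vertex_elt_def cls_def)
  have edge: "inv\<^bsub>Pr\<^esub> (stable_elt \<Gamma> e) \<otimes>\<^bsub>Pr\<^esub> vertex_elt \<Gamma> (tail Y e) (emb \<Gamma> e x)
       \<otimes>\<^bsub>Pr\<^esub> stable_elt \<Gamma> e
       \<otimes>\<^bsub>Pr\<^esub> inv\<^bsub>Pr\<^esub> (vertex_elt \<Gamma> (tail Y (rv e)) (emb \<Gamma> (rv e) x)) = cls (edge_word e x)"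
    if "e \<in> arcs Y" "x \<in> carrier (egroup \<Gamma> e)" for e x
    using that emb_closed[OF that] emb_rv_closed[OF that] group.inv_closed[OF group_vgroup, of "head Y e"]
    by (simp add: elts inv_cls_stable inv_cls_vertex cls_mult edge_word_def)
  have stable: "stable_elt \<Gamma> e \<otimes>\<^bsub>Pr\<^esub> stable_elt \<Gamma> (rv e) = cls [Stable e True, Stable (rv e) True]"
    if "e \<in> arcs Y" for e
    using that by (simp add: elts cls_mult)
  have "cls ` {edge_word e x |e x. e \<in> arcs Y \<and> x \<in> carrier (egroup \<Gamma> e)} =
      {cls (edge_word e x) |e x. e \<in> arcs Y \<and> x \<in> carrier (egroup \<Gamma> e)}"
    "cls ` {[Stable e True, Stable (rv e) True] |e. e \<in> arcs Y} =
      {cls [Stable e True, Stable (rv e) True] |e. e \<in> arcs Y}"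
    "cls ` {[Stable e True] |e. e \<in> arcs S} = {cls [Stable e True] |e. e \<in> arcs S}"
    by blast+
  then show ?thesis
    unfolding relators_def Let_def relator_words_def image_Un
    using edge stable elts(1) by (simp cong: rev_conj_cong)
qed

lemma relator_word_proj:
  assumes "w \<in> relator_words"
  shows "proj w = \<one>"
proof (rule proj_Ker)
  have "cls w \<in> relators \<Gamma> S" unfolding relators_words using assms by blast
  then show "cls w \<in> Ker" unfolding normal_closure_def by blast
qed

lemma st_rv: "e \<in> arcs Y \<Longrightarrow> st e \<otimes> st (rv e) = \<one>"
  using relator_word_proj[of "[Stable e True, Stable (rv e) True]"] proj_mult[of "[Stable e True]" "[Stable (rv e) True]"]
  by (auto simp: relator_words_def)

lemma st_tree: "e \<in> arcs S \<Longrightarrow> st e = \<one>"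
  using relator_word_proj[of "[Stable e True]"] by (auto simp: relator_words_def)

lemma vh_inv:
  assumes v: "v \<in> verts Y" "x \<in> carrier (vgroup \<Gamma> v)"
  shows "vh v (inv\<^bsub>vgroup \<Gamma> v\<^esub> x) = inv vh v x"
proof -
  interpret V: group "vgroup \<Gamma> v" by (rule group_vgroup[OF v(1)])
  show ?thesis using v vh_mult[of v "inv\<^bsub>vgroup \<Gamma> v\<^esub> x" x] vh_one
    by (intro G.inv_equality[symmetric]) simp_all
qed

lemma st_conj:
  assumes e: "e \<in> arcs Y" "x \<in> carrier (egroup \<Gamma> e)"
  shows "vh (tail Y e) (emb \<Gamma> e x) \<otimes> st e = st e \<otimes> vh (head Y e) (emb \<Gamma> (rv e) x)"
proof -
  let ?a = "vh (tail Y e) (emb \<Gamma> e x)" and ?b = "vh (head Y e) (emb \<Gamma> (rv e) x)"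
  have c: "?a \<in> carrier G" "?b \<in> carrier G" "st e \<in> carrier G"
    using e emb_closed emb_rv_closed by simp_all
  have b': "inv\<^bsub>vgroup \<Gamma> (head Y e)\<^esub> emb \<Gamma> (rv e) x \<in> carrier (vgroup \<Gamma> (head Y e))"
    using e emb_rv_closed group.inv_closed[OF group_vgroup] by simp
  have "proj (edge_word e x) = \<one>"
    by (rule relator_word_proj) (use e in \<open>auto simp: relator_words_def\<close>)
  moreover have "proj (edge_word e x) = inv st e \<otimes> (?a \<otimes> (st e \<otimes> inv ?b))"
    using e emb_closed[OF e] b' vh_inv[OF _ emb_rv_closed[OF e]]
    unfolding edge_word_def vh_eq by (simp add: proj_Cons[of _ "_ # _"] proj_stable_False)
  ultimately have "st e \<otimes> (inv st e \<otimes> (?a \<otimes> (st e \<otimes> inv ?b))) = st e"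
    using c by simp
  then have "?a \<otimes> (st e \<otimes> inv ?b) = st e"
    using c by (simp add: G.m_assoc[symmetric])
  then have "(?a \<otimes> (st e \<otimes> inv ?b)) \<otimes> ?b = st e \<otimes> ?b"
    by (rule arg_cong)
  then show ?thesis using c by (simp add: G.m_assoc)
qed

section \<open>Holonomy of a parity cocycle\<close>

text \<open>The first clause makes \<open>\<Phi> v\<close> a function on cosets of the vertex group,
  which are the vertices of the Bass-Serre tree over \<open>v\<close>. The second clause is the
  coboundary equation over Z/2.\<close>

definition coboundary where
  "coboundary \<Phi> f \<longleftrightarrow> (\<forall>v\<in>verts Y. \<forall>g\<in>carrier G. \<forall>x\<in>carrier (vgroup \<Gamma> v). \<Phi> v (g \<otimes> vh v x) = \<Phi> v g) \<and>
    (\<forall>e\<in>arcs Y. \<forall>g\<in>carrier G. \<Phi> (head Y e) (g \<otimes> st e) = (\<Phi> (tail Y e) g \<noteq> f e g))"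

text \<open>A parity cocycle \<open>f\<close> on the edges of the Bass-Serre tree, written as a function of an edge \<open>e\<close> of
  the base and a coset representative, is a coboundary: \<open>G\<close> acts on the double cover of itself
  whose holonomy along a letter is the parity of \<open>f\<close> along the lifted path. Since this action
  respects the presentation of \<open>G\<close>, no normal form theorem is needed.\<close>

context
  fixes f :: "'e \<Rightarrow> ('v, 'e, 'g) letter list set set \<Rightarrow> bool"
    and \<phi> :: "('v, 'e, 'g) letter list set set \<Rightarrow> 'v \<Rightarrow> bool"
  assumes f_edge: "\<lbrakk>e \<in> arcs Y; g \<in> carrier G; x \<in> carrier (egroup \<Gamma> e)\<rbrakk> \<Longrightarrow>
      f e (g \<otimes> vh (tail Y e) (emb \<Gamma> e x)) = f e g"
    and f_rv: "\<lbrakk>e \<in> arcs Y; g \<in> carrier G\<rbrakk> \<Longrightarrow> f (rv e) (g \<otimes> st e) = f e g"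
    and \<phi>: "\<lbrakk>g \<in> carrier G; e \<in> arcs S\<rbrakk> \<Longrightarrow> \<phi> g (head Y e) = (\<phi> g (tail Y e) \<noteq> f e g)"
begin

text \<open>\<open>\<phi> g\<close> is a potential of \<open>f\<close> on the lift of
  \<open>S\<close> at \<open>g\<close>. A vertex letter leads to a lift that shares a vertex with
  it, a stable letter to a lift joined to it by an edge; \<open>hol\<close> is the discrepancy of
  the two potentials there.\<close>

fun hol :: "('v, 'e, 'g) letter list set set \<Rightarrow> ('v, 'e, 'g) letter \<Rightarrow> bool" where
  "hol g (Vertex v x) = (\<phi> g v \<noteq> \<phi> (g \<otimes> vh v x) v)"
| "hol g (Stable e True) = ((\<phi> g (tail Y e) \<noteq> f e g) \<noteq> \<phi> (g \<otimes> st e) (head Y e))"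
| "hol g (Stable e False) = ((\<phi> (g \<otimes> inv st e) (tail Y e) \<noteq> f e (g \<otimes> inv st e)) \<noteq> \<phi> g (head Y e))"

fun holw :: "('v, 'e, 'g) letter list set set \<Rightarrow> ('v, 'e, 'g) letter list \<Rightarrow> bool" where
  "holw g [] = False"
| "holw g (a # w) = (hol g a \<noteq> holw (g \<otimes> proj [a]) w)"

lemma holw_append:
  "\<lbrakk>g \<in> carrier G; u \<in> L; v \<in> L\<rbrakk> \<Longrightarrow> holw g (u @ v) = (holw g u \<noteq> holw (g \<otimes> proj u) v)"
proof (induction u arbitrary: g rule: list.induct)
  case Nil
  then show ?case by (simp add: proj_one)
next
  case (Cons a u)
  then have a: "a \<in> letters \<Gamma>" "u \<in> L" by simp_all
  then have "proj [a] \<in> carrier G" "proj u \<in> carrier G" by simp_all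
  then show ?case
    using Cons.IH[of "g \<otimes> proj [a]"] Cons.prems a proj_Cons[OF a]
    by (simp add: G.m_assoc) blast
qed

text \<open>The values of \<open>\<phi>\<close> telescope, both sides end at the same element of
  \<open>G\<close>, and an edge crossed back and forth contributes \<open>f\<close> twice.\<close>

lemma holw_rel:
  assumes g: "g \<in> carrier G" and lr: "(l, r) \<in> letter_rels \<Gamma>"
  shows "holw g l = holw g r"
proof -
  consider (mult) v x y where "v \<in> verts Y" "x \<in> carrier (vgroup \<Gamma> v)" "y \<in> carrier (vgroup \<Gamma> v)"
      "l = [Vertex v x, Vertex v y]" "r = [Vertex v (x \<otimes>\<^bsub>vgroup \<Gamma> v\<^esub> y)]"
    | (one) v where "v \<in> verts Y" "l = [Vertex v \<one>\<^bsub>vgroup \<Gamma> v\<^esub>]" "r = []"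
    | (stable) e b where "e \<in> arcs Y" "l = [Stable e b, Stable e (\<not> b)]" "r = []"
    using lr unfolding letter_rels_def by blast
  then show ?thesis
  proof cases
    case mult
    have "g \<otimes> vh v x \<otimes> vh v y = g \<otimes> vh v (x \<otimes>\<^bsub>vgroup \<Gamma> v\<^esub> y)"
      using g mult(1-3) vh_mult[OF mult(1-3)] by (simp add: G.m_assoc)
    then show ?thesis unfolding mult(4,5) by (simp add: vh_eq[symmetric]) blast
  next
    case one
    then show ?thesis using g vh_one[OF one(1)] by simp
  next
    case stable
    have c: "st e \<in> carrier G" using stable by simp
    show ?thesis
    proof (cases b)
      case True
      have "g \<otimes> st e \<otimes> inv st e = g" using g c by (simp add: G.m_assoc)
      then show ?thesis unfolding stable(2,3) using True by simp
    next
      case False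
      have "g \<otimes> inv st e \<otimes> st e = g" using g c by (simp add: G.m_assoc)
      then show ?thesis unfolding stable(2,3) using False
        by (simp add: proj_stable_False[OF stable(1)])
    qed
  qed
qed

lemma holw_cong:
  assumes g: "g \<in> carrier G" and uv: "u \<in> L" "v \<in> L" "cls u = cls v"
  shows "holw g v = holw g u"
proof (rule word_cong_invariant[THEN conjunct2, OF letter_rels_lists])
  show "equivclp (word_step (letter_rels \<Gamma>)) u v" using uv by (simp add: cls_eq_iff)
  fix x y l r assume xy: "x \<in> L" "y \<in> L" and lr: "(l, r) \<in> letter_rels \<Gamma>"
  have l: "l \<in> L" "r \<in> L" using letter_rels_lists[OF lr] by blast+
  have "proj l = proj r" by (rule proj_cong[OF cls_rel[OF lr]])
  then show "holw g (x @ l @ y) = holw g (x @ r @ y)"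
    using holw_append[OF g xy(1), of "l @ y"] holw_append[OF g xy(1), of "r @ y"]
      holw_append[of "g \<otimes> proj x" l y] holw_append[of "g \<otimes> proj x" r y]
      holw_rel[OF _ lr, of "g \<otimes> proj x"] g xy l by simp
qed (use uv in auto)

text \<open>The kernel of the action of the free product on the double cover. Quantifying over all
  starting points \<open>g\<close> makes it invariant under conjugation.\<close>

definition trivial_words where
  "trivial_words = {w \<in> L. proj w = \<one> \<and> (\<forall>g\<in>carrier G. \<not> holw g w)}"

lemma trivial_words_cong:
  assumes "w \<in> L" "cls w \<in> cls ` trivial_words"
  shows "w \<in> trivial_words"
proof -
  obtain u where u: "u \<in> trivial_words" "cls w = cls u" using assms(2) by blast
  then have uL: "u \<in> L" by (simp add: trivial_words_def)
  have "holw g w = holw g u" if "g \<in> carrier G" for g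
    by (rule holw_cong[OF that uL assms(1) u(2)[symmetric]])
  then show ?thesis
    using u(1) assms(1) proj_cong[OF u(2)] unfolding trivial_words_def by simp
qed

lemma trivial_words_conj:
  assumes w: "w \<in> trivial_words" and u: "u \<in> L" "v \<in> L" "cls (u @ v) = cls []"
  shows "u @ w @ v \<in> trivial_words"
proof -
  have wL: "w \<in> L" "proj w = \<one>" using w by (simp_all add: trivial_words_def)
  have uv: "proj u \<otimes> proj v = \<one>"
    using proj_mult[OF u(1,2)] proj_cong[OF u(3)] proj_one by simp
  have "proj (u @ w @ v) = \<one>"
    using proj_mult[of u "w @ v"] proj_mult[of w v] u wL uv by simp
  moreover have "\<not> holw g (u @ w @ v)" if g: "g \<in> carrier G" for g
  proof -
    have gu: "g \<otimes> proj u \<in> carrier G" using g u by simp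
    have "holw g (u @ v) = holw g []" using holw_cong[OF g _ _ u(3)[symmetric]] u by simp
    moreover have "\<not> holw (g \<otimes> proj u) w" using w gu by (simp add: trivial_words_def)
    ultimately show ?thesis
      using holw_append[OF g u(1), of "w @ v"] holw_append[OF gu wL(1) u(2)] holw_append[OF g u(1,2)] u wL gu
      by simp
  qed
  ultimately show ?thesis using u wL by (simp add: trivial_words_def)
qed

lemma inverse_word:
  assumes "w \<in> L"
  obtains v where "v \<in> L" "inv\<^bsub>Pr\<^esub> cls w = cls v" "cls (w @ v) = cls []"
proof -
  have "inv\<^bsub>Pr\<^esub> cls w \<in> carrier Pr" using assms cls_closed by simp
  then obtain v where v: "v \<in> L" "inv\<^bsub>Pr\<^esub> cls w = cls v" unfolding carrier_free_prod by blast
  have "cls (w @ v) = cls []"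
    using cls_mult[OF assms v(1)] P.r_inv[OF cls_closed[OF assms]] v(2) cls_one by simp
  then show ?thesis using that v by blast
qed

lemma trivial_words_normal: "cls ` trivial_words \<lhd> Pr"
  unfolding P.normal_inv_iff
proof
  have TL: "trivial_words \<subseteq> L" by (auto simp: trivial_words_def)
  show "subgroup (cls ` trivial_words) Pr"
  proof (rule P.subgroupI)
    show "cls ` trivial_words \<subseteq> carrier Pr" using TL cls_closed by blast
    have "[] \<in> trivial_words" by (simp add: trivial_words_def proj_one)
    then show "cls ` trivial_words \<noteq> {}" by blast
  next
    fix a assume "a \<in> cls ` trivial_words"
    then obtain w where w: "w \<in> trivial_words" "a = cls w" by blast
    then have wL: "w \<in> L" and wp: "proj w = \<one>" by (simp_all add: trivial_words_def)
    obtain v where v: "v \<in> L" "inv\<^bsub>Pr\<^esub> cls w = cls v" "cls (w @ v) = cls []"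
      by (rule inverse_word[OF wL])
    have "proj v = \<one>"
      using proj_mult[OF wL v(1)] proj_cong[OF v(3)] proj_one wp v(1) by simp
    moreover have "\<not> holw g v" if g: "g \<in> carrier G" for g
      using holw_cong[OF g _ _ v(3)[symmetric]] holw_append[OF g wL v(1)] w(1) wL v(1) wp g
      by (simp add: trivial_words_def)
    ultimately have "v \<in> trivial_words" using v(1) by (simp add: trivial_words_def)
    then show "inv\<^bsub>Pr\<^esub> a \<in> cls ` trivial_words" using v(2) w(2) by blast
    fix b assume "b \<in> cls ` trivial_words"
    then obtain u where u: "u \<in> trivial_words" "b = cls u" by blast
    then have uL: "u \<in> L" and up: "proj u = \<one>" by (simp_all add: trivial_words_def)
    have "w @ u \<in> trivial_words"
      using w(1) u(1) holw_append[OF _ wL uL] proj_mult[OF wL uL] wp up wL uL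
      by (simp add: trivial_words_def)
    then show "a \<otimes>\<^bsub>Pr\<^esub> b \<in> cls ` trivial_words"
      using w(2) u(2) cls_mult[OF wL uL] by blast
  qed
  show "\<forall>x\<in>carrier Pr. \<forall>h\<in>cls ` trivial_words.
      x \<otimes>\<^bsub>Pr\<^esub> h \<otimes>\<^bsub>Pr\<^esub> inv\<^bsub>Pr\<^esub> x \<in> cls ` trivial_words"
  proof (intro ballI)
    fix x h assume "x \<in> carrier Pr" "h \<in> cls ` trivial_words"
    then obtain u w where u: "u \<in> L" "x = cls u" and w: "w \<in> trivial_words" "h = cls w"
      unfolding carrier_free_prod by blast
    have wL: "w \<in> L" using w TL by blast
    obtain v where v: "v \<in> L" "inv\<^bsub>Pr\<^esub> cls u = cls v" "cls (u @ v) = cls []"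
      by (rule inverse_word[OF u(1)])
    have "x \<otimes>\<^bsub>Pr\<^esub> h \<otimes>\<^bsub>Pr\<^esub> inv\<^bsub>Pr\<^esub> x = cls (u @ w @ v)"
      using u w(2) v wL by (simp add: cls_mult)
    then show "x \<otimes>\<^bsub>Pr\<^esub> h \<otimes>\<^bsub>Pr\<^esub> inv\<^bsub>Pr\<^esub> x \<in> cls ` trivial_words"
      using trivial_words_conj[OF w(1) u(1) v(1,3)] by blast
  qed
qed

text \<open>Each assumption serves one family of relators: \<open>f_edge\<close> the edge groups,
  \<open>f_rv\<close> the pairs of mutually inverse edges, and \<open>\<phi>\<close> the edges of
  the maximal subtree.\<close>

lemma relator_words_trivial: "relator_words \<subseteq> trivial_words"
proof
  fix w assume w: "w \<in> relator_words"
  have wL: "w \<in> L" using w relator_words_lists by blast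
  have "\<not> holw g w" if g: "g \<in> carrier G" for g
  proof -
    consider (edge) e x where "e \<in> arcs Y" "x \<in> carrier (egroup \<Gamma> e)" "w = edge_word e x"
      | (stable) e where "e \<in> arcs Y" "w = [Stable e True, Stable (rv e) True]"
      | (tree) e where "e \<in> arcs S" "w = [Stable e True]"
      using w unfolding relator_words_def by blast
    then show ?thesis
    proof cases
      case edge
      let ?a = "vh (tail Y e) (emb \<Gamma> e x)"
      let ?b = "vh (head Y e) (inv\<^bsub>vgroup \<Gamma> (head Y e)\<^esub> emb \<Gamma> (rv e) x)"
      define h where "h = g \<otimes> inv st e"
      have b': "inv\<^bsub>vgroup \<Gamma> (head Y e)\<^esub> emb \<Gamma> (rv e) x \<in> carrier (vgroup \<Gamma> (head Y e))"
        using edge emb_rv_closed group.inv_closed[OF group_vgroup] by simp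
      have c: "st e \<in> carrier G" "?a \<in> carrier G" "?b \<in> carrier G"
        using edge emb_closed b' by simp_all
      have h: "h \<in> carrier G" unfolding h_def using g c by simp
      have "h \<otimes> ?a \<otimes> st e \<otimes> ?b = g"
      proof -
        have "h \<otimes> ?a \<otimes> st e \<otimes> ?b = g \<otimes> proj (edge_word e x)"
          using g c edge(1) emb_closed[OF edge(1,2)] b' unfolding edge_word_def vh_eq h_def
          by (simp add: proj_Cons[of _ "_ # _"] proj_stable_False G.m_assoc)
        then show ?thesis using relator_word_proj[OF w] edge(3) g by simp
      qed
      moreover have "f e (h \<otimes> ?a) = f e h" by (rule f_edge[OF edge(1) h edge(2)])
      ultimately show ?thesis
        unfolding edge(3) edge_word_def
        by (simp add: vh_eq[symmetric] proj_stable_False[OF edge(1)] h_def[symmetric]) blast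
    next
      case stable
      have "g \<otimes> st e \<otimes> st (rv e) = g"
        using g stable(1) st_rv[OF stable(1)] by (simp add: G.m_assoc)
      then show ?thesis
        unfolding stable(2) using f_rv[OF stable(1) g] stable(1) by simp blast
    next
      case tree
      then show ?thesis using \<phi>[OF g tree(1)] st_tree[OF tree(1)] g by simp
    qed
  qed
  then show "w \<in> trivial_words" using wL relator_word_proj[OF w] by (simp add: trivial_words_def)
qed

lemma Ker_trivial: "Ker \<subseteq> cls ` trivial_words"
  unfolding normal_closure_def relators_words
  using trivial_words_normal relator_words_trivial by blast

text \<open>\<open>Ker\<close> is the smallest normal subgroup containing the relators, so it lies
  in the kernel of the action; hence the holonomy of a word depends only on its value in
  \<open>G\<close>.\<close>

lemma holw_proj:
  assumes g: "g \<in> carrier G" and uv: "u \<in> L" "v \<in> L" "proj u = proj v"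
  shows "holw g u = holw g v"
proof -
  obtain v' where v': "v' \<in> L" "inv\<^bsub>Pr\<^esub> cls v = cls v'" "cls (v @ v') = cls []"
    by (rule inverse_word[OF uv(2)])
  interpret N: normal Ker "free_prod \<Gamma>" by (rule Ker_normal)
  have "cls u \<in> Ker #>\<^bsub>Pr\<^esub> cls v"
    using uv(3) P.rcos_self[OF cls_closed[OF uv(1)] N.is_subgroup] unfolding proj_def by simp
  then have "cls u \<otimes>\<^bsub>Pr\<^esub> cls v' \<in> Ker"
    using N.rcos_module_imp[OF P.is_group cls_closed[OF uv(2)]] v'(2) by simp
  then have "u @ v' \<in> trivial_words"
    using trivial_words_cong[of "u @ v'"] Ker_trivial cls_mult[OF uv(1) v'(1)] uv(1) v'(1) by auto
  then have "\<not> holw g (u @ v')" using g by (simp add: trivial_words_def)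
  moreover have "\<not> holw g (v @ v')" using holw_cong[OF g _ _ v'(3)[symmetric]] uv v' by simp
  ultimately show ?thesis
    using holw_append[OF g uv(1) v'(1)] holw_append[OF g uv(2) v'(1)] uv(3) by simp
qed

text \<open>\<open>\<psi> g\<close> is the total discrepancy along any word with value
  \<open>g\<close>. Correcting each \<open>\<phi> g\<close> by it makes the potentials on the lifts
  of \<open>S\<close> fit together.\<close>

lemma edge_cocycle_coboundary_aux:
  "\<exists>\<Phi>. coboundary \<Phi> f"
proof -
  define \<psi> where "\<psi> g = (\<exists>w\<in>L. proj w = g \<and> holw \<one> w)" for g
  have \<psi>: "\<psi> (proj w) = holw \<one> w" if "w \<in> L" for w
    unfolding \<psi>_def using holw_proj[OF G.one_closed _ that] that by blast
  have \<psi>_mult: "\<psi> (g \<otimes> proj [a]) = (\<psi> g \<noteq> hol g a)" if g: "g \<in> carrier G" and a: "a \<in> letters \<Gamma>" for g a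
  proof -
    obtain w where w: "w \<in> L" "g = proj w" using g unfolding carrier_G by blast
    then show ?thesis
      using \<psi>[OF w(1)] \<psi>[of "w @ [a]"] proj_mult[of w "[a]"] holw_append[OF G.one_closed w(1), of "[a]"] a g
      by simp
  qed
  define \<Phi> where "\<Phi> v g = (\<psi> g \<noteq> \<phi> g v)" for v g
  have vertex: "\<Phi> v (g \<otimes> vh v x) = \<Phi> v g"
    if "v \<in> verts Y" "g \<in> carrier G" "x \<in> carrier (vgroup \<Gamma> v)" for v g x
    using \<psi>_mult[of g "Vertex v x"] that unfolding \<Phi>_def by (auto simp: vh_eq)
  have edge: "\<Phi> (head Y e) (g \<otimes> st e) = (\<Phi> (tail Y e) g \<noteq> f e g)"
    if "e \<in> arcs Y" "g \<in> carrier G" for e g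
  proof -
    have "\<psi> (g \<otimes> st e) = (\<psi> g \<noteq> hol g (Stable e True))"
      using \<psi>_mult[of g "Stable e True"] that by simp
    then show ?thesis unfolding \<Phi>_def hol.simps by argo
  qed
  show ?thesis
    unfolding coboundary_def by (intro exI[of _ \<Phi>] conjI ballI) (fact vertex edge)+
qed

end

text \<open>Stable letters of \<open>S\<close> are trivial, so \<open>f\<close> is symmetric on each
  lift of \<open>S\<close> and has a potential there, chosen for every \<open>g\<close>
  separately.\<close>

theorem edge_cocycle_coboundary:
  assumes f_edge: "\<And>e g x. \<lbrakk>e \<in> arcs Y; g \<in> carrier G; x \<in> carrier (egroup \<Gamma> e)\<rbrakk> \<Longrightarrow>
      f e (g \<otimes> vh (tail Y e) (emb \<Gamma> e x)) = f e g"
    and f_rv: "\<And>e g. \<lbrakk>e \<in> arcs Y; g \<in> carrier G\<rbrakk> \<Longrightarrow> f (rv e) (g \<otimes> st e) = f e g"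
  obtains \<Phi> where "coboundary \<Phi> f"
proof -
  have "\<exists>\<phi>. \<forall>e\<in>arcs S. \<phi> (head Y e) = (\<phi> (tail Y e) \<noteq> f e g)" if g: "g \<in> carrier G" for g
  proof -
    have "f (rv e) g = f e g" if "e \<in> arcs S" for e
      using f_rv[of e g] st_tree[OF that] B.S_arcs that g by auto
    then obtain \<phi>' where "\<And>e. e \<in> arcs S \<Longrightarrow> \<phi>' (head Y e) = (\<phi>' (tail Y e) \<noteq> f e g)"
      using B.even_coboundary_S[of "\<lambda>e. f e g"] by blast
    then show ?thesis by blast
  qed
  then obtain \<phi> where \<phi>: "\<And>g e. \<lbrakk>g \<in> carrier G; e \<in> arcs S\<rbrakk> \<Longrightarrow> \<phi> g (head Y e) = (\<phi> g (tail Y e) \<noteq> f e g)"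
    by metis
  have "\<exists>\<Phi>. coboundary \<Phi> f"
    by (rule edge_cocycle_coboundary_aux) (fact f_edge f_rv \<phi>)+
  then show ?thesis using that by blast
qed

end

section \<open>The Bass-Serre tree\<close>

context group
begin

lemma lcos_eq_iff:
  assumes K: "subgroup K G" and gh: "g \<in> carrier G" "h \<in> carrier G"
  shows "g <# K = h <# K \<longleftrightarrow> inv g \<otimes> h \<in> K"
proof
  have KG: "k \<in> carrier G" if "k \<in> K" for k using subgroup.mem_carrier[OF K that] .
  show "inv g \<otimes> h \<in> K" if eq: "g <# K = h <# K"
  proof -
    have "h \<otimes> \<one> \<in> h <# K" unfolding l_coset_def using subgroup.one_closed[OF K] by blast
    then have "h \<in> g <# K" using gh eq by simp
    then obtain k where "k \<in> K" "h = g \<otimes> k" unfolding l_coset_def by blast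
    then show ?thesis using gh KG by (simp add: m_assoc[symmetric])
  qed
  have sub: "b <# K \<subseteq> a <# K" if ab: "a \<in> carrier G" "b \<in> carrier G" "inv a \<otimes> b \<in> K" for a b
  proof
    fix x assume "x \<in> b <# K"
    then obtain k where k: "k \<in> K" "x = b \<otimes> k" unfolding l_coset_def by blast
    then have "x = a \<otimes> (inv a \<otimes> b \<otimes> k)" using ab KG by (simp add: m_assoc[symmetric])
    moreover have "inv a \<otimes> b \<otimes> k \<in> K" using subgroup.m_closed[OF K ab(3) k(1)] .
    ultimately show "x \<in> a <# K" unfolding l_coset_def by blast
  qed
  show "g <# K = h <# K" if m: "inv g \<otimes> h \<in> K"
  proof
    have "inv h \<otimes> g = inv (inv g \<otimes> h)" using gh by (simp add: inv_mult_group)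
    then have "inv h \<otimes> g \<in> K" using subgroup.m_inv_closed[OF K m] by simp
    then show "g <# K \<subseteq> h <# K" by (rule sub[OF gh(2,1)])
    show "h <# K \<subseteq> g <# K" by (rule sub[OF gh m])
  qed
qed

end

context bass_serre
begin

abbreviation "GV \<equiv> vertex_subgroup \<Gamma> S"
abbreviation "GE \<equiv> edge_subgroup \<Gamma> S"

lemma GE_alt: "GE e = (\<lambda>x. vh (tail Y e) (emb \<Gamma> e x)) ` carrier (egroup \<Gamma> e)"
  by (simp add: edge_subgroup_def image_image)

lemma GV_subgroup:
  assumes v: "v \<in> verts Y"
  shows "subgroup (GV v) G"
proof -
  interpret V: group "vgroup \<Gamma> v" by (rule group_vgroup[OF v])
  show ?thesis
  proof (rule G.subgroupI)
    show "GV v \<subseteq> carrier G" "GV v \<noteq> {}"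
      using v V.one_closed unfolding vertex_subgroup_def by auto
    fix a assume "a \<in> GV v"
    then obtain x where x: "x \<in> carrier (vgroup \<Gamma> v)" "a = vh v x" unfolding vertex_subgroup_def by blast
    have "inv a = vh v (inv\<^bsub>vgroup \<Gamma> v\<^esub> x)" using vh_inv[OF v x(1)] x(2) by simp
    then show "inv a \<in> GV v" unfolding vertex_subgroup_def using V.inv_closed[OF x(1)] by simp
    fix b assume "b \<in> GV v"
    then obtain y where y: "y \<in> carrier (vgroup \<Gamma> v)" "b = vh v y" unfolding vertex_subgroup_def by blast
    show "a \<otimes> b \<in> GV v"
      unfolding vertex_subgroup_def x(2) y(2) vh_mult[OF v x(1) y(1)] using V.m_closed[OF x(1) y(1)] by simp
  qed
qed

lemma GE_sub_GV: "e \<in> arcs Y \<Longrightarrow> GE e \<subseteq> GV (tail Y e)"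
  unfolding GE_alt vertex_subgroup_def using emb_closed by blast

lemma GE_subgroup:
  assumes e: "e \<in> arcs Y"
  shows "subgroup (GE e) G"
proof -
  have v: "tail Y e \<in> verts Y" using e by simp
  interpret V: group "vgroup \<Gamma> (tail Y e)" by (rule group_vgroup[OF v])
  interpret E: group "egroup \<Gamma> e" by (rule group_egroup[OF e])
  interpret emb: group_hom "egroup \<Gamma> e" "vgroup \<Gamma> (tail Y e)" "emb \<Gamma> e"
    using emb_mon[OF e] by unfold_locales (simp add: mon_def)
  show ?thesis
  proof (rule G.subgroupI)
    show "GE e \<subseteq> carrier G" using GE_sub_GV[OF e] subgroup.subset[OF GV_subgroup[OF v]] by blast
    show "GE e \<noteq> {}" unfolding GE_alt using E.one_closed by blast
    fix a assume "a \<in> GE e"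
    then obtain x where x: "x \<in> carrier (egroup \<Gamma> e)" "a = vh (tail Y e) (emb \<Gamma> e x)" unfolding GE_alt by blast
    have "inv a = vh (tail Y e) (emb \<Gamma> e (inv\<^bsub>egroup \<Gamma> e\<^esub> x))"
      using vh_inv[OF v emb.hom_closed[OF x(1)]] x by simp
    then show "inv a \<in> GE e" unfolding GE_alt using E.inv_closed[OF x(1)] by simp
    fix b assume "b \<in> GE e"
    then obtain y where y: "y \<in> carrier (egroup \<Gamma> e)" "b = vh (tail Y e) (emb \<Gamma> e y)" unfolding GE_alt by blast
    have "a \<otimes> b = vh (tail Y e) (emb \<Gamma> e (x \<otimes>\<^bsub>egroup \<Gamma> e\<^esub> y))"
      unfolding x(2) y(2) using vh_mult[OF v emb.hom_closed[OF x(1)] emb.hom_closed[OF y(1)]] x(1) y(1) by simp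
    then show "a \<otimes> b \<in> GE e" unfolding GE_alt using E.m_closed[OF x(1) y(1)] by simp
  qed
qed

lemma st_conj_GE_iff:
  assumes e: "e \<in> arcs Y" and k: "k \<in> carrier G"
  shows "inv st e \<otimes> k \<otimes> st e \<in> GE (rv e) \<longleftrightarrow> k \<in> GE e"
proof -
  have GE_rv: "GE (rv e) = (\<lambda>x. vh (head Y e) (emb \<Gamma> (rv e) x)) ` carrier (egroup \<Gamma> e)"
    unfolding GE_alt using e egroup_inversion[OF e] by simp
  have s: "st e \<in> carrier G" using e by simp
  have "inv st e \<otimes> k \<otimes> st e = vh (head Y e) (emb \<Gamma> (rv e) x) \<longleftrightarrow>
      k = vh (tail Y e) (emb \<Gamma> e x)" if x: "x \<in> carrier (egroup \<Gamma> e)" for x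
  proof -
    let ?a = "vh (tail Y e) (emb \<Gamma> e x)" and ?b = "vh (head Y e) (emb \<Gamma> (rv e) x)"
    have c: "?a \<in> carrier G" "?b \<in> carrier G" using e x emb_closed emb_rv_closed by simp_all
    have "inv st e \<otimes> k \<otimes> st e = ?b \<longleftrightarrow> k \<otimes> st e = st e \<otimes> ?b"
      using G.inv_solve_left'[of ?b "st e" "k \<otimes> st e"] c s k by (simp add: G.m_assoc)
    also have "\<dots> \<longleftrightarrow> k \<otimes> st e = ?a \<otimes> st e" using st_conj[OF e x] by simp
    also have "\<dots> \<longleftrightarrow> k = ?a" using c s k by simp
    finally show ?thesis .
  qed
  then show ?thesis unfolding GE_rv unfolding GE_alt image_iff by blast
qed

text \<open>The coset is tagged with \<open>v\<close> because cosets of different vertex groups may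
  coincide as sets.\<close>

definition vtx where
  "vtx v g = (v, g <# GV v)"

lemma vtx_eq_iff:
  assumes "v \<in> verts Y" "g \<in> carrier G" "h \<in> carrier G"
  shows "vtx v g = vtx w h \<longleftrightarrow> v = w \<and> inv g \<otimes> h \<in> GV v"
  using G.lcos_eq_iff[OF GV_subgroup[OF assms(1)] assms(2,3)] unfolding vtx_def by auto

abbreviation ecos :: "'e \<Rightarrow> ('v, 'e, 'g) letter list set set \<Rightarrow> ('v, 'e, 'g) letter list set set set" where
  "ecos e g \<equiv> g <# GE e"

text \<open>A coset of \<open>GE e\<close> stands for an edge over \<open>e\<close>. The inverse
  edge has the representative \<open>g \<otimes> st e\<close>, and this passage respects cosets
  since \<open>st e\<close> conjugates one edge group into the other.\<close>

lemma ecos_rv: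
  assumes e: "e \<in> arcs Y" and gh: "g \<in> carrier G" "h \<in> carrier G"
  shows "ecos (rv e) (g \<otimes> st e) = ecos (rv e) (h \<otimes> st e) \<longleftrightarrow> ecos e g = ecos e h"
proof -
  have s: "st e \<in> carrier G" using e by simp
  have "inv (g \<otimes> st e) \<otimes> (h \<otimes> st e) = inv st e \<otimes> (inv g \<otimes> h) \<otimes> st e"
    using gh s by (simp add: G.inv_mult_group G.m_assoc)
  then show ?thesis
    using G.lcos_eq_iff[OF GE_subgroup[OF e] gh] G.lcos_eq_iff[OF GE_subgroup, of "rv e" "g \<otimes> st e" "h \<otimes> st e"]
      st_conj_GE_iff[OF e, of "inv g \<otimes> h"] gh s e by simp
qed

lemma ecos_tail:
  assumes e: "e \<in> arcs Y" and gh: "g \<in> carrier G" "h \<in> carrier G" and eq: "ecos e g = ecos e h"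
  shows "vtx (tail Y e) g = vtx (tail Y e) h"
proof -
  have "inv g \<otimes> h \<in> GE e" using G.lcos_eq_iff[OF GE_subgroup[OF e] gh] eq by simp
  then show ?thesis using vtx_eq_iff[of "tail Y e" g h "tail Y e"] GE_sub_GV[OF e] e gh by auto
qed

lemma ecos_head:
  assumes e: "e \<in> arcs Y" and gh: "g \<in> carrier G" "h \<in> carrier G" and eq: "ecos e g = ecos e h"
  shows "vtx (head Y e) (g \<otimes> st e) = vtx (head Y e) (h \<otimes> st e)"
  using ecos_tail[of "rv e" "g \<otimes> st e" "h \<otimes> st e"] ecos_rv[OF e gh] e gh eq by simp

lemma st_st_rv: "\<lbrakk>e \<in> arcs Y; g \<in> carrier G\<rbrakk> \<Longrightarrow> g \<otimes> st e \<otimes> st (rv e) = g"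
  using st_rv by (simp add: G.m_assoc)

text \<open>The indicator of the edge from \<open>vtx (tail Y e0) g0\<close> to \<open>vtx (head Y e0) (g0 \<otimes> st e0)\<close> and of its inverse
  is the coboundary of \<open>Q\<close>.\<close>

definition separates where
  "separates e0 g0 Q \<longleftrightarrow>
    (\<forall>v\<in>verts Y. \<forall>g\<in>carrier G. \<forall>h\<in>carrier G. vtx v g = vtx v h \<longrightarrow> Q v g = Q v h) \<and>
    (\<forall>e\<in>arcs Y. \<forall>g\<in>carrier G. Q (head Y e) (g \<otimes> st e) = (Q (tail Y e) g \<noteq>
      (e = e0 \<and> ecos e0 g = ecos e0 g0 \<or> e = rv e0 \<and> ecos (rv e0) g = ecos (rv e0) (g0 \<otimes> st e0))))"

text \<open>The indicator of an edge and its inverse depends on cosets only and is symmetric under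
  inversion, so it is a parity cocycle. As \<open>rv e0\<close> differs from \<open>e0\<close>, its
  two alternatives exclude each other.\<close>

lemma separates_exists:
  assumes e0: "e0 \<in> arcs Y" and g0: "g0 \<in> carrier G"
  obtains Q where "separates e0 g0 Q"
proof -
  define f where "f e g = (e = e0 \<and> ecos e0 g = ecos e0 g0 \<or>
    e = rv e0 \<and> ecos (rv e0) g = ecos (rv e0) (g0 \<otimes> st e0))" for e g
  have s0: "st e0 \<in> carrier G" "g0 \<otimes> st e0 \<in> carrier G" using e0 g0 by simp_all
  have f_edge: "f e (g \<otimes> vh (tail Y e) (emb \<Gamma> e x)) = f e g"
    if "e \<in> arcs Y" "g \<in> carrier G" "x \<in> carrier (egroup \<Gamma> e)" for e g x
  proof -
    let ?a = "vh (tail Y e) (emb \<Gamma> e x)"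
    have a: "?a \<in> GE e" unfolding GE_alt using that by blast
    then have aG: "?a \<in> carrier G" using subgroup.mem_carrier[OF GE_subgroup[OF that(1)]] by blast
    have "ecos e g = ecos e (g \<otimes> ?a)"
      using G.lcos_eq_iff[OF GE_subgroup[OF that(1)], of g "g \<otimes> ?a"] that a aG
      by (simp add: G.m_assoc[symmetric])
    then show ?thesis unfolding f_def by metis
  qed
  have f_rv: "f (rv e) (g \<otimes> st e) = f e g" if e: "e \<in> arcs Y" and g: "g \<in> carrier G" for e g
  proof -
    have ne: "rv e0 \<noteq> e0" by (rule B.arev_neq[OF e0])
    consider "e = e0" | "e = rv e0" | "e \<noteq> e0" "e \<noteq> rv e0" by blast
    then show ?thesis
    proof cases
      case 1
      then show ?thesis unfolding f_def using ne ecos_rv[OF e0 g g0] by auto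
    next
      case 2
      have "ecos e0 (g \<otimes> st (rv e0)) = ecos e0 g0 \<longleftrightarrow> ecos (rv e0) g = ecos (rv e0) (g0 \<otimes> st e0)"
        using ecos_rv[of "rv e0" g "g0 \<otimes> st e0"] e0 g s0 st_st_rv[OF e0 g0] by simp
      then show ?thesis unfolding f_def 2 using ne by auto
    next
      case 3
      then have "rv e \<noteq> e0" "rv e \<noteq> rv e0" by (metis B.arev_arev)+
      then show ?thesis unfolding f_def using 3 by simp
    qed
  qed
  obtain \<Phi> where \<Phi>: "coboundary \<Phi> f"
    by (rule edge_cocycle_coboundary[of f, OF f_edge f_rv]) blast+
  have "\<Phi> v g = \<Phi> v h" if "v \<in> verts Y" "g \<in> carrier G" "h \<in> carrier G" "vtx v g = vtx v h" for v g h
  proof -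
    have "inv g \<otimes> h \<in> GV v" using vtx_eq_iff[OF that(1-3), of v] that(4) by blast
    then obtain x where x: "x \<in> carrier (vgroup \<Gamma> v)" "inv g \<otimes> h = vh v x"
      unfolding vertex_subgroup_def by blast
    have "h = g \<otimes> vh v x" using that(2,3) unfolding x(2)[symmetric] by (simp add: G.m_assoc[symmetric])
    then show ?thesis using \<Phi> that(1,2) x(1) unfolding coboundary_def by blast
  qed
  then have "separates e0 g0 \<Phi>"
    using \<Phi> unfolding separates_def coboundary_def f_def by blast
  then show ?thesis by (rule that)
qed

section \<open>Vertices, edges and connectedness of the tree\<close>

definition tree_verts where
  "tree_verts = {vtx v g |v g. v \<in> verts Y \<and> g \<in> carrier G}"

text \<open>Edges are recorded by their ends alone. That the stabiliser of both ends is contained in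
  a conjugate of an edge group needs the separating potentials.\<close>

definition tree_edges where
  "tree_edges = {(vtx (tail Y e) g, vtx (head Y e) (g \<otimes> st e)) |e g. e \<in> arcs Y \<and> g \<in> carrier G}"

definition tree_act where
  "tree_act h x = (fst x, h <#\<^bsub>G\<^esub> snd x)"

lemma vtx_in_tree_verts: "\<lbrakk>v \<in> verts Y; g \<in> carrier G\<rbrakk> \<Longrightarrow> vtx v g \<in> tree_verts"
  unfolding tree_verts_def by blast

lemma tree_act_vtx:
  "\<lbrakk>h \<in> carrier G; g \<in> carrier G; v \<in> verts Y\<rbrakk> \<Longrightarrow> tree_act h (vtx v g) = vtx v (h \<otimes> g)"
  unfolding tree_act_def vtx_def using G.lcos_m_assoc[OF subgroup.subset[OF GV_subgroup]] by simp

lemma tree_edges_sym: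
  assumes "(x, y) \<in> tree_edges"
  shows "(y, x) \<in> tree_edges"
proof -
  obtain e g where e: "e \<in> arcs Y" "g \<in> carrier G" "x = vtx (tail Y e) g" "y = vtx (head Y e) (g \<otimes> st e)"
    using assms unfolding tree_edges_def by blast
  have "y = vtx (tail Y (rv e)) (g \<otimes> st e)"
    "x = vtx (head Y (rv e)) (g \<otimes> st e \<otimes> st (rv e))"
    using e st_st_rv by simp_all
  moreover have "rv e \<in> arcs Y" "g \<otimes> st e \<in> carrier G" using e by simp_all
  ultimately show ?thesis unfolding tree_edges_def by blast
qed

lemma tree_edges_rtrancl_sym:
  assumes "(x, y) \<in> tree_edges\<^sup>*"
  shows "(y, x) \<in> tree_edges\<^sup>*"
proof -
  have "sym tree_edges" using tree_edges_sym by (auto intro: symI)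
  then show ?thesis using assms by (meson sym_rtrancl symD)
qed

text \<open>As the stable letters of \<open>S\<close> are trivial, the vertices
  \<open>vtx v g\<close> with \<open>g\<close> fixed are joined by a copy of the spanning
  tree.\<close>

lemma tree_path_in_fibre:
  assumes g: "g \<in> carrier G" and vw: "v \<in> verts Y" "w \<in> verts Y"
  shows "(vtx v g, vtx w g) \<in> tree_edges\<^sup>*"
proof -
  have "(v, w) \<in> (arcs_ends S)\<^sup>*"
    using B.S_tree vw unfolding bidirected_tree_def B.S.connected_iff B.S_spanning by blast
  then show ?thesis
  proof (induction rule: rtrancl_induct)
    case (step a b)
    then obtain e where e: "e \<in> arcs S" "a = tail Y e" "b = head Y e"
      unfolding arcs_ends_conv B.S_tail B.S_head by auto
    then have "(vtx a g, vtx b g) \<in> tree_edges"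
      unfolding tree_edges_def using st_tree[OF e(1)] B.S_arcs g by force
    then show ?case using step.IH by (meson rtrancl_into_rtrancl)
  qed simp
qed

text \<open>For a vertex letter over \<open>w\<close> the copies of \<open>S\<close> at both
  elements share the vertex over \<open>w\<close>; for a stable letter they are joined by an
  edge.\<close>

lemma tree_path_letter:
  assumes g: "g \<in> carrier G" and v: "v \<in> verts Y" and a: "a \<in> letters \<Gamma>"
  shows "(vtx v g, vtx v (g \<otimes> proj [a])) \<in> tree_edges\<^sup>*"
proof -
  have stable: "(vtx v g, vtx v (g \<otimes> st e)) \<in> tree_edges\<^sup>*" if e: "e \<in> arcs Y" and g: "g \<in> carrier G" for e g
  proof -
    have "(vtx (tail Y e) g, vtx (head Y e) (g \<otimes> st e)) \<in> tree_edges"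
      unfolding tree_edges_def using e g by blast
    moreover have "(vtx v g, vtx (tail Y e) g) \<in> tree_edges\<^sup>*"
      by (rule tree_path_in_fibre) (use e g v in simp_all)
    moreover have "(vtx (head Y e) (g \<otimes> st e), vtx v (g \<otimes> st e)) \<in> tree_edges\<^sup>*"
      by (rule tree_path_in_fibre) (use e g v in simp_all)
    ultimately show ?thesis by (meson rtrancl_into_rtrancl rtrancl_trans)
  qed
  show ?thesis
  proof (cases a)
    case (Vertex w x)
    then have w: "w \<in> verts Y" "x \<in> carrier (vgroup \<Gamma> w)" using a by simp_all
    have gx: "g \<otimes> vh w x \<in> carrier G" using g w by simp
    have eq: "vtx w g = vtx w (g \<otimes> vh w x)"
      using vtx_eq_iff[OF w(1) g gx] g w unfolding vertex_subgroup_def by (simp add: G.m_assoc[symmetric])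
    have "(vtx v g, vtx v (g \<otimes> vh w x)) \<in> tree_edges\<^sup>*"
      by (rule rtrancl_trans[OF tree_path_in_fibre[OF g v w(1), unfolded eq] tree_path_in_fibre[OF gx w(1) v]])
    then show ?thesis unfolding Vertex vh_eq .
  next
    case (Stable e b)
    then have e: "e \<in> arcs Y" using a by simp
    show ?thesis
    proof (cases b)
      case True
      then show ?thesis using stable[OF e g] Stable by simp
    next
      case False
      have c: "g \<otimes> inv st e \<in> carrier G" using g e by simp
      have "g \<otimes> inv st e \<otimes> st e = g" using g e by (simp add: G.m_assoc)
      then show ?thesis
        using tree_edges_rtrancl_sym[OF stable[OF e c]] Stable False proj_stable_False[OF e] by simp
    qed
  qed
qed

lemma tree_connected:
  assumes "x \<in> tree_verts" "y \<in> tree_verts"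
  shows "(x, y) \<in> tree_edges\<^sup>*"
proof -
  obtain v g where x: "x = vtx v g" "v \<in> verts Y" "g \<in> carrier G" using assms(1) unfolding tree_verts_def by blast
  obtain w h where y: "y = vtx w h" "w \<in> verts Y" "h \<in> carrier G" using assms(2) unfolding tree_verts_def by blast
  have base: "(vtx v \<one>, vtx v (proj u)) \<in> tree_edges\<^sup>*" if "u \<in> L" for u
    using that
  proof (induction u rule: rev_induct)
    case (snoc a u)
    then have u: "u \<in> L" and a: "a \<in> letters \<Gamma>" by simp_all
    have "proj (u @ [a]) = proj u \<otimes> proj [a]" using proj_mult[of u "[a]"] u a by simp
    then show ?case
      using rtrancl_trans[OF snoc.IH[OF u] tree_path_letter[OF proj_closed[OF u] x(2) a]] by simp
  qed (simp add: proj_one)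
  have "(vtx v \<one>, vtx v k) \<in> tree_edges\<^sup>*" if "k \<in> carrier G" for k
    using base that unfolding carrier_G by blast
  then have "(vtx v g, vtx v h) \<in> tree_edges\<^sup>*"
    using x y tree_edges_rtrancl_sym by (meson rtrancl_trans)
  then show ?thesis unfolding x(1) y(1) using tree_path_in_fibre[OF y(3) x(2) y(2)] by (rule rtrancl_trans)
qed

text \<open>The separating potential is constant across every other edge, so the vertices where it
  differs from its value at \<open>x\<close> form the required cut.\<close>

lemma tree_bridge:
  assumes "(x, y) \<in> tree_edges"
  shows "\<exists>U. x \<notin> U \<and> y \<in> U \<and> (\<forall>(a, b)\<in>tree_edges. a \<notin> U \<longrightarrow> b \<in> U \<longrightarrow> a = x \<and> b = y)"
proof -
  obtain e0 g0 where e0: "e0 \<in> arcs Y" "g0 \<in> carrier G" "x = vtx (tail Y e0) g0"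
      "y = vtx (head Y e0) (g0 \<otimes> st e0)"
    using assms unfolding tree_edges_def by blast
  obtain Q where "separates e0 g0 Q"
    by (rule separates_exists[OF e0(1,2)])
  note Q = this[unfolded separates_def, THEN conjunct1, rule_format] this[unfolded separates_def, THEN conjunct2, rule_format]
  define U where "U = {vtx v g |v g. v \<in> verts Y \<and> g \<in> carrier G \<and> Q v g \<noteq> Q (tail Y e0) g0}"
  have U: "vtx v g \<in> U \<longleftrightarrow> Q v g \<noteq> Q (tail Y e0) g0" if vg: "v \<in> verts Y" "g \<in> carrier G" for v g
  proof
    assume "vtx v g \<in> U"
    then obtain w h where w: "vtx v g = vtx w h" "w \<in> verts Y" "h \<in> carrier G" "Q w h \<noteq> Q (tail Y e0) g0"
      unfolding U_def by blast
    then have "w = v" by (simp add: vtx_def)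
    then show "Q v g \<noteq> Q (tail Y e0) g0" using Q(1)[OF vg w(3)] w by simp
  qed (use vg in \<open>auto simp: U_def\<close>)
  have s0: "g0 \<otimes> st e0 \<in> carrier G" using e0 by simp
  have xU: "x \<notin> U" using U[of "tail Y e0" g0] e0 by simp
  have yU: "y \<in> U" using U[of "head Y e0" "g0 \<otimes> st e0"] Q(2)[OF e0(1,2)] e0 by simp
  have "a = x \<and> b = y" if ab: "(a, b) \<in> tree_edges" "a \<notin> U" "b \<in> U" for a b
  proof -
    obtain e g where e: "e \<in> arcs Y" "g \<in> carrier G" "a = vtx (tail Y e) g" "b = vtx (head Y e) (g \<otimes> st e)"
      using ab(1) unfolding tree_edges_def by blast
    have "Q (head Y e) (g \<otimes> st e) \<noteq> Q (tail Y e) g"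
      using ab(2,3) U[of "tail Y e" g] U[of "head Y e" "g \<otimes> st e"] e by auto
    then consider "e = e0" "ecos e0 g = ecos e0 g0" | "e = rv e0" "ecos (rv e0) g = ecos (rv e0) (g0 \<otimes> st e0)"
      using Q(2)[OF e(1,2)] by blast
    then show ?thesis
    proof cases
      case 1
      then show ?thesis
        using ecos_tail[OF e0(1) e(2) e0(2)] ecos_head[OF e0(1) e(2) e0(2)] e e0 by simp
    next
      case 2
      \<comment> \<open>The inverse edge starts inside \<open>U\<close> and so does not enter
        it.\<close>
      then have "a = y" using ecos_tail[of "rv e0" g "g0 \<otimes> st e0"] e e0 s0 by simp
      then show ?thesis using ab(2) yU by simp
    qed
  qed
  then show ?thesis using xU yU by blast
qed

text \<open>If \<open>h\<close> fixes both ends, the potential that separates them jumps along the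
  translated edge too. It jumps only at the given edge and its inverse, so the coset of the edge is
  fixed by \<open>h\<close>.\<close>

lemma tree_edge_stabilizer:
  assumes e: "e \<in> arcs Y" "g \<in> carrier G" and h: "h \<in> carrier G"
    and fixed: "tree_act h (vtx (tail Y e) g) = vtx (tail Y e) g"
      "tree_act h (vtx (head Y e) (g \<otimes> st e)) = vtx (head Y e) (g \<otimes> st e)"
  shows "inv g \<otimes> h \<otimes> g \<in> GE e"
proof -
  obtain Q where "separates e g Q"
    by (rule separates_exists[OF e])
  note Q = this[unfolded separates_def, THEN conjunct1, rule_format] this[unfolded separates_def, THEN conjunct2, rule_format]
  have s: "g \<otimes> st e \<in> carrier G" "h \<otimes> g \<in> carrier G" "h \<otimes> (g \<otimes> st e) \<in> carrier G"
    using e h by simp_all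
  have "Q (tail Y e) (h \<otimes> g) = Q (tail Y e) g"
    using Q(1)[of "tail Y e" "h \<otimes> g" g] fixed(1) tree_act_vtx[OF h e(2)] e s by simp
  moreover have "Q (head Y e) (h \<otimes> g \<otimes> st e) = Q (head Y e) (g \<otimes> st e)"
    using Q(1)[of "head Y e" "h \<otimes> (g \<otimes> st e)" "g \<otimes> st e"] fixed(2) tree_act_vtx[OF h s(1)] e s h
    by (simp add: G.m_assoc)
  ultimately have "ecos e (h \<otimes> g) = ecos e g"
    using Q(2)[OF e] Q(2)[OF e(1) s(2)] B.arev_neq[OF e(1)] by auto
  then have "inv g \<otimes> (h \<otimes> g) \<in> GE e"
    using G.lcos_eq_iff[OF GE_subgroup[OF e(1)] e(2) s(2)] by simp
  then show ?thesis using e h by (simp add: G.m_assoc)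
qed

text \<open>An element swapping the ends makes the potential jump along the translated edge, which
  is therefore the edge itself. Then the two ends coincide, although the potential separates
  them.\<close>

lemma tree_no_inversion:
  assumes h: "h \<in> carrier G" and xy: "(x, y) \<in> tree_edges"
  shows "\<not> (tree_act h x = y \<and> tree_act h y = x)"
proof
  assume swap: "tree_act h x = y \<and> tree_act h y = x"
  obtain e g where e: "e \<in> arcs Y" "g \<in> carrier G" and x: "x = vtx (tail Y e) g"
      and y: "y = vtx (head Y e) (g \<otimes> st e)"
    using xy unfolding tree_edges_def by blast
  obtain Q where "separates e g Q"
    by (rule separates_exists[OF e])
  note Q = this[unfolded separates_def, THEN conjunct1, rule_format] this[unfolded separates_def, THEN conjunct2, rule_format]
  have s: "g \<otimes> st e \<in> carrier G" "h \<otimes> g \<in> carrier G" "h \<otimes> (g \<otimes> st e) \<in> carrier G"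
    using e h by simp_all
  have v: "tail Y e \<in> verts Y" using e by simp
  have hx: "vtx (tail Y e) (h \<otimes> g) = vtx (head Y e) (g \<otimes> st e)"
    using swap tree_act_vtx[OF h e(2) v] unfolding x y by simp
  then have ht: "head Y e = tail Y e" by (simp add: vtx_def)
  have hy: "vtx (tail Y e) (h \<otimes> (g \<otimes> st e)) = vtx (tail Y e) g"
    using swap tree_act_vtx[OF h s(1) v] unfolding x y ht by simp
  have "Q (tail Y e) (h \<otimes> g) = Q (tail Y e) (g \<otimes> st e)"
    by (rule Q(1)[OF v s(2) s(1)]) (use hx ht in simp)
  moreover have "Q (tail Y e) (h \<otimes> g \<otimes> st e) = Q (tail Y e) g"
    using Q(1)[OF v s(3) e(2) hy] e h by (simp add: G.m_assoc)
  ultimately have "ecos e (h \<otimes> g) = ecos e g" and flip: "Q (tail Y e) (g \<otimes> st e) \<noteq> Q (tail Y e) g"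
    using Q(2)[OF e] Q(2)[OF e(1) s(2)] B.arev_neq[OF e(1)] unfolding ht by auto
  then have "vtx (tail Y e) (h \<otimes> g) = vtx (tail Y e) g" using ecos_tail[OF e(1) s(2) e(2)] by simp
  then have "Q (tail Y e) (g \<otimes> st e) = Q (tail Y e) g"
    using Q(1)[OF v s(1) e(2)] hx ht by simp
  then show False using flip by simp
qed

theorem Bass_Serre_tree: "tree_action tree_verts tree_edges G tree_act"
proof (intro tree_action.intro tree_graph.intro tree_action_axioms.intro G.is_group)
  show "tree_edges \<subseteq> tree_verts \<times> tree_verts"
  proof
    fix p assume "p \<in> tree_edges"
    then obtain e g where e: "e \<in> arcs Y" "g \<in> carrier G" "p = (vtx (tail Y e) g, vtx (head Y e) (g \<otimes> st e))"
      unfolding tree_edges_def by blast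
    then have "vtx (tail Y e) g \<in> tree_verts" "vtx (head Y e) (g \<otimes> st e) \<in> tree_verts"
      by (simp_all add: vtx_in_tree_verts)
    then show "p \<in> tree_verts \<times> tree_verts" using e(3) by simp
  qed
next
  fix g x assume g: "g \<in> carrier G" and "x \<in> tree_verts"
  then obtain v h where x: "x = vtx v h" "v \<in> verts Y" "h \<in> carrier G" unfolding tree_verts_def by blast
  show "tree_act g x \<in> tree_verts"
    unfolding x(1) tree_act_vtx[OF g x(3,2)] using g x by (simp add: vtx_in_tree_verts)
next
  fix x assume "x \<in> tree_verts"
  then obtain v h where x: "x = vtx v h" "v \<in> verts Y" "h \<in> carrier G" unfolding tree_verts_def by blast
  then show "tree_act \<one> x = x" using tree_act_vtx[OF G.one_closed x(3,2)] by simp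
next
  fix g h x assume gh: "g \<in> carrier G" "h \<in> carrier G" and "x \<in> tree_verts"
  then obtain v k where x: "x = vtx v k" "v \<in> verts Y" "k \<in> carrier G" unfolding tree_verts_def by blast
  then show "tree_act (g \<otimes> h) x = tree_act g (tree_act h x)"
    using gh by (simp add: tree_act_vtx G.m_assoc)
next
  fix h x y assume h: "h \<in> carrier G" and "(x, y) \<in> tree_edges"
  then obtain e g where e: "e \<in> arcs Y" "g \<in> carrier G" "x = vtx (tail Y e) g" "y = vtx (head Y e) (g \<otimes> st e)"
    unfolding tree_edges_def by blast
  then have "tree_act h x = vtx (tail Y e) (h \<otimes> g)" "tree_act h y = vtx (head Y e) (h \<otimes> g \<otimes> st e)"
    using h by (simp_all add: tree_act_vtx G.m_assoc)
  then show "(tree_act h x, tree_act h y) \<in> tree_edges"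
    unfolding tree_edges_def using e(1) G.m_closed[OF h e(2)] by blast
qed (fact tree_edges_sym tree_connected tree_bridge tree_no_inversion)+

section \<open>The rank inequality in the fundamental group\<close>

lemma conj_coset_iff: "y \<in> inv g <# A #> g \<longleftrightarrow> (\<exists>k\<in>A. y = inv g \<otimes> k \<otimes> g)"
  unfolding l_coset_def r_coset_def by blast

text \<open>The stabiliser of \<open>vtx v g\<close> is a conjugate of \<open>GV v\<close>, so an
  element of \<open>H\<close> fixing this vertex lies in a trivial intersection.\<close>

lemma tree_act_free:
  assumes HG: "H \<subseteq> carrier G"
    and triv: "\<forall>v\<in>verts Y. \<forall>g\<in>carrier G. H \<inter> (inv g <# GV v #> g) = {\<one>}"
    and h: "h \<in> H" "x \<in> tree_verts" "tree_act h x = x"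
  shows "h = \<one>"
proof -
  obtain v g where x: "x = vtx v g" "v \<in> verts Y" "g \<in> carrier G" using h(2) unfolding tree_verts_def by blast
  have hG: "h \<in> carrier G" using h(1) HG by blast
  have "vtx v g = vtx v (h \<otimes> g)" using h(3) tree_act_vtx[OF hG x(3,2)] unfolding x(1) by simp
  then have k: "inv g \<otimes> (h \<otimes> g) \<in> GV v"
    using vtx_eq_iff[OF x(2,3) G.m_closed[OF hG x(3)], of v] by blast
  have "h = inv (inv g) \<otimes> (inv g \<otimes> (h \<otimes> g)) \<otimes> inv g"
    using hG x(3) by (simp add: G.m_assoc) (simp add: G.m_assoc[symmetric])
  then have "h \<in> inv (inv g) <# GV v #> inv g"
    unfolding conj_coset_iff using k by blast
  then show ?thesis using triv h(1) x(2,3) by blast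
qed

text \<open>\<open>m\<close> is any upper bound, so that the same statement covers the maximum over
  all conjugates and the maximal order of the edge groups.\<close>

lemma Int_reduced_rank_le:
  assumes fin: "\<forall>e\<in>arcs Y. finite (carrier (egroup \<Gamma> e))"
    and H: "finitely_generated_subgroup H G" and K: "finitely_generated_subgroup K G"
    and trivH: "\<forall>v\<in>verts Y. \<forall>g\<in>carrier G. H \<inter> (inv g <# GV v #> g) = {\<one>}"
    and trivK: "\<forall>v\<in>verts Y. \<forall>g\<in>carrier G. K \<inter> (inv g <# GV v #> g) = {\<one>}"
    and m: "\<And>e g. \<lbrakk>e \<in> arcs Y; g \<in> carrier G\<rbrakk> \<Longrightarrow>
      card ((inv g <# GE e #> g) \<inter> (H <#> K)) \<le> m"
  shows "is_free_group (G\<lparr>carrier := H\<rparr>) \<and> is_free_group (G\<lparr>carrier := K\<rparr>) \<and>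
    is_free_group (G\<lparr>carrier := H \<inter> K\<rparr>) \<and>
    reduced_rank (G\<lparr>carrier := H \<inter> K\<rparr>)
      \<le> 6 * enat m * reduced_rank (G\<lparr>carrier := H\<rparr>) * reduced_rank (G\<lparr>carrier := K\<rparr>)"
proof -
  interpret T: tree_action tree_verts tree_edges G tree_act by (rule Bass_Serre_tree)
  obtain A where A: "subgroup H G" "H = generate G A" "finite A" "A \<subseteq> carrier G"
    using H unfolding finitely_generated_subgroup_def by blast
  obtain B where B: "subgroup K G" "K = generate G B" "finite B" "B \<subseteq> carrier G"
    using K unfolding finitely_generated_subgroup_def by blast
  have HK: "H <#> K \<subseteq> carrier G"
    using G.set_mult_closed[OF subgroup.subset[OF A(1)] subgroup.subset[OF B(1)]] .
  obtain v where "v \<in> verts Y" using connected unfolding connected_conv by blast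
  then have ne: "tree_verts \<noteq> {}" using vtx_in_tree_verts[OF _ G.one_closed] by blast
  have "finite {h \<in> H <#> K. tree_act h x = x \<and> tree_act h y = y} \<and>
      card {h \<in> H <#> K. tree_act h x = x \<and> tree_act h y = y} \<le> m"
    if xy: "(x, y) \<in> tree_edges" for x y
  proof -
    obtain e g where e: "e \<in> arcs Y" "g \<in> carrier G" "x = vtx (tail Y e) g" "y = vtx (head Y e) (g \<otimes> st e)"
      using xy unfolding tree_edges_def by blast
    let ?St = "{h \<in> H <#> K. tree_act h x = x \<and> tree_act h y = y}"
    \<comment> \<open>The stabiliser of an edge at \<open>g\<close> conjugates by the inverse of
      \<open>g\<close>, so the bound \<open>m\<close> is applied to \<open>inv g\<close>.\<close>
    let ?C = "(inv (inv g) <# GE e #> inv g) \<inter> (H <#> K)"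
    have sub: "?St \<subseteq> ?C"
    proof
      fix h assume h: "h \<in> ?St"
      then have hG: "h \<in> carrier G" using HK by blast
      have k: "inv g \<otimes> h \<otimes> g \<in> GE e"
        by (rule tree_edge_stabilizer[OF e(1,2) hG]) (use h e in simp_all)
      have "h = inv (inv g) \<otimes> (inv g \<otimes> h \<otimes> g) \<otimes> inv g"
        using hG e(2) by (simp add: G.m_assoc) (simp add: G.m_assoc[symmetric])
      then have "h \<in> inv (inv g) <# GE e #> inv g"
        unfolding conj_coset_iff using k by blast
      then show "h \<in> ?C" using h by blast
    qed
    have "finite (GE e)" unfolding GE_alt using fin e(1) by simp
    moreover have "inv (inv g) <# GE e #> inv g =
        (\<lambda>k. inv (inv g) \<otimes> k \<otimes> inv g) ` GE e"
      unfolding l_coset_def r_coset_def by blast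
    ultimately have finC: "finite ?C" by simp
    have "card ?C \<le> m" by (rule m[OF e(1) G.inv_closed[OF e(2)]])
    then show ?thesis using finite_subset[OF sub finC] card_mono[OF finC sub] by simp
  qed
  then have stab: "T.edge_stabilizers_le (H <#> K) m" unfolding T.edge_stabilizers_le_def by blast
  obtain XH XK XL :: "('v, 'e, 'g) letter list set set set" where X:
      "finite XH" "free_group XH \<cong> G\<lparr>carrier := H\<rparr>"
      "finite XK" "free_group XK \<cong> G\<lparr>carrier := K\<rparr>"
      "finite XL" "free_group XL \<cong> G\<lparr>carrier := H \<inter> K\<rparr>"
      "card XL - 1 \<le> 6 * m * (card XH - 1) * (card XK - 1)"
  proof (rule T.Int_rank_inequality[OF A B ne])
    show "h = \<one>" if "h \<in> H" "x \<in> tree_verts" "tree_act h x = x" for h x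
      by (rule tree_act_free[OF subgroup.subset[OF A(1)] trivH that])
    show "h = \<one>" if "h \<in> K" "x \<in> tree_verts" "tree_act h x = x" for h x
      by (rule tree_act_free[OF subgroup.subset[OF B(1)] trivK that])
  qed (rule stab, blast)
  note rank = free_rank_eq[OF X(2,1)] free_rank_eq[OF X(4,3)] free_rank_eq[OF X(6,5)]
  have "reduced_rank (G\<lparr>carrier := H \<inter> K\<rparr>) = enat (card XL - 1)"
    "reduced_rank (G\<lparr>carrier := H\<rparr>) = enat (card XH - 1)"
    "reduced_rank (G\<lparr>carrier := K\<rparr>) = enat (card XK - 1)"
    using rank by (simp_all add: reduced_rank_def one_enat_def)
  then show ?thesis using rank X(7) by (simp add: numeral_eq_enat)
qed

end

theorem theorem1:
  fixes \<Gamma> :: "('v, 'e, 'g, 'h) graph_of_groups"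
    and S :: "('v, 'e) pre_digraph"
    and G :: "('v, 'e, 'g) letter list set set monoid"
    and H K :: "('v, 'e, 'g) letter list set set set"
    and m m' :: nat
  assumes "graph_of_groups \<Gamma>"
    and "fin_digraph (base \<Gamma>)"
    and "maximal_subtree S \<Gamma>"
    and G: "G = fundamental_group \<Gamma> S"
    and "\<forall>e\<in>arcs (base \<Gamma>). finite (carrier (egroup \<Gamma> e))"
    and "finitely_generated_subgroup H G"
    and "finitely_generated_subgroup K G"
    and "\<forall>v\<in>verts (base \<Gamma>). \<forall>g\<in>carrier G.
           H \<inter> (inv\<^bsub>G\<^esub> g <#\<^bsub>G\<^esub> vertex_subgroup \<Gamma> S v #>\<^bsub>G\<^esub> g) = {\<one>\<^bsub>G\<^esub>}"
    and "\<forall>v\<in>verts (base \<Gamma>). \<forall>g\<in>carrier G.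
           K \<inter> (inv\<^bsub>G\<^esub> g <#\<^bsub>G\<^esub> vertex_subgroup \<Gamma> S v #>\<^bsub>G\<^esub> g) = {\<one>\<^bsub>G\<^esub>}"
    and m: "m = Max {card ((inv\<^bsub>G\<^esub> g <#\<^bsub>G\<^esub> edge_subgroup \<Gamma> S e #>\<^bsub>G\<^esub> g) \<inter> (H <#>\<^bsub>G\<^esub> K)) |e g.
                      e \<in> arcs (base \<Gamma>) \<and> g \<in> carrier G}"
    and m': "m' = Max {order (egroup \<Gamma> e) |e. e \<in> arcs (base \<Gamma>)}"
  shows "is_free_group (G\<lparr>carrier := H\<rparr>) \<and> is_free_group (G\<lparr>carrier := K\<rparr>) \<and>
         is_free_group (G\<lparr>carrier := H \<inter> K\<rparr>) \<and>
         reduced_rank (G\<lparr>carrier := H \<inter> K\<rparr>)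
           \<le> 6 * enat m * reduced_rank (G\<lparr>carrier := H\<rparr>) * reduced_rank (G\<lparr>carrier := K\<rparr>) \<and>
         reduced_rank (G\<lparr>carrier := H \<inter> K\<rparr>)
           \<le> 6 * enat m' * reduced_rank (G\<lparr>carrier := H\<rparr>) * reduced_rank (G\<lparr>carrier := K\<rparr>)"
proof -
  interpret bass_serre \<Gamma> S G
    using assms(1,3) G by (simp add: bass_serre_def bass_serre_axioms_def)
  interpret Y: fin_digraph "base \<Gamma>" by (rule assms(2))
  let ?c = "\<lambda>e g. card ((inv\<^bsub>G\<^esub> g <#\<^bsub>G\<^esub> edge_subgroup \<Gamma> S e #>\<^bsub>G\<^esub> g) \<inter> (H <#>\<^bsub>G\<^esub> K))"
  have order_le: "order (egroup \<Gamma> e) \<le> m'" if "e \<in> arcs (base \<Gamma>)" for e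
  proof -
    have "{order (egroup \<Gamma> e) |e. e \<in> arcs (base \<Gamma>)} = (\<lambda>e. order (egroup \<Gamma> e)) ` arcs (base \<Gamma>)" by blast
    then show ?thesis unfolding m' using that by (intro Max_ge) auto
  qed
  have c_le_m': "?c e g \<le> m'" if "e \<in> arcs (base \<Gamma>)" "g \<in> carrier G" for e g
  proof -
    have fin: "finite (carrier (egroup \<Gamma> e))" using assms(5) that(1) by blast
    have eq: "inv\<^bsub>G\<^esub> g <#\<^bsub>G\<^esub> edge_subgroup \<Gamma> S e #>\<^bsub>G\<^esub> g =
        (\<lambda>x. inv\<^bsub>G\<^esub> g \<otimes>\<^bsub>G\<^esub> vertex_hom \<Gamma> S (tail (base \<Gamma>) e) (emb \<Gamma> e x) \<otimes>\<^bsub>G\<^esub> g) ` carrier (egroup \<Gamma> e)"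
      unfolding GE_alt l_coset_def r_coset_def by blast
    have "?c e g \<le> card (inv\<^bsub>G\<^esub> g <#\<^bsub>G\<^esub> edge_subgroup \<Gamma> S e #>\<^bsub>G\<^esub> g)"
      using fin unfolding eq by (intro card_mono) auto
    also have "\<dots> \<le> order (egroup \<Gamma> e)"
      unfolding eq order_def using fin by (rule card_image_le)
    also have "\<dots> \<le> m'" by (rule order_le[OF that(1)])
    finally show ?thesis .
  qed
  \<comment> \<open>\<open>Max\<close> is meaningful on finite sets only. Although \<open>g\<close>
    may range over an infinite group, the cardinalities are bounded by \<open>m'\<close>.\<close>
  have "{?c e g |e g. e \<in> arcs (base \<Gamma>) \<and> g \<in> carrier G} \<subseteq> {..m'}"
    using c_le_m' by auto
  then have fin: "finite {?c e g |e g. e \<in> arcs (base \<Gamma>) \<and> g \<in> carrier G}"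
    by (rule finite_subset) simp
  have c_le_m: "?c e g \<le> m" if "e \<in> arcs (base \<Gamma>)" "g \<in> carrier G" for e g
    unfolding m using fin by (rule Max_ge) (use that in blast)
  show ?thesis
    using Int_reduced_rank_le[OF assms(5-9) c_le_m] Int_reduced_rank_le[OF assms(5-9) c_le_m'] by blast
qed

end
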